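(* Let $(\Gamma,\mu)$ be a weighted graph satisfying $(p_0)$, (VD) and (TC). Then the following five conditions are equivalent (each condition means that there exist constants $C,\delta>0$, respectively $C>0$, respectively $c,C>0$ and $\beta>1$, depending only on $(\Gamma,\mu)$, such that the stated inequality holds for all $x,y\in\Gamma$, all $R>0$, all integers $n\ge1$, and all nonempty sets $D\subset A\subset B$, where $B=B(x,2R)$): (1) $\displaystyle \frac{\overline{E}(A)}{\overline{E}(B)}\le C\left(\frac{\mu(A)}{\mu(B)}\right)^{\delta}$; (2) $\displaystyle \frac{\lambda^{-1}(A)}{\lambda^{-1}(B)}\le C\left(\frac{\mu(A)}{\mu(B)}\right)^{\delta}$; (3) $\displaystyle \frac{\rho(D,A)}{\rho(x,R,2R)}\le C\left(\frac{\mu(A)}{\mu(D)}\right)^{\delta}\left(\frac{\mu(D)}{\mu(B)}\right)^{\delta-1}$; (4) $\displaystyle p_n(x,x)\le\frac{C}{V(x,e(x,n))}$; (5) $\displaystyle p_n(x,y)\le\frac{C}{V(x,e(x,n))}\exp\left(-c\left(\frac{E(x,d(x,y))}{n}\right)^{\frac1{\beta-1}}\right)$.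
   Context: $\Gamma$ is a countable infinite connected graph with symmetric weights $\mu_{x,y}=\mu_{y,x}>0$ on edges $x\sim y$ (and $\mu_{x,y}=0$ otherwise); $\mu(x)=\sum_{y\sim x}\mu_{x,y}$ and $\mu(A)=\sum_{y\in A}\mu(y)$. $d$ is the graph distance, $B(x,R)=\{y\in\Gamma: d(x,y)<R\}$, $V(x,R)=\mu(B(x,R))$. The pair $(\Gamma,\mu)$ is called a weighted graph. Random walk: $X_n$ is the Markov chain on $\Gamma$ with transition probabilities $P(x,y)=\mu_{x,y}/\mu(x)$; $P_n(x,y)=\mathbb P(X_n=y\mid X_0=x)$; the heat kernel is $p_n(x,y)=P_n(x,y)/\mu(y)$. Condition $(p_0)$: there is $p_0>0$ with $\mu_{x,y}/\mu(x)\ge p_0$ for all $x\sim y$. Exit times: $T_A=\min\{k\ge 0: X_k\in\Gamma\setminus A\}$, $E_x(A)=\mathbb E(T_A\mid X_0=x)$, $E(x,R)=E_x(B(x,R))$ (so $E(x,0)=0$), $\overline E(A)=\max_{x\in A}E_x(A)$. $e(x,n)=\min\{r\in\mathbb N: E(x,r)\ge n\}$ is the inverse of $E(x,\cdot)$. Dirichlet form: $\mathcal E(f,f)=\frac12\sum_{x,y\in\Gamma}\mu_{x,y}(f(x)-f(y))^2$, $(f,f)=\sum_x f(x)^2\mu(x)$. For finite nonempty $A$, $\lambda(A)=\inf\{\mathcal E(f,f)/(f,f): f\neq 0,\ f=0 \text{ outside } A\}$, and $\lambda^{-1}(A)=1/\lambda(A)$. Resistance: for disjoint sets $A_1,A_2$,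 $\rho(A_1,A_2)=\left(\inf\{\mathcal E(f,f): f|_{A_1}=1,\ f|_{A_2}=0\}\right)^{-1}$. For $D\subset A$, the notation $\rho(D,A)$ means $\rho(D,\Gamma\setminus A)$. For $0<r<R$, $\rho(x,r,R)=\rho(B(x,r),\Gamma\setminus B(x,R))$. (VD): there is $D_V>0$ with $V(x,2R)\le D_V V(x,R)$ for all $x\in\Gamma$, $R>0$. (TC): there is $C>1$ with $E(y,2R)\le C\,E(x,R)$ for all $x\in\Gamma$, $R>0$, $y\in B(x,R)$. *)

theory Defs
  imports "HOL-Probability.Probability"
begin

section \<open>Weighted graphs\<close>

definition adjacent :: "('v \<Rightarrow> 'v \<Rightarrow> real) \<Rightarrow> 'v \<Rightarrow> 'v \<Rightarrow> bool" where
  "adjacent w x y \<longleftrightarrow> w x y > 0"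

text \<open>The vertex set is the whole type \<open>'v\<close>; the edges are the pairs of positive weight, so the
  weight function determines the graph. Loops are not excluded. Summability of the weights at a
  vertex says that \<open>\<mu>(x)\<close> is finite, which is what makes \<open>P(x, y)\<close> a transition
  probability.\<close>

locale weighted_graph =
  fixes w :: "'v \<Rightarrow> 'v \<Rightarrow> real"
  assumes countable_vertices: "countable (UNIV :: 'v set)"
    and infinite_vertices: "infinite (UNIV :: 'v set)"
    and weight_nonneg: "w x y \<ge> 0"
    and weight_sym: "w x y = w y x"
    and weight_summable: "(\<lambda>y. w x y) summable_on UNIV"
    and connected: "(adjacent w)\<^sup>*\<^sup>* x y"

definition vertex_mass :: "('v \<Rightarrow> 'v \<Rightarrow> real) \<Rightarrow> 'v \<Rightarrow> real" where
  "vertex_mass w x = (\<Sum>\<^sub>\<infinity>y\<in>{y. adjacent w x y}. w x y)"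

definition mass :: "('v \<Rightarrow> 'v \<Rightarrow> real) \<Rightarrow> 'v set \<Rightarrow> real" where
  "mass w A = (\<Sum>\<^sub>\<infinity>y\<in>A. vertex_mass w y)"

definition graph_dist :: "('v \<Rightarrow> 'v \<Rightarrow> real) \<Rightarrow> 'v \<Rightarrow> 'v \<Rightarrow> nat" where
  "graph_dist w x y = (LEAST n. (adjacent w ^^ n) x y)"

definition graph_ball :: "('v \<Rightarrow> 'v \<Rightarrow> real) \<Rightarrow> 'v \<Rightarrow> real \<Rightarrow> 'v set" where
  "graph_ball w x R = {y. real (graph_dist w x y) < R}"

definition volume :: "('v \<Rightarrow> 'v \<Rightarrow> real) \<Rightarrow> 'v \<Rightarrow> real \<Rightarrow> real" where
  "volume w x R = mass w (graph_ball w x R)"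


section \<open>The random walk\<close>

definition trans_prob :: "('v \<Rightarrow> 'v \<Rightarrow> real) \<Rightarrow> 'v \<Rightarrow> 'v \<Rightarrow> real" where
  "trans_prob w x y = w x y / vertex_mass w x"

definition step_pmf :: "('v \<Rightarrow> 'v \<Rightarrow> real) \<Rightarrow> 'v \<Rightarrow> 'v pmf" where
  "step_pmf w x = embed_pmf (trans_prob w x)"

definition walk_kernel ::
  "('v \<Rightarrow> 'v \<Rightarrow> real) \<Rightarrow> 'v \<Rightarrow> nat \<Rightarrow> (nat \<Rightarrow> 'v) \<Rightarrow> 'v measure" where
  "walk_kernel w x n \<omega> =
     (case n of 0 \<Rightarrow> measure_pmf (return_pmf x) | Suc m \<Rightarrow> measure_pmf (step_pmf w (\<omega> m)))"

text \<open>The law on trajectories \<open>\<omega> = (X\<^sub>0, X\<^sub>1, \<dots>)\<close> of the chain started at \<open>x\<close>, obtained from the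
  Ionescu-Tulcea construction; the finite-dimensional distributions are computed in
  \<open>walk_law\<close> below.\<close>

definition walk :: "('v \<Rightarrow> 'v \<Rightarrow> real) \<Rightarrow> 'v \<Rightarrow> (nat \<Rightarrow> 'v) measure" where
  "walk w x = projective_family.lim UNIV
     (Ionescu_Tulcea.CI (walk_kernel w x) (\<lambda>_. count_space UNIV)) (\<lambda>_. count_space UNIV)"

definition n_step_prob :: "('v \<Rightarrow> 'v \<Rightarrow> real) \<Rightarrow> nat \<Rightarrow> 'v \<Rightarrow> 'v \<Rightarrow> real" where
  "n_step_prob w n x y = measure (walk w x) {\<omega> \<in> space (walk w x). \<omega> n = y}"

definition heat_kernel :: "('v \<Rightarrow> 'v \<Rightarrow> real) \<Rightarrow> nat \<Rightarrow> 'v \<Rightarrow> 'v \<Rightarrow> real" where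
  "heat_kernel w n x y = n_step_prob w n x y / vertex_mass w y"

definition exit_time :: "'v set \<Rightarrow> (nat \<Rightarrow> 'v) \<Rightarrow> enat" where
  "exit_time A \<omega> = Inf (enat ` {k. \<omega> k \<notin> A})"

text \<open>Only used for finite \<open>A\<close>, for which the expectation is finite (the graph being infinite and
  connected), so that no information is lost by passing to the reals.\<close>

definition mean_exit :: "('v \<Rightarrow> 'v \<Rightarrow> real) \<Rightarrow> 'v \<Rightarrow> 'v set \<Rightarrow> real" where
  "mean_exit w x A = enn2real (\<integral>\<^sup>+\<omega>. ennreal_of_enat (exit_time A \<omega>) \<partial>walk w x)"

definition mean_exit_ball :: "('v \<Rightarrow> 'v \<Rightarrow> real) \<Rightarrow> 'v \<Rightarrow> real \<Rightarrow> real" where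
  "mean_exit_ball w x R = mean_exit w x (graph_ball w x R)"

definition max_mean_exit :: "('v \<Rightarrow> 'v \<Rightarrow> real) \<Rightarrow> 'v set \<Rightarrow> real" where
  "max_mean_exit w A = Max ((\<lambda>x. mean_exit w x A) ` A)"

definition exit_radius :: "('v \<Rightarrow> 'v \<Rightarrow> real) \<Rightarrow> 'v \<Rightarrow> nat \<Rightarrow> nat" where
  "exit_radius w x n = (LEAST r. mean_exit_ball w x (real r) \<ge> real n)"


section \<open>Dirichlet form, eigenvalue and resistance\<close>

text \<open>The energy and the squared norm take values in \<open>[0, \<infinity>]\<close>, where infinite sums always make
  sense. This matters for the resistance, whose test functions are arbitrary. Eigenvalue and
  resistance are passed to the reals afterwards; they are only used where they are positive and
  finite, namely for finite nonempty \<open>A\<close>, and for a finite nonempty set against the complement of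
  a finite superset, respectively.\<close>

definition energy :: "('v \<Rightarrow> 'v \<Rightarrow> real) \<Rightarrow> ('v \<Rightarrow> real) \<Rightarrow> ennreal" where
  "energy w f = (\<Sum>\<^sub>\<infinity>(x, y)\<in>UNIV. ennreal (w x y * (f x - f y)\<^sup>2)) / 2"

definition sq_norm :: "('v \<Rightarrow> 'v \<Rightarrow> real) \<Rightarrow> ('v \<Rightarrow> real) \<Rightarrow> ennreal" where
  "sq_norm w f = (\<Sum>\<^sub>\<infinity>x\<in>UNIV. ennreal ((f x)\<^sup>2 * vertex_mass w x))"

definition eigenvalue :: "('v \<Rightarrow> 'v \<Rightarrow> real) \<Rightarrow> 'v set \<Rightarrow> real" where
  "eigenvalue w A =
     enn2real (INF f\<in>{f. f \<noteq> (\<lambda>_. 0) \<and> (\<forall>x. x \<notin> A \<longrightarrow> f x = 0)}. energy w f / sq_norm w f)"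

definition inv_eigenvalue :: "('v \<Rightarrow> 'v \<Rightarrow> real) \<Rightarrow> 'v set \<Rightarrow> real" where
  "inv_eigenvalue w A = 1 / eigenvalue w A"

definition resistance :: "('v \<Rightarrow> 'v \<Rightarrow> real) \<Rightarrow> 'v set \<Rightarrow> 'v set \<Rightarrow> real" where
  "resistance w A1 A2 =
     enn2real (inverse (INF f\<in>{f. (\<forall>x\<in>A1. f x = 1) \<and> (\<forall>x\<in>A2. f x = 0)}. energy w f))"

definition rel_resistance :: "('v \<Rightarrow> 'v \<Rightarrow> real) \<Rightarrow> 'v set \<Rightarrow> 'v set \<Rightarrow> real" where
  "rel_resistance w D A = resistance w D (UNIV - A)"

definition annulus_resistance :: "('v \<Rightarrow> 'v \<Rightarrow> real) \<Rightarrow> 'v \<Rightarrow> real \<Rightarrow> real \<Rightarrow> real" where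
  "annulus_resistance w x r R = resistance w (graph_ball w x r) (UNIV - graph_ball w x R)"


section \<open>Standing conditions\<close>

definition p0_condition :: "('v \<Rightarrow> 'v \<Rightarrow> real) \<Rightarrow> bool" where
  "p0_condition w \<longleftrightarrow>
     (\<exists>p0>0. \<forall>x y. adjacent w x y \<longrightarrow> w x y / vertex_mass w x \<ge> p0)"

definition volume_doubling :: "('v \<Rightarrow> 'v \<Rightarrow> real) \<Rightarrow> bool" where
  "volume_doubling w \<longleftrightarrow>
     (\<exists>DV>0. \<forall>x. \<forall>R>0. volume w x (2 * R) \<le> DV * volume w x R)"

definition time_comparison :: "('v \<Rightarrow> 'v \<Rightarrow> real) \<Rightarrow> bool" where
  "time_comparison w \<longleftrightarrow>
     (\<exists>C>1. \<forall>x. \<forall>R>0. \<forall>y\<in>graph_ball w x R.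
        mean_exit_ball w y (2 * R) \<le> C * mean_exit_ball w x R)"


section \<open>The five inequalities\<close>

definition mean_exit_ineq :: "('v \<Rightarrow> 'v \<Rightarrow> real) \<Rightarrow> bool" where
  "mean_exit_ineq w \<longleftrightarrow>
     (\<exists>C>0. \<exists>\<delta>>0. \<forall>x. \<forall>R>0. \<forall>A. A \<noteq> {} \<longrightarrow> A \<subseteq> graph_ball w x (2 * R) \<longrightarrow>
        max_mean_exit w A / max_mean_exit w (graph_ball w x (2 * R))
          \<le> C * (mass w A / mass w (graph_ball w x (2 * R))) powr \<delta>)"

definition eigenvalue_ineq :: "('v \<Rightarrow> 'v \<Rightarrow> real) \<Rightarrow> bool" where
  "eigenvalue_ineq w \<longleftrightarrow>
     (\<exists>C>0. \<exists>\<delta>>0. \<forall>x. \<forall>R>0. \<forall>A. A \<noteq> {} \<longrightarrow> A \<subseteq> graph_ball w x (2 * R) \<longrightarrow>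
        inv_eigenvalue w A / inv_eigenvalue w (graph_ball w x (2 * R))
          \<le> C * (mass w A / mass w (graph_ball w x (2 * R))) powr \<delta>)"

definition resistance_ineq :: "('v \<Rightarrow> 'v \<Rightarrow> real) \<Rightarrow> bool" where
  "resistance_ineq w \<longleftrightarrow>
     (\<exists>C>0. \<exists>\<delta>>0. \<forall>x. \<forall>R>0. \<forall>A D.
        D \<noteq> {} \<longrightarrow> D \<subseteq> A \<longrightarrow> A \<subseteq> graph_ball w x (2 * R) \<longrightarrow>
        rel_resistance w D A / annulus_resistance w x R (2 * R)
          \<le> C * (mass w A / mass w D) powr \<delta>
              * (mass w D / mass w (graph_ball w x (2 * R))) powr (\<delta> - 1))"

definition diagonal_upper_estimate :: "('v \<Rightarrow> 'v \<Rightarrow> real) \<Rightarrow> bool" where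
  "diagonal_upper_estimate w \<longleftrightarrow>
     (\<exists>C>0. \<forall>x. \<forall>n\<ge>1. heat_kernel w n x x \<le> C / volume w x (real (exit_radius w x n)))"

definition upper_estimate :: "('v \<Rightarrow> 'v \<Rightarrow> real) \<Rightarrow> bool" where
  "upper_estimate w \<longleftrightarrow>
     (\<exists>c>0. \<exists>C>0. \<exists>\<beta>>1. \<forall>x y. \<forall>n\<ge>1.
        heat_kernel w n x y \<le> C / volume w x (real (exit_radius w x n))
          * exp (- c * (mean_exit_ball w x (real (graph_dist w x y)) / real n)
                         powr (1 / (\<beta> - 1))))"


section \<open>The law of the random walk\<close>

interpretation walk: Ionescu_Tulcea "walk_kernel w x" "\<lambda>_. count_space UNIV"
  for w :: "'v \<Rightarrow> 'v \<Rightarrow> real" and x :: 'v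
proof (rule Ionescu_Tulcea.intro)
  fix i
  have K: "(\<lambda>v. measure_pmf (step_pmf w v))
      \<in> measurable (count_space UNIV) (subprob_algebra (count_space UNIV))"
    by (simp add: measure_pmf_in_subprob_algebra)
  show "walk_kernel w x i
      \<in> measurable (PiM {0..<i} (\<lambda>_. count_space UNIV)) (subprob_algebra (count_space UNIV))"
  proof (cases i)
    case 0
    have "(\<lambda>_. measure_pmf (return_pmf x))
      \<in> measurable (PiM {0..<i} (\<lambda>_. count_space UNIV)) (subprob_algebra (count_space UNIV))"
      by (intro measurable_const measure_pmf_in_subprob_algebra)
    then show ?thesis
      by (simp add: walk_kernel_def[abs_def] 0)
  next
    case (Suc m)
    have "(\<lambda>\<omega>. \<omega> m) \<in> measurable (PiM {0..<i} (\<lambda>_. count_space UNIV)) (count_space UNIV)"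
      using Suc by (intro measurable_component_singleton) auto
    from measurable_compose[OF this K] show ?thesis
      by (simp add: walk_kernel_def[abs_def] Suc)
  qed
next
  show "prob_space (walk_kernel w x i \<omega>)" for i \<omega>
    by (auto simp: walk_kernel_def measure_pmf.prob_space_axioms split: nat.split)
qed

lemma space_walk [simp]: "space (walk w x) = UNIV"
  by (auto simp: walk_def space_PiM)

lemma sets_walk [measurable_cong]: "sets (walk w x) = sets (PiM UNIV (\<lambda>_. count_space UNIV))"
  by (simp add: walk_def)

lemma emeasure_walk_path:
  "emeasure (walk w x) {\<omega>. \<forall>i\<le>n. \<omega> i = xs i} =
     (if xs 0 = x then \<Prod>i<n. ennreal (pmf (step_pmf w (xs i)) (xs (Suc i))) else 0)"
proof -
  let ?M = "\<lambda>_::nat. count_space (UNIV :: 'a set)"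
  let ?r = "\<lambda>m. restrict xs {0..<m}"
  let ?C = "\<lambda>m. walk.C w x 0 m (\<lambda>_. undefined)"
  have u: "(\<lambda>_. undefined) \<in> space (PiM {0..<0} ?M)"
    by (simp add: space_PiM)
  have r_space: "?r m \<in> space (PiM {0..<m} ?M)" for m
    by (auto simp: space_PiM)
  have r_sets: "{?r m} \<in> sets (PiM {0..<m} ?M)" for m
  proof -
    have "{?r m} = PiE {0..<m} (\<lambda>i. {xs i})"
      by (auto simp: PiE_iff extensional_def restrict_def fun_eq_iff)
    then show ?thesis
      by (metis (no_types, lifting) finite_atLeastLessThan sets_PiM_I_finite sets_count_space Pow_UNIV UNIV_I)
  qed
  have step: "emeasure (?C (Suc m)) {?r (Suc m)} =
      emeasure (?C m) {?r m} * emeasure (walk_kernel w x m (?r m)) {xs m}" for m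
  proof -
    have eP: "emeasure (walk.eP w x m \<omega>) {?r (Suc m)} =
        emeasure (walk_kernel w x m (?r m)) {xs m} * indicator {?r m} \<omega>"
      if \<omega>: "\<omega> \<in> space (PiM {0..<m} ?M)" for \<omega>
    proof -
      have "fun_upd \<omega> m v = ?r (Suc m) \<longleftrightarrow> v = xs m \<and> \<omega> = ?r m" for v
        using \<omega> by (force simp: space_PiM PiE_iff extensional_def restrict_def fun_eq_iff less_Suc_eq)
      then have "fun_upd \<omega> m -` {?r (Suc m)} \<inter> space (?M m) =
          (if \<omega> = ?r m then {xs m} else {})"
        by auto
      then show ?thesis
        by (simp add: walk.emeasure_eP[OF \<omega> r_sets])
    qed
    have "emeasure (?C (Suc m)) {?r (Suc m)} =
        (\<integral>\<^sup>+\<omega>. emeasure (walk.eP w x m \<omega>) {?r (Suc m)} \<partial>?C m)"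
      using walk.measurable_eP[of w x m] r_sets[of "Suc m"] walk.prob_space_C[OF u, of w x m]
      by (simp add: emeasure_bind[where N="PiM {0..<Suc m} ?M"] walk.space_C[OF u] prob_space.not_empty
           measurable_cong_sets[OF walk.sets_C[OF u] refl])
    also have "\<dots> = (\<integral>\<^sup>+\<omega>. emeasure (walk_kernel w x m (?r m)) {xs m} * indicator {?r m} \<omega> \<partial>?C m)"
      by (intro nn_integral_cong) (use eP walk.space_C[OF u, of w x m] in simp)
    also have "\<dots> = emeasure (walk_kernel w x m (?r m)) {xs m} * emeasure (?C m) {?r m}"
      using r_sets[of m] walk.sets_C[OF u, of w x m] by (subst nn_integral_cmult_indicator) auto
    finally show ?thesis
      by (simp add: mult.commute)
  qed
  have C: "emeasure (?C (Suc n)) {?r (Suc n)} =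
     (if xs 0 = x then \<Prod>i<n. ennreal (pmf (step_pmf w (xs i)) (xs (Suc i))) else 0)" for n
  proof (induction n)
    case 0
    have "emeasure (?C 0) {?r 0} = 1"
      by (simp add: emeasure_return PiM_empty restrict_def)
    then show ?case
      by (subst step) (auto simp: walk_kernel_def emeasure_pmf_single)
  next
    case (Suc n)
    show ?case
      by (subst step) (simp add: Suc walk_kernel_def emeasure_pmf_single del: walk.C.simps)
  qed
  have "{\<omega>. \<forall>i\<le>n. \<omega> i = xs i} = prod_emb UNIV ?M {0..<Suc n} {?r (Suc n)}"
    unfolding prod_emb_def by (auto simp: fun_eq_iff less_Suc_eq_le restrict_def split: if_splits)
  then have "emeasure (walk w x) {\<omega>. \<forall>i\<le>n. \<omega> i = xs i} = emeasure (walk.CI w x {0..<Suc n}) {?r (Suc n)}"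
    using walk.lim[OF _ r_sets, of "Suc n" w x] by (simp add: walk_def)
  also have "\<dots> = emeasure (?C (Suc n)) {?r (Suc n)}"
    by (subst walk.emeasure_CI[OF subset_refl r_sets])
       (simp add: prod_emb_id del: walk.C.simps; auto simp: prod_emb_def space_PiM restrict_def)
  finally show ?thesis
    using C by simp
qed

lemma prob_space_walk: "prob_space (walk w x)"
proof
  have "emeasure (walk w x) (prod_emb UNIV (\<lambda>_. count_space UNIV) {} (space (PiM {} (\<lambda>_. count_space UNIV))))
      = emeasure (walk.CI w x {}) (space (PiM {} (\<lambda>_. count_space UNIV)))"
    unfolding walk_def by (rule walk.lim) auto
  also have "\<dots> = 1"
    using prob_space.emeasure_space_1[OF walk.PF.prob_space_P[of "{}" w x]]
    by (simp add: walk.PF.space_P)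
  finally show "emeasure (walk w x) (space (walk w x)) = 1"
    by (simp add: prod_emb_def space_PiM vimage_def restrict_def)
qed

context weighted_graph
begin

lemma vertex_mass_eq: "vertex_mass w x = (\<Sum>\<^sub>\<infinity>y. w x y)"
  unfolding vertex_mass_def adjacent_def
  by (rule infsum_cong_neutral) (use weight_nonneg in \<open>auto simp: not_less intro: antisym\<close>)

lemma vertex_mass_pos: "vertex_mass w x > 0"
proof -
  obtain z where "z \<noteq> x"
    using infinite_vertices by (metis UNIV_I UNIV_eq_I finite.emptyI finite_insert insertI1)
  with connected[of x z] obtain y where y: "adjacent w x y"
    by (metis converse_rtranclpE)
  have "(\<Sum>\<^sub>\<infinity>y\<in>{y}. w x y) \<le> (\<Sum>\<^sub>\<infinity>y. w x y)"
    by (rule infsum_mono_neutral) (use weight_nonneg weight_summable in auto)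
  with y show ?thesis
    by (simp add: vertex_mass_eq adjacent_def)
qed

lemma pmf_step: "pmf (step_pmf w x) y = trans_prob w x y"
  unfolding step_pmf_def
proof (rule pmf_embed_pmf)
  show nonneg: "0 \<le> trans_prob w x y" for y
    using weight_nonneg vertex_mass_pos[of x] by (simp add: trans_prob_def)
  have "(\<lambda>y. w x y * inverse (vertex_mass w x)) summable_on UNIV"
    by (rule summable_on_cmult_left) (rule weight_summable)
  then have s: "trans_prob w x summable_on UNIV"
    by (simp add: trans_prob_def[abs_def] divide_inverse)
  have "(\<Sum>\<^sub>\<infinity>y. trans_prob w x y) = (\<Sum>\<^sub>\<infinity>y. w x y * inverse (vertex_mass w x))"
    by (simp add: trans_prob_def divide_inverse)
  also have "\<dots> = vertex_mass w x * inverse (vertex_mass w x)"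
    by (subst infsum_cmult_left) (use weight_summable in \<open>auto simp: vertex_mass_eq\<close>)
  finally have "(\<Sum>\<^sub>\<infinity>y. trans_prob w x y) = 1"
    using vertex_mass_pos[of x] by simp
  then show "(\<integral>\<^sup>+y. ennreal (trans_prob w x y) \<partial>count_space UNIV) = 1"
    using nn_integral_conv_infsetsum[of "trans_prob w x" UNIV] infsetsum_infsum[of "trans_prob w x" UNIV]
      nonneg s
    by (simp add: abs_summable_equivalent[symmetric])
qed

theorem walk_law:
  "measure (walk w x) {\<omega>. \<forall>i\<le>n. \<omega> i = xs i} =
     (if xs 0 = x then \<Prod>i<n. trans_prob w (xs i) (xs (Suc i)) else 0)"
proof -
  have nonneg: "0 \<le> trans_prob w u v" for u v
    using pmf_nonneg[of "step_pmf w u" v] by (simp add: pmf_step)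
  show ?thesis
    using nonneg by (simp add: measure_def emeasure_walk_path pmf_step prod_ennreal prod_nonneg)
qed

end

end

theory Submission
  imports Defs
begin

text \<open>With \<open>E\<close> and \<open>V\<close> as in the paper, (TC) makes the maximal mean exit time of a ball comparable to
  \<open>E(x, R)\<close>, and test functions built from the mean exit time \<open>u\<close> show that \<open>\<lambda>\<^sup>-\<^sup>1(B)\<close> and
  \<open>\<rho>(x, R, 2R) \<mu>(B)\<close> are comparable to it as well. Since \<open>\<rho>(D, A) \<mu>(D) \<le> \<lambda>\<^sup>-\<^sup>1(A)\<close> and \<open>\<lambda>\<^sup>-\<^sup>1(A)\<close> is at
  most the maximal mean exit time of \<open>A\<close>, (1) implies (2) and (2) implies (3). From (3) one returns to (1)
  by a De Giorgi iteration over the level sets of \<open>u\<close>.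

  For (2) \<open>\<Longrightarrow>\<close> (4), the Faber-Krahn inequality (2) gives a Nash inequality, hence a diagonal bound for
  the walk killed outside \<open>B(x, L e(x, n))\<close>. The paths leaving this ball contribute an exit probability,
  which is exponentially small in a power of \<open>L\<close>, times values of the heat kernel at earlier times
  near \<open>x\<close>, which cost only a power of \<open>L\<close>; so the bound closes by induction on time for \<open>L\<close> large.
  For (4) \<open>\<Longrightarrow>\<close> (5), split a path from \<open>x\<close> to \<open>y\<close> at half time: it leaves \<open>B(x, d/2)\<close> in the first half or,
  reversed, \<open>B(y, d/2)\<close> in the second. For (4) \<open>\<Longrightarrow>\<close> (1), choose \<open>n\<close> so large that \<open>\<mu>(A) p\<^sub>n \<le> 1/2\<close> on \<open>A\<close>; then
  the mean exit time is at most \<open>2n\<close>.\<close>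

section \<open>The graph metric\<close>

text \<open>Everything runs on finite sets: balls are finite by \<open>p0_condition\<close>, and the
  heat kernel at time \<open>n\<close> from \<open>x\<close> equals the density of the walk killed
  outside any finite set containing the closed \<open>n\<close>-ball. The L2 theory thus reduces to
  finite sums and the self-adjoint matrices \<open>killed A\<close>.

  The estimates (4) and (5) use volumes at the radius \<open>er x n\<close>, while (TC) bounds the
  growth of E(x, .) from above only, with exponent \<open>beta\<close>. Turning times into radii
  also needs power growth from below; its exponent \<open>gam\<close> is gained in
  \<open>E_step\<close>.

  On-diagonal values need not decrease in time, since P may have negative spectrum. Even times,
  where p_2m(x, x) is a squared norm, carry the bounds; odd times follow by one averaging step.

  A walk leaving B(x, R) crosses about k balls of radius R / k, with mean exit times at least of
  order E(x, R) / k^beta. Making these comparable to n gives k of order (E(x, R) / n)^(1 / beta) and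
  a tail exponentially small in k; hence the constant \<open>beta + 1\<close> in (5).\<close>

context weighted_graph begin

lemma adjacent_sym: "adjacent w x y \<longleftrightarrow> adjacent w y x"
  by (simp add: adjacent_def weight_sym)

lemma not_adjacent_iff: "\<not> adjacent w x y \<longleftrightarrow> w x y = 0"
  using weight_nonneg[of x y] by (auto simp: adjacent_def)

lemma trans_prob_nonneg: "trans_prob w x y \<ge> 0"
  using weight_nonneg vertex_mass_pos[of x] by (simp add: trans_prob_def)

lemma trans_prob_reversible: "vertex_mass w x * trans_prob w x y = w x y"
  using vertex_mass_pos[of x] by (simp add: trans_prob_def)

lemma trans_prob_eq_0: "\<not> adjacent w x y \<Longrightarrow> trans_prob w x y = 0"
  by (simp add: not_adjacent_iff trans_prob_def)

lemma sum_trans_prob_le_1: "finite S \<Longrightarrow> (\<Sum>y\<in>S. trans_prob w x y) \<le> 1"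
  using measure_measure_pmf_finite[of S "step_pmf w x"]
  by (metis measure_pmf.prob_le_1 pmf_step sum.cong)

lemma dist_path: "(adjacent w ^^ graph_dist w x y) x y"
proof -
  obtain n where "(adjacent w ^^ n) x y"
    using connected[of x y] rtranclp_imp_relpowp by metis
  then show ?thesis
    unfolding graph_dist_def by (rule LeastI)
qed

lemma dist_le: "(adjacent w ^^ n) x y \<Longrightarrow> graph_dist w x y \<le> n"
  unfolding graph_dist_def by (rule Least_le)

lemma dist_refl [simp]: "graph_dist w x x = 0"
  using dist_le[of 0 x x] by simp

lemma dist_eq_0_iff [simp]: "graph_dist w x y = 0 \<longleftrightarrow> x = y"
  using dist_path[of x y] by auto

lemma dist_triangle: "graph_dist w x z \<le> graph_dist w x y + graph_dist w y z"
  by (rule dist_le) (use dist_path[of x y] dist_path[of y z] in \<open>auto simp: relpowp_add\<close>)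

lemma dist_adjacent: "adjacent w x y \<Longrightarrow> graph_dist w x y \<le> 1"
  by (rule dist_le) auto

lemma relpowp_adjacent_sym: "(adjacent w ^^ n) x y \<Longrightarrow> (adjacent w ^^ n) y x"
proof (induction n arbitrary: y)
  case (Suc n)
  then obtain z where "(adjacent w ^^ n) x z" "adjacent w z y"
    by auto
  with Suc.IH show ?case
    by (metis adjacent_sym relpowp_Suc_I2)
qed auto

lemma dist_sym: "graph_dist w x y = graph_dist w y x"
  by (meson antisym dist_le dist_path relpowp_adjacent_sym)

lemma mem_ball: "y \<in> graph_ball w x R \<longleftrightarrow> real (graph_dist w x y) < R"
  by (simp add: graph_ball_def)

lemma centre_in_ball [simp]: "x \<in> graph_ball w x R \<longleftrightarrow> R > 0"
  by (simp add: mem_ball)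

lemma ball_mono: "R \<le> R' \<Longrightarrow> graph_ball w x R \<subseteq> graph_ball w x R'"
  by (auto simp: mem_ball)

lemma ball_subset_ball:
  assumes "real (graph_dist w x y) + R \<le> R'"
  shows "graph_ball w y R \<subseteq> graph_ball w x R'"
proof
  fix z assume "z \<in> graph_ball w y R"
  with assms dist_triangle[of x z y] show "z \<in> graph_ball w x R'"
    by (simp add: mem_ball)
qed

lemma ball_small: "0 < R \<Longrightarrow> R \<le> 1 \<Longrightarrow> graph_ball w x R = {x}"
proof -
  assume R: "0 < R" "R \<le> 1"
  have "y = x" if "real (graph_dist w x y) < R" for y
  proof -
    from that R have "graph_dist w x y = 0" by linarith
    then show ?thesis by simp
  qed
  with R show ?thesis by (auto simp: mem_ball)
qed

lemma ball_nonpos: "R \<le> 0 \<Longrightarrow> graph_ball w x R = {}"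
  by (auto simp: mem_ball)

end

section \<open>Local finiteness and finite volumes\<close>

locale bounded_prob_graph = weighted_graph w for w :: "'v \<Rightarrow> 'v \<Rightarrow> real" +
  fixes p0 :: real
  assumes p0_pos: "p0 > 0"
    and p0_le: "adjacent w x y \<Longrightarrow> w x y / vertex_mass w x \<ge> p0"
begin

definition nbrs :: "'v \<Rightarrow> 'v set" where
  "nbrs x = {y. adjacent w x y}"

lemma trans_prob_ge: "y \<in> nbrs x \<Longrightarrow> p0 \<le> trans_prob w x y"
  using p0_le by (simp add: nbrs_def trans_prob_def)

text \<open>Each neighbour receives transition probability at least \<open>p0\<close> out of a total
  of at most 1.\<close>

lemma finite_nbrs: "finite (nbrs x)"
proof (rule ccontr)
  assume "infinite (nbrs x)"
  then obtain F where F: "finite F" "card F = nat \<lceil>1 / p0\<rceil> + 1" "F \<subseteq> nbrs x"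
    using infinite_arbitrarily_large by blast
  have "real (card F) * p0 \<le> (\<Sum>y\<in>F. trans_prob w x y)"
    using F by (intro sum_bounded_below) (auto intro: trans_prob_ge)
  also have "\<dots> \<le> 1"
    using F sum_trans_prob_le_1 by simp
  finally have "real (card F) \<le> 1 / p0"
    using p0_pos by (simp add: field_simps)
  with F p0_pos show False
    by linarith
qed

lemma finite_closed_ball: "finite {y. graph_dist w x y \<le> n}"
proof (induction n)
  case (Suc n)
  have "{y. graph_dist w x y \<le> Suc n} \<subseteq> insert x (\<Union>z\<in>{y. graph_dist w x y \<le> n}. nbrs z)"
  proof
    fix y assume "y \<in> {y. graph_dist w x y \<le> Suc n}"
    then have y: "graph_dist w x y \<le> Suc n" by simp
    show "y \<in> insert x (\<Union>z\<in>{y. graph_dist w x y \<le> n}. nbrs z)"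
    proof (cases "graph_dist w x y")
      case (Suc k)
      with dist_path[of x y] obtain z where "(adjacent w ^^ k) x z" "adjacent w z y"
        by auto
      with dist_le[of k x z] Suc y show ?thesis
        by (auto simp: nbrs_def)
    qed auto
  qed
  with Suc.IH finite_nbrs show ?case
    by (meson finite_UN_I finite_insert finite_subset)
qed auto

lemma finite_ball [simp]: "finite (graph_ball w x R)"
proof (rule finite_subset)
  show "graph_ball w x R \<subseteq> {y. graph_dist w x y \<le> nat \<lceil>R\<rceil>}"
    by (auto simp: mem_ball) linarith
qed (rule finite_closed_ball)

lemma sum_trans_prob_eq_1:
  assumes "finite S" "nbrs x \<subseteq> S"
  shows "(\<Sum>y\<in>S. trans_prob w x y) = 1"
proof -
  have "measure_pmf.prob (step_pmf w x) S = 1"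
  proof (rule measure_pmf.prob_eq_1[THEN iffD2])
    show "AE y in measure_pmf (step_pmf w x). y \<in> S"
    proof (rule AE_pmfI)
      fix y assume "y \<in> set_pmf (step_pmf w x)"
      then have "adjacent w x y"
        using trans_prob_eq_0[of x y] by (auto simp: set_pmf_iff pmf_step)
      with assms show "y \<in> S"
        by (auto simp: nbrs_def)
    qed
  qed auto
  then show ?thesis
    using measure_measure_pmf_finite[of S "step_pmf w x"] assms by (simp add: pmf_step)
qed

lemma mass_finite: "finite A \<Longrightarrow> mass w A = (\<Sum>y\<in>A. vertex_mass w y)"
  by (simp add: mass_def)

lemma mass_mono: "finite B \<Longrightarrow> A \<subseteq> B \<Longrightarrow> mass w A \<le> mass w B"
  using vertex_mass_pos by (simp add: mass_finite finite_subset sum_mono2 less_imp_le)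

lemma mass_pos: "finite A \<Longrightarrow> A \<noteq> {} \<Longrightarrow> mass w A > 0"
  by (simp add: mass_finite sum_pos vertex_mass_pos)

lemma volume_mono: "R \<le> R' \<Longrightarrow> volume w x R \<le> volume w x R'"
  by (simp add: volume_def mass_mono ball_mono)

lemma volume_pos: "R > 0 \<Longrightarrow> volume w x R > 0"
  unfolding volume_def by (rule mass_pos) (simp, metis centre_in_ball empty_iff)

lemma volume_1: "volume w x 1 = vertex_mass w x"
  by (simp add: volume_def ball_small mass_finite)

end

section \<open>The killed walk and its transition density\<close>

context bounded_prob_graph begin

abbreviation \<mu> where "\<mu> \<equiv> vertex_mass w"
abbreviation P where "P \<equiv> trans_prob w"

text \<open>The transition matrix compressed to \<open>A\<close>; the value 0 outside
  \<open>A\<close> keeps every image supported in \<open>A\<close>, so iterating this operator means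
  taking powers of the compressed matrix.\<close>

definition killed :: "'v set \<Rightarrow> ('v \<Rightarrow> real) \<Rightarrow> 'v \<Rightarrow> real" where
  "killed A f x = (if x \<in> A then \<Sum>y\<in>A. P x y * f y else 0)"

definition ip :: "'v set \<Rightarrow> ('v \<Rightarrow> real) \<Rightarrow> ('v \<Rightarrow> real) \<Rightarrow> real" where
  "ip A f g = (\<Sum>x\<in>A. f x * g x * \<mu> x)"

text \<open>The transition density, with respect to \<mu>, of the walk killed outside
  \<open>A\<close>. The recursion acts on the end point; by reversibility this is the same as acting
  on the starting point.\<close>

definition hk :: "'v set \<Rightarrow> nat \<Rightarrow> 'v \<Rightarrow> 'v \<Rightarrow> real" where
  "hk A n x = (killed A ^^ n) (\<lambda>y. if y = x \<and> x \<in> A then 1 / \<mu> x else 0)"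

text \<open>The probability of staying in \<open>A\<close> at all times 0, ..., n
  (\<open>measure_walk_survival\<close>).\<close>

definition survival :: "'v set \<Rightarrow> nat \<Rightarrow> 'v \<Rightarrow> real" where
  "survival A n = (killed A ^^ n) (indicator A)"

lemma mu_pos [simp]: "\<mu> x > 0"
  by (rule vertex_mass_pos)

lemma mu_nonneg [simp]: "\<mu> x \<ge> 0"
  using mu_pos[of x] by linarith

lemma mu_nonzero [simp]: "\<mu> x \<noteq> 0"
  using mu_pos[of x] by linarith

lemma ip_sym: "ip A f g = ip A g f"
  by (simp add: ip_def mult_ac)

lemma ip_add_left: "ip A (\<lambda>x. f x + g x) h = ip A f h + ip A g h"
  by (simp add: ip_def algebra_simps sum.distrib)

lemma ip_diff_left: "ip A (\<lambda>x. f x - g x) h = ip A f h - ip A g h"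
  by (simp add: ip_def algebra_simps sum_subtractf)

lemma ip_add_right: "ip A h (\<lambda>x. f x + g x) = ip A h f + ip A h g"
  by (simp add: ip_def algebra_simps sum.distrib)

lemma ip_diff_right: "ip A h (\<lambda>x. f x - g x) = ip A h f - ip A h g"
  by (simp add: ip_def algebra_simps sum_subtractf)

lemma ip_cong:
  "(\<And>x. x \<in> A \<Longrightarrow> f x = f' x) \<Longrightarrow> (\<And>x. x \<in> A \<Longrightarrow> g x = g' x) \<Longrightarrow> ip A f g = ip A f' g'"
  by (simp add: ip_def)

lemma ip_mono:
  assumes "\<And>x. x \<in> A \<Longrightarrow> f x \<le> f' x" "\<And>x. x \<in> A \<Longrightarrow> 0 \<le> g x"
  shows "ip A f g \<le> ip A f' g"
  unfolding ip_def by (intro sum_mono mult_right_mono) (use assms in auto)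

lemma ip_self_nonneg: "0 \<le> ip A f f"
  unfolding ip_def by (intro sum_nonneg) (simp add: mult_nonneg_nonneg)

lemma ip_restrict:
  assumes "finite S" "A \<subseteq> S" "\<And>x. x \<in> S - A \<Longrightarrow> f x = 0"
  shows "ip S f g = ip A f g"
  unfolding ip_def by (rule sum.mono_neutral_right) (use assms in auto)

lemma Cauchy_Schwarz_ip: "ip A f g \<le> sqrt (ip A f f * ip A g g)"
proof -
  let ?f = "\<lambda>x. f x * sqrt (\<mu> x)" and ?g = "\<lambda>x. g x * sqrt (\<mu> x)"
  have "(\<Sum>x\<in>A. ?f x * ?g x)\<^sup>2 \<le> (\<Sum>x\<in>A. (?f x)\<^sup>2) * (\<Sum>x\<in>A. (?g x)\<^sup>2)"
    by (rule Cauchy_Schwarz_ineq_sum)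
  moreover have sq: "(c * sqrt (\<mu> x))\<^sup>2 = c * c * \<mu> x" for c x
    by (simp add: power_mult_distrib) (simp add: power2_eq_square)
  moreover have "(\<Sum>x\<in>A. ?f x * ?g x) = ip A f g"
    unfolding ip_def
    by (intro sum.cong refl) (simp add: algebra_simps real_sqrt_mult_self flip: real_sqrt_mult)
  moreover have "(\<Sum>x\<in>A. (?f x)\<^sup>2) = ip A f f" "(\<Sum>x\<in>A. (?g x)\<^sup>2) = ip A g g"
    by (simp_all add: ip_def sq)
  ultimately show ?thesis
    by (simp add: real_le_rsqrt)
qed

lemma killed_outside [simp]: "x \<notin> A \<Longrightarrow> killed A f x = 0"
  by (simp add: killed_def)

lemma killed_add: "killed A (\<lambda>y. f y + g y) x = killed A f x + killed A g x"
  by (simp add: killed_def algebra_simps sum.distrib)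

lemma killed_diff: "killed A (\<lambda>y. f y - g y) x = killed A f x - killed A g x"
  by (simp add: killed_def algebra_simps sum_subtractf)

lemma killed_cmult: "killed A (\<lambda>y. c * f y) x = c * killed A f x"
  by (simp add: killed_def sum_distrib_left mult_ac)

lemma killed_mono: "(\<And>y. y \<in> A \<Longrightarrow> f y \<le> g y) \<Longrightarrow> killed A f x \<le> killed A g x"
  unfolding killed_def by (auto intro!: sum_mono mult_left_mono trans_prob_nonneg)

lemma killed_nonneg: "(\<And>y. y \<in> A \<Longrightarrow> 0 \<le> f y) \<Longrightarrow> 0 \<le> killed A f x"
  unfolding killed_def by (auto intro!: sum_nonneg mult_nonneg_nonneg trans_prob_nonneg)

lemma killed_mono_set:
  assumes "finite B" "A \<subseteq> B" "\<And>y. y \<in> B \<Longrightarrow> 0 \<le> g y" "\<And>y. y \<in> A \<Longrightarrow> f y \<le> g y"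
  shows "killed A f x \<le> killed B g x"
proof (cases "x \<in> A")
  case True
  have "(\<Sum>y\<in>A. P x y * f y) \<le> (\<Sum>y\<in>A. P x y * g y)"
    using assms by (intro sum_mono mult_left_mono trans_prob_nonneg) auto
  also have "\<dots> \<le> (\<Sum>y\<in>B. P x y * g y)"
    using assms by (intro sum_mono2 mult_nonneg_nonneg trans_prob_nonneg) auto
  finally show ?thesis
    using True assms by (auto simp: killed_def)
next
  case False
  then show ?thesis
    using assms by (simp add: killed_nonneg)
qed

lemma killed_le_bound:
  assumes "finite A" "\<And>y. y \<in> A \<Longrightarrow> adjacent w x y \<Longrightarrow> f y \<le> M" "0 \<le> M"
  shows "killed A f x \<le> M"
proof (cases "x \<in> A")
  case True
  have "(\<Sum>y\<in>A. P x y * f y) \<le> (\<Sum>y\<in>A. P x y * M)"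
  proof (rule sum_mono)
    fix y assume "y \<in> A"
    with assms show "P x y * f y \<le> P x y * M"
      by (cases "adjacent w x y") (auto simp: trans_prob_eq_0 intro!: mult_left_mono trans_prob_nonneg)
  qed
  also have "\<dots> = (\<Sum>y\<in>A. P x y) * M"
    by (simp add: sum_distrib_right)
  also have "\<dots> \<le> 1 * M"
    using assms sum_trans_prob_le_1 by (intro mult_right_mono) auto
  finally show ?thesis
    using True by (simp add: killed_def)
qed (use assms in simp)

text \<open>Reversibility: \<mu>(x) P(x, y) = w(x, y) is symmetric.\<close>

lemma killed_selfadjoint: "ip A (killed A f) g = ip A f (killed A g)"
proof -
  have L: "ip A (killed A f) g = (\<Sum>x\<in>A. \<Sum>y\<in>A. w x y * f y * g x)" for f g
    unfolding ip_def
  proof (rule sum.cong[OF refl])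
    fix x assume "x \<in> A"
    then have "killed A f x * g x * \<mu> x = (\<Sum>y\<in>A. \<mu> x * P x y * f y * g x)"
      by (simp add: killed_def sum_distrib_left sum_distrib_right mult_ac)
    then show "killed A f x * g x * \<mu> x = (\<Sum>y\<in>A. w x y * f y * g x)"
      by (simp add: trans_prob_reversible)
  qed
  have "ip A f (killed A g) = (\<Sum>x\<in>A. \<Sum>y\<in>A. w x y * g y * f x)"
    by (subst ip_sym) (rule L)
  also have "\<dots> = (\<Sum>y\<in>A. \<Sum>x\<in>A. w x y * g y * f x)"
    by (rule sum.swap)
  also have "\<dots> = (\<Sum>x\<in>A. \<Sum>y\<in>A. w x y * f y * g x)"
    by (simp add: mult_ac weight_sym)
  finally show ?thesis
    using L by simp
qed

lemma killed_pow_selfadjoint: "ip A ((killed A ^^ n) f) g = ip A f ((killed A ^^ n) g)"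
proof (induction n arbitrary: f)
  case (Suc n)
  have "ip A ((killed A ^^ Suc n) f) g = ip A ((killed A ^^ n) (killed A f)) g"
    by (simp only: funpow_Suc_right comp_apply)
  also have "\<dots> = ip A (killed A f) ((killed A ^^ n) g)"
    by (rule Suc)
  also have "\<dots> = ip A f ((killed A ^^ Suc n) g)"
    by (simp add: killed_selfadjoint)
  finally show ?case .
qed simp

lemma hk_0: "hk A 0 x y = (if y = x \<and> x \<in> A then 1 / \<mu> x else 0)"
  by (simp add: hk_def)

lemma hk_Suc: "hk A (Suc n) x = killed A (hk A n x)"
  by (simp add: hk_def)

lemma hk_outside: "y \<notin> A \<Longrightarrow> hk A n x y = 0"
  by (cases n) (auto simp: hk_0 hk_Suc)

lemma hk_start_outside: "x \<notin> A \<Longrightarrow> hk A n x y = 0"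
  by (induction n arbitrary: y) (auto simp: hk_0 hk_Suc killed_def)

lemma hk_nonneg: "0 \<le> hk A n x y"
  by (induction n arbitrary: y) (auto simp: hk_0 hk_Suc intro: killed_nonneg)

lemma hk_mono_set: "finite B \<Longrightarrow> A \<subseteq> B \<Longrightarrow> hk A n x y \<le> hk B n x y"
  by (induction n arbitrary: y) (auto simp: hk_0 hk_Suc hk_nonneg intro!: killed_mono_set)

lemma ip_delta: "finite A \<Longrightarrow> y \<in> A \<Longrightarrow> ip A f (\<lambda>z. if z = y \<and> y \<in> A then 1 / \<mu> y else 0) = f y"
proof -
  assume "finite A" "y \<in> A"
  moreover have "f x * (if x = y \<and> y \<in> A then 1 / \<mu> y else 0) * \<mu> x = (if x = y then f y else 0)" for x
    using \<open>y \<in> A\<close> by simp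
  ultimately show ?thesis
    by (simp add: ip_def)
qed

text \<open>Chapman-Kolmogorov and symmetry in one: self-adjointness moves \<open>n\<close> powers
  onto \<open>hk A m x\<close>, and pairing with the point density at \<open>y\<close> evaluates the
  result there.\<close>

lemma ip_hk:
  assumes "finite A"
  shows "ip A (hk A m x) (hk A n y) = hk A (m + n) x y"
proof (cases "y \<in> A")
  case True
  have "ip A (hk A m x) (hk A n y)
      = ip A ((killed A ^^ n) (hk A m x)) (\<lambda>z. if z = y \<and> y \<in> A then 1 / \<mu> y else 0)"
    unfolding hk_def[of A n y] by (rule killed_pow_selfadjoint[symmetric])
  also have "\<dots> = (killed A ^^ n) (hk A m x) y"
    using assms True by (rule ip_delta)
  also have "\<dots> = hk A (m + n) x y"
    using funpow_add[of n m "killed A"] by (simp add: hk_def add.commute)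
  finally show ?thesis .
next
  case False
  then show ?thesis
    by (simp add: ip_def hk_outside hk_start_outside)
qed

text \<open>An even time splits into two equal halves, which makes the kernel an inner product open
  to Cauchy-Schwarz.\<close>

lemma hk_le_sqrt:
  assumes "finite A"
  shows "hk A (2 * l) x y \<le> sqrt (hk A (2 * l) x x * hk A (2 * l) y y)"
  using Cauchy_Schwarz_ip[of A "hk A l x" "hk A l y"] assms by (simp add: ip_hk mult_2)

lemma survival_0: "survival A 0 x = indicator A x"
  by (simp add: survival_def)

lemma survival_Suc: "survival A (Suc n) = killed A (survival A n)"
  by (simp add: survival_def)

lemma survival_outside [simp]: "x \<notin> A \<Longrightarrow> survival A n x = 0"
  by (cases n) (auto simp: survival_0 survival_Suc)

lemma survival_nonneg: "0 \<le> survival A n x"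
  by (induction n arbitrary: x) (auto simp: survival_0 survival_Suc intro: killed_nonneg)

lemma survival_le_1: "finite A \<Longrightarrow> survival A n x \<le> 1"
  by (induction n arbitrary: x) (auto simp: survival_0 survival_Suc indicator_def intro: killed_le_bound)

lemma survival_mono_set: "finite B \<Longrightarrow> A \<subseteq> B \<Longrightarrow> survival A n x \<le> survival B n x"
  by (induction n arbitrary: x)
     (auto simp: survival_0 survival_Suc survival_nonneg indicator_def intro!: killed_mono_set)

lemma survival_Suc_le: "finite A \<Longrightarrow> survival A (Suc n) x \<le> survival A n x"
proof (induction n arbitrary: x)
  case 0
  then show ?case
    using survival_le_1[of A 1 x] by (cases "x \<in> A") (auto simp: survival_0)
next
  case (Suc n)
  then show ?case
    unfolding survival_Suc[of A "Suc n"] survival_Suc[of A n] by (intro killed_mono) (simp add: survival_Suc)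
qed

lemma survival_antimono: "finite A \<Longrightarrow> m \<le> n \<Longrightarrow> survival A n x \<le> survival A m x"
  by (rule lift_Suc_antimono_le) (auto intro: survival_Suc_le)

lemma survival_eq_sum:
  assumes "finite A"
  shows "survival A n x = (\<Sum>y\<in>A. hk A n x y * \<mu> y)"
proof (cases "x \<in> A")
  case True
  have "(\<Sum>y\<in>A. hk A n x y * \<mu> y) = ip A (hk A n x) (indicator A)"
    by (simp add: ip_def)
  also have "\<dots> = ip A (\<lambda>z. if z = x \<and> x \<in> A then 1 / \<mu> x else 0) (survival A n)"
    unfolding hk_def survival_def by (rule killed_pow_selfadjoint)
  also have "\<dots> = survival A n x"
    using assms True by (subst ip_sym) (rule ip_delta)
  finally show ?thesis by simp
next
  case False
  then show ?thesis
    by (simp add: hk_start_outside)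
qed

text \<open>The walk moves by distance at most 1 per step.\<close>

lemma survival_eq_1:
  assumes "finite A" "{z. graph_dist w x z \<le> n} \<subseteq> A"
  shows "survival A n x = 1"
  using assms(2)
proof (induction n arbitrary: x)
  case 0
  then show ?case by (auto simp: survival_0)
next
  case (Suc n)
  have x: "x \<in> A"
    using Suc.prems by auto
  have nb: "nbrs x \<subseteq> A"
    using Suc.prems dist_adjacent[of x] by (force simp: nbrs_def)
  have "survival A n y = 1" if "y \<in> nbrs x" for y
  proof (rule Suc.IH)
    have "graph_dist w x z \<le> Suc n" if "graph_dist w y z \<le> n" for z
      using dist_triangle[of x z y] dist_adjacent[of x y] \<open>y \<in> nbrs x\<close> that by (simp add: nbrs_def)
    then show "{z. graph_dist w y z \<le> n} \<subseteq> A"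
      using Suc.prems by auto
  qed
  then have "survival A (Suc n) x = (\<Sum>y\<in>A. P x y * 1)"
    using x unfolding survival_Suc killed_def
    by (auto intro!: sum.cong) (metis mem_Collect_eq nbrs_def trans_prob_eq_0)
  also have "\<dots> = 1"
    using sum_trans_prob_eq_1[OF assms(1) nb] by simp
  finally show ?case .
qed

section \<open>The killed walk under the trajectory measure\<close>

lemma measurable_walk_component [measurable]:
  "(\<lambda>\<omega>. \<omega> i) \<in> measurable (walk w x) (count_space UNIV)"
  by measurable

lemma sets_walk_Collect_at: "{\<omega>. Q (\<omega> i)} \<in> sets (walk w x)"
proof -
  have "(\<lambda>\<omega>. \<omega> i) -` {v. Q v} \<inter> space (walk w x) \<in> sets (walk w x)"
    by (rule measurable_sets[OF measurable_walk_component]) simp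
  then show ?thesis by (simp add: vimage_def)
qed

lemma sets_walk_Collect_upto: "{\<omega>. \<forall>i\<le>n. Q i (\<omega> i)} \<in> sets (walk w x)"
proof -
  have "{\<omega>. \<forall>i\<le>n. Q i (\<omega> i)} = (\<Inter>i\<in>{..n}. {\<omega>. Q i (\<omega> i)})"
    by auto
  then show ?thesis
    by (auto intro!: sets.finite_INT sets_walk_Collect_at)
qed

interpretation walk_prob: prob_space "walk w x" for x
  by (rule prob_space_walk)

text \<open>Finiteness of \<open>A\<close> makes the event a finite disjoint union of cylinders, one
  for each path inside \<open>A\<close>, and \<open>walk_law\<close> computes each of them.\<close>

lemma walk_markov:
  assumes "finite A"
  shows "measure (walk w x) {\<omega>. (\<forall>i\<le>n. \<omega> i \<in> A) \<and> \<omega> n = z \<and> \<omega> (Suc n) = y}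
       = measure (walk w x) {\<omega>. (\<forall>i\<le>n. \<omega> i \<in> A) \<and> \<omega> n = z} * P z y"
proof -
  define I where "I = {xs \<in> {..n} \<rightarrow>\<^sub>E A. xs n = z}"
  have fin: "finite I"
    unfolding I_def using assms by (simp add: finite_PiE)
  let ?C = "\<lambda>xs. {\<omega>. \<forall>i\<le>n. \<omega> i = xs i}"
  let ?C' = "\<lambda>xs. {\<omega>. \<forall>i\<le>Suc n. \<omega> i = (xs(Suc n := y)) i}"
  have split: "\<omega> \<in> ?C (restrict \<omega> {..n})" for \<omega> :: "nat \<Rightarrow> 'v"
    by simp
  have E: "{\<omega>. (\<forall>i\<le>n. \<omega> i \<in> A) \<and> \<omega> n = z} = (\<Union>xs\<in>I. ?C xs)"
  proof (intro equalityI subsetI)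
    fix \<omega> assume "\<omega> \<in> {\<omega>. (\<forall>i\<le>n. \<omega> i \<in> A) \<and> \<omega> n = z}"
    then have "restrict \<omega> {..n} \<in> I"
      by (auto simp: I_def)
    with split show "\<omega> \<in> (\<Union>xs\<in>I. ?C xs)"
      by blast
  qed (auto simp: I_def)
  have E': "{\<omega>. (\<forall>i\<le>n. \<omega> i \<in> A) \<and> \<omega> n = z \<and> \<omega> (Suc n) = y} = (\<Union>xs\<in>I. ?C' xs)"
  proof (intro equalityI subsetI)
    fix \<omega> assume *: "\<omega> \<in> {\<omega>. (\<forall>i\<le>n. \<omega> i \<in> A) \<and> \<omega> n = z \<and> \<omega> (Suc n) = y}"
    then have "restrict \<omega> {..n} \<in> I"
      by (auto simp: I_def)
    moreover have "\<omega> \<in> ?C' (restrict \<omega> {..n})"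
      using * by (auto simp: le_Suc_eq)
    ultimately show "\<omega> \<in> (\<Union>xs\<in>I. ?C' xs)"
      by blast
  next
    fix \<omega> assume "\<omega> \<in> (\<Union>xs\<in>I. ?C' xs)"
    then obtain xs where xs: "xs \<in> I" "\<forall>i\<le>Suc n. \<omega> i = (xs(Suc n := y)) i"
      by auto
    then have "\<forall>i\<le>n. \<omega> i = xs i" "\<omega> (Suc n) = y"
      by (metis fun_upd_apply le_SucI not_less_eq_eq order_refl, metis fun_upd_same order_refl)
    with xs(1) show "\<omega> \<in> {\<omega>. (\<forall>i\<le>n. \<omega> i \<in> A) \<and> \<omega> n = z \<and> \<omega> (Suc n) = y}"
      by (auto simp: I_def)
  qed
  have ext: "xs = ys" if "xs \<in> I" "ys \<in> I" "\<forall>i\<le>n. xs i = ys i" for xs ys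
    using that by (intro PiE_ext[of xs "{..n}" "\<lambda>_. A" ys]) (auto simp: I_def)
  have disj: "disjoint_family_on ?C I"
    unfolding disjoint_family_on_def using ext by auto
  have sub: "?C' xs \<subseteq> ?C xs" for xs
  proof
    fix \<omega> assume "\<omega> \<in> ?C' xs"
    then show "\<omega> \<in> ?C xs"
      by auto
  qed
  have disj': "disjoint_family_on ?C' I"
    using disj sub unfolding disjoint_family_on_def by blast
  have step: "measure (walk w x) (?C' xs) = measure (walk w x) (?C xs) * P z y" if "xs \<in> I" for xs
  proof -
    have "(\<Prod>i<n. P ((xs(Suc n := y)) i) ((xs(Suc n := y)) (Suc i))) = (\<Prod>i<n. P (xs i) (xs (Suc i)))"
      by (intro prod.cong) auto
    then show ?thesis
      using that by (simp only: walk_law) (simp add: I_def)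
  qed
  have "measure (walk w x) (\<Union>xs\<in>I. ?C' xs) = (\<Sum>xs\<in>I. measure (walk w x) (?C' xs))"
    using fin disj' by (intro walk_prob.finite_measure_finite_Union) (auto simp del: fun_upd_apply intro: sets_walk_Collect_upto)
  also have "\<dots> = (\<Sum>xs\<in>I. measure (walk w x) (?C xs)) * P z y"
    by (simp add: step sum_distrib_right del: fun_upd_apply)
  also have "(\<Sum>xs\<in>I. measure (walk w x) (?C xs)) = measure (walk w x) (\<Union>xs\<in>I. ?C xs)"
    using fin disj by (intro walk_prob.finite_measure_finite_Union[symmetric]) (auto intro: sets_walk_Collect_upto)
  finally show ?thesis
    by (simp only: E E')
qed

text \<open>Split by the position before the last step; reversibility turns P(z, y) into P(y, z), so
  that \<open>killed A\<close> acts in the end point.\<close>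

lemma measure_walk_killed:
  assumes "finite A"
  shows "measure (walk w x) {\<omega>. (\<forall>i\<le>n. \<omega> i \<in> A) \<and> \<omega> n = y} = hk A n x y * \<mu> y"
proof (induction n arbitrary: y)
  case 0
  have "{\<omega> :: nat \<Rightarrow> 'v. (\<forall>i\<le>0. \<omega> i \<in> A) \<and> \<omega> 0 = y} = (if y \<in> A then {\<omega>. \<forall>i\<le>0. \<omega> i = (\<lambda>_. y) i} else {})"
    by auto
  then show ?case
    by (simp only: walk_law split: if_splits) (auto simp: hk_0)
next
  case (Suc n)
  show ?case
  proof (cases "y \<in> A")
    case True
    let ?F = "\<lambda>z. {\<omega>. (\<forall>i\<le>n. \<omega> i \<in> A) \<and> \<omega> n = z \<and> \<omega> (Suc n) = y}"
    have "{\<omega>. (\<forall>i\<le>Suc n. \<omega> i \<in> A) \<and> \<omega> (Suc n) = y} = (\<Union>z\<in>A. ?F z)"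
      using True by (auto simp: le_Suc_eq)
    moreover have "measure (walk w x) (\<Union>z\<in>A. ?F z) = (\<Sum>z\<in>A. measure (walk w x) (?F z))"
    proof (rule walk_prob.finite_measure_finite_Union)
      have "?F z = {\<omega>. \<forall>i\<le>Suc n. (i \<le> n \<longrightarrow> \<omega> i \<in> A) \<and> (i = n \<longrightarrow> \<omega> i = z) \<and> (i = Suc n \<longrightarrow> \<omega> i = y)}" for z
        by (auto simp: le_Suc_eq)
      then have "?F z \<in> sets (walk w x)" for z
        using sets_walk_Collect_upto[of "Suc n"
            "\<lambda>i v. (i \<le> n \<longrightarrow> v \<in> A) \<and> (i = n \<longrightarrow> v = z) \<and> (i = Suc n \<longrightarrow> v = y)"] by simp
      then show "?F ` A \<subseteq> sets (walk w x)"
        by auto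
    qed (use assms in \<open>auto simp: disjoint_family_on_def\<close>)
    moreover have "\<dots> = (\<Sum>z\<in>A. hk A n x z * \<mu> z * P z y)"
      by (simp add: walk_markov[OF assms] Suc)
    moreover have "\<dots> = hk A (Suc n) x y * \<mu> y"
    proof -
      have "hk A n x z * \<mu> z * P z y = P y z * hk A n x z * \<mu> y" for z
      proof -
        have "\<mu> z * P z y = \<mu> y * P y z"
          by (simp add: trans_prob_reversible weight_sym[of y z])
        then have "hk A n x z * (\<mu> z * P z y) = hk A n x z * (\<mu> y * P y z)"
          by (simp only:)
        then show ?thesis
          by (simp only: mult_ac)
      qed
      then have "(\<Sum>z\<in>A. hk A n x z * \<mu> z * P z y) = (\<Sum>z\<in>A. P y z * hk A n x z * \<mu> y)"
        by (simp only:)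
      also have "\<dots> = hk A (Suc n) x y * \<mu> y"
        using True by (simp add: hk_Suc killed_def sum_distrib_right)
      finally show ?thesis .
    qed
    ultimately show ?thesis by simp
  next
    case False
    then have "{\<omega>. (\<forall>i\<le>Suc n. \<omega> i \<in> A) \<and> \<omega> (Suc n) = y} = {}"
      by auto
    then have "measure (walk w x) {\<omega>. (\<forall>i\<le>Suc n. \<omega> i \<in> A) \<and> \<omega> (Suc n) = y} = 0"
      by (simp only: measure_empty)
    with False show ?thesis
      by (simp only: hk_outside mult_zero_left simp_thms)
  qed
qed

lemma measure_walk_survival:
  assumes "finite A"
  shows "measure (walk w x) {\<omega>. \<forall>i\<le>n. \<omega> i \<in> A} = survival A n x"
proof -
  let ?F = "\<lambda>y. {\<omega>. (\<forall>i\<le>n. \<omega> i \<in> A) \<and> \<omega> n = y}"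
  have "?F y = {\<omega>. \<forall>i\<le>n. \<omega> i \<in> A \<and> (i = n \<longrightarrow> \<omega> i = y)}" for y
    by auto
  then have "?F y \<in> sets (walk w x)" for y
    using sets_walk_Collect_upto[of n "\<lambda>i v. v \<in> A \<and> (i = n \<longrightarrow> v = y)"] by simp
  then have meas: "?F ` A \<subseteq> sets (walk w x)"
    by auto
  have "{\<omega>. \<forall>i\<le>n. \<omega> i \<in> A} = (\<Union>y\<in>A. ?F y)"
    by auto
  moreover have "measure (walk w x) (\<Union>y\<in>A. ?F y) = (\<Sum>y\<in>A. measure (walk w x) (?F y))"
    by (rule walk_prob.finite_measure_finite_Union) (use assms meas in \<open>auto simp: disjoint_family_on_def\<close>)
  ultimately show ?thesis
    by (simp add: measure_walk_killed[OF assms] survival_eq_sum[OF assms])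
qed

lemma hk_le_heat_kernel:
  assumes "finite A"
  shows "hk A n x y \<le> heat_kernel w n x y"
proof -
  have "hk A n x y * \<mu> y \<le> n_step_prob w n x y"
    unfolding measure_walk_killed[OF assms, symmetric] n_step_prob_def
    by (rule walk_prob.finite_measure_mono) (auto intro: sets_walk_Collect_at)
  then show ?thesis
    by (simp add: heat_kernel_def field_simps)
qed

text \<open>Killing outside a set that contains everything reachable in \<open>n\<close> steps has
  no effect.\<close>

lemma heat_kernel_eq_hk:
  assumes "finite A" "{z. graph_dist w x z \<le> n} \<subseteq> A"
  shows "heat_kernel w n x y = hk A n x y"
proof -
  have 1: "walk_prob.prob x {\<omega>. \<forall>i\<le>n. \<omega> i \<in> A} = 1"
    using survival_eq_1[OF assms] measure_walk_survival[OF assms(1)] by simp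
  have "walk_prob.prob x {\<omega>. \<omega> n = y} = walk_prob.prob x ({\<omega>. \<omega> n = y} \<inter> {\<omega>. \<forall>i\<le>n. \<omega> i \<in> A})"
    by (rule walk_prob.measure_space_inter[symmetric]) (use 1 walk_prob.prob_space[of x] in \<open>auto intro: sets_walk_Collect_at sets_walk_Collect_upto\<close>)
  also have "{\<omega>. \<omega> n = y} \<inter> {\<omega>. \<forall>i\<le>n. \<omega> i \<in> A} = {\<omega>. (\<forall>i\<le>n. \<omega> i \<in> A) \<and> \<omega> n = y}"
    by auto
  finally show ?thesis
    by (simp add: heat_kernel_def n_step_prob_def measure_walk_killed[OF assms(1)])
qed

lemma less_exit_time_iff: "enat n < exit_time A \<omega> \<longleftrightarrow> (\<forall>i\<le>n. \<omega> i \<in> A)"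
proof
  assume n: "enat n < exit_time A \<omega>"
  show "\<forall>i\<le>n. \<omega> i \<in> A"
  proof (intro allI impI, rule ccontr)
    fix i assume "i \<le> n" "\<omega> i \<notin> A"
    then have "exit_time A \<omega> \<le> enat i"
      unfolding exit_time_def by (intro Inf_lower) auto
    with n \<open>i \<le> n\<close> show False
      by (metis enat_ord_simps(1) leD order_trans)
  qed
next
  assume "\<forall>i\<le>n. \<omega> i \<in> A"
  then have "enat (Suc n) \<le> exit_time A \<omega>"
    unfolding exit_time_def by (intro Inf_greatest) (auto simp: not_le[symmetric] not_less_eq_eq)
  then show "enat n < exit_time A \<omega>"
    by (simp add: Suc_ile_eq)
qed

text \<open>An extended natural number is determined by the naturals below it, so the events
  \<open>enat n < exit_time A \<omega>\<close> suffice.\<close>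

lemma measurable_exit_time [measurable]: "exit_time A \<in> measurable (walk w x) (count_space UNIV)"
proof (subst measurable_count_space_eq2_countable, safe)
  fix e
  have eq: "exit_time A \<omega> = e \<longleftrightarrow> (\<forall>n. enat n < exit_time A \<omega> \<longleftrightarrow> enat n < e)" for \<omega>
  proof
    assume *: "\<forall>n. enat n < exit_time A \<omega> \<longleftrightarrow> enat n < e"
    have fin: "\<exists>k. a = enat k" if "a < b" for a b :: enat
      using that by (cases a) auto
    show "exit_time A \<omega> = e"
      using * fin[of "exit_time A \<omega>" e] fin[of e "exit_time A \<omega>"]
      by (cases "exit_time A \<omega>" e rule: linorder_cases) auto
  qed simp
  have "exit_time A -` {e} \<inter> space (walk w x) = (\<Inter>n. {\<omega>. enat n < exit_time A \<omega> \<longleftrightarrow> enat n < e})"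
    using eq by auto
  moreover have "{\<omega>. enat n < exit_time A \<omega> \<longleftrightarrow> enat n < e} \<in> sets (walk w x)" for n
  proof -
    have "{\<omega>. \<forall>i\<le>n. \<omega> i \<in> A} \<in> sets (walk w x)"
      by (rule sets_walk_Collect_upto)
    then have "{\<omega>. enat n < exit_time A \<omega>} \<in> sets (walk w x)"
      by (simp add: less_exit_time_iff)
    moreover from this have "- {\<omega>. enat n < exit_time A \<omega>} \<in> sets (walk w x)"
      using sets.compl_sets[of "{\<omega>. enat n < exit_time A \<omega>}" "walk w x"] by (simp add: Compl_eq_Diff_UNIV)
    ultimately show ?thesis
      by (cases "enat n < e") (simp_all add: Collect_neg_eq)
  qed
  ultimately show "exit_time A -` {e} \<inter> space (walk w x) \<in> sets (walk w x)"
    by (auto intro!: sets.countable_INT)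
qed auto

text \<open>Tail formula for the expectation of a variable with values in the extended
  naturals.\<close>

lemma mean_exit_eq_suminf:
  assumes "finite A"
  shows "mean_exit w x A = enn2real (\<Sum>n. ennreal (survival A n x))"
proof -
  have "(\<integral>\<^sup>+\<omega>. ennreal_of_enat (exit_time A \<omega>) \<partial>walk w x)
      = (\<Sum>n. emeasure (walk w x) {\<omega> \<in> space (walk w x). enat n < exit_time A \<omega>})"
    by (rule nn_integral_enat_function) measurable
  also have "\<dots> = (\<Sum>n. ennreal (survival A n x))"
    by (simp add: less_exit_time_iff walk_prob.emeasure_eq_measure measure_walk_survival[OF assms])
  finally show ?thesis
    by (simp add: mean_exit_def)
qed

end

section \<open>Mean exit times, Dirichlet forms and resistance\<close>

lemma ennreal_inverse_antimono: "a \<le> b \<Longrightarrow> inverse b \<le> inverse (a :: ennreal)"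
  including ennreal.lifting by transfer (rule ereal_inverse_antimono)

context bounded_prob_graph begin

section \<open>Geometric decay of survival and finite mean exit times\<close>

lemma survival_less_1_of_path:
  assumes "finite A" "z \<notin> A" "(adjacent w ^^ n) x z"
  shows "survival A n x < 1"
  using assms(3)
proof (induction n arbitrary: x)
  case 0
  with assms show ?case by (simp add: survival_0)
next
  case (Suc n)
  then obtain y where y: "adjacent w x y" "(adjacent w ^^ n) y z"
    by (meson relpowp_Suc_E2)
  show ?case
  proof (cases "x \<in> A")
    case True
    have "survival A (Suc n) x = (\<Sum>y\<in>A. P x y * survival A n y)"
      using True by (simp add: survival_Suc killed_def)
    also have "\<dots> = (\<Sum>y\<in>insert y A. P x y * survival A n y)"
      using assms(1) by (intro sum.mono_neutral_left) auto
    also have "\<dots> < (\<Sum>y\<in>insert y A. P x y)"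
    proof (rule sum_strict_mono_ex1)
      show "\<forall>v\<in>insert y A. P x v * survival A n v \<le> P x v"
        using survival_le_1[OF assms(1)] trans_prob_nonneg by (auto intro: mult_left_le)
      have "P x y > 0"
        using y(1) vertex_mass_pos[of x] by (simp add: trans_prob_def adjacent_def)
      with Suc.IH[OF y(2)] show "\<exists>v\<in>insert y A. P x v * survival A n v < P x v"
        by auto
    qed (use assms in auto)
    also have "\<dots> \<le> 1"
      using assms(1) by (intro sum_trans_prob_le_1) auto
    finally show ?thesis .
  qed simp
qed

text \<open>Finiteness of \<open>A\<close> gives one time at which every starting point has left
  with positive probability, and the maximum of finitely many numbers below 1 is below 1.\<close>

lemma survival_uniform_decay:
  assumes "finite A"
  shows "\<exists>N \<theta>. 0 \<le> \<theta> \<and> \<theta> < 1 \<and> (\<forall>x. survival A N x \<le> \<theta>)"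
proof -
  obtain z where z: "z \<notin> A"
    using assms infinite_vertices ex_new_if_finite by blast
  define N where "N = Max (insert 0 ((\<lambda>x. graph_dist w x z) ` A))"
  have lt: "survival A N x < 1" if "x \<in> A" for x
  proof -
    have "graph_dist w x z \<le> N"
      unfolding N_def using assms that by (intro Max_ge) auto
    then have "survival A N x \<le> survival A (graph_dist w x z) x"
      by (rule survival_antimono[OF assms])
    also have "\<dots> < 1"
      by (rule survival_less_1_of_path[OF assms z dist_path])
    finally show ?thesis .
  qed
  define \<theta> where "\<theta> = Max (insert 0 (survival A N ` A))"
  show ?thesis
  proof (intro exI conjI allI)
    show nonneg: "0 \<le> \<theta>" unfolding \<theta>_def using assms by (intro Max_ge) auto
    show "\<theta> < 1" unfolding \<theta>_def using assms lt by (subst Max_less_iff) auto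
    show "survival A N x \<le> \<theta>" for x
    proof (cases "x \<in> A")
      case True
      then show ?thesis unfolding \<theta>_def using assms by (intro Max_ge) auto
    next
      case False
      then show ?thesis using nonneg by simp
    qed
  qed
qed

lemma killed_pow_mono:
  "(\<And>y. f y \<le> g y) \<Longrightarrow> (killed A ^^ n) f x \<le> (killed A ^^ n) g x"
  by (induction n arbitrary: x) (auto intro: killed_mono)

lemma killed_pow_cmult: "(killed A ^^ n) (\<lambda>y. c * f y) x = c * (killed A ^^ n) f x"
proof (induction n arbitrary: x)
  case (Suc n)
  have "(killed A ^^ n) (\<lambda>y. c * f y) = (\<lambda>y. c * (killed A ^^ n) f y)"
    using Suc.IH by auto
  then show ?case
    by (simp add: killed_cmult)
qed simp

text \<open>\<open>N\<close> further steps multiply survival by at most \<theta>, so shifting the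
  partial sum S by \<open>N\<close> gives S <= N + \<theta> S.\<close>

lemma sum_survival_le:
  assumes "finite A" "0 \<le> \<theta>" "\<theta> < 1" "\<And>x. survival A N x \<le> \<theta>"
  shows "(\<Sum>n<m. survival A n x) \<le> N / (1 - \<theta>)"
proof -
  have step: "survival A (n + N) x \<le> \<theta> * survival A n x" for n
  proof -
    have "survival A (n + N) x = (killed A ^^ n) (survival A N) x"
      by (simp add: survival_def funpow_add)
    also have "\<dots> \<le> (killed A ^^ n) (\<lambda>y. \<theta> * indicator A y) x"
    proof (rule killed_pow_mono)
      show "survival A N y \<le> \<theta> * indicator A y" for y
        using assms(4)[of y] by (cases "y \<in> A") auto
    qed
    also have "\<dots> = \<theta> * survival A n x"
      by (simp add: killed_pow_cmult survival_def)
    finally show ?thesis .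
  qed
  let ?S = "\<Sum>n<m. survival A n x"
  have "?S \<le> (\<Sum>n<N + m. survival A n x)"
    by (intro sum_mono2) (auto simp: survival_nonneg)
  also have "\<dots> = (\<Sum>n<N. survival A n x) + (\<Sum>n<m. survival A (n + N) x)"
    by (induction m) (auto simp: add.commute)
  also have "\<dots> \<le> (\<Sum>n<N. 1) + (\<Sum>n<m. \<theta> * survival A n x)"
    by (intro add_mono sum_mono step survival_le_1 assms)
  also have "\<dots> = N + \<theta> * ?S"
    by (simp add: sum_distrib_left)
  finally show ?thesis
    using assms(3) by (simp add: field_simps)
qed

lemma summable_survival:
  assumes "finite A"
  shows "summable (\<lambda>n. survival A n x)"
proof -
  obtain N \<theta> where \<theta>: "0 \<le> \<theta>" "\<theta> < 1" and N: "\<And>x. survival A N x \<le> \<theta>"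
    using survival_uniform_decay[OF assms] by blast
  show ?thesis
    by (rule summableI_nonneg_bounded) (rule survival_nonneg, rule sum_survival_le[OF assms \<theta> N])
qed

lemma mean_exit_eq:
  assumes "finite A"
  shows "mean_exit w x A = (\<Sum>n. survival A n x)"
  unfolding mean_exit_eq_suminf[OF assms]
  using summable_survival[OF assms, of x]
  by (subst suminf_ennreal2) (auto simp: survival_nonneg suminf_nonneg)

lemma survival_tendsto_0: "finite A \<Longrightarrow> (\<lambda>n. survival A n x) \<longlonglongrightarrow> 0"
  by (rule summable_LIMSEQ_zero) (rule summable_survival)

lemma mean_exit_outside [simp]: "finite A \<Longrightarrow> x \<notin> A \<Longrightarrow> mean_exit w x A = 0"
  by (simp add: mean_exit_eq)

lemma mean_exit_nonneg: "mean_exit w x A \<ge> 0"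
  by (simp add: mean_exit_def)

lemma mean_exit_mono: "finite B \<Longrightarrow> A \<subseteq> B \<Longrightarrow> mean_exit w x A \<le> mean_exit w x B"
  by (simp add: mean_exit_eq finite_subset suminf_le summable_survival survival_mono_set)

lemma mean_exit_rec:
  assumes "finite A" "x \<in> A"
  shows "mean_exit w x A = 1 + killed A (\<lambda>y. mean_exit w y A) x"
proof -
  have "mean_exit w x A = (\<Sum>n. survival A (Suc n) x) + survival A 0 x"
    using suminf_split_head[OF summable_survival[OF assms(1)]] by (simp add: mean_exit_eq assms)
  also have "survival A 0 x = 1"
    using assms by (simp add: survival_0)
  also have "(\<Sum>n. survival A (Suc n) x) = (\<Sum>n. \<Sum>y\<in>A. P x y * survival A n y)"
    using assms by (simp add: survival_Suc killed_def)
  also have "\<dots> = (\<Sum>y\<in>A. \<Sum>n. P x y * survival A n y)"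
    by (rule suminf_sum) (intro summable_mult summable_survival assms)
  also have "\<dots> = (\<Sum>y\<in>A. P x y * mean_exit w y A)"
    by (simp add: suminf_mult summable_survival mean_exit_eq assms)
  finally show ?thesis
    using assms by (simp add: killed_def)
qed

lemma mean_exit_ge_1: "finite A \<Longrightarrow> x \<in> A \<Longrightarrow> 1 \<le> mean_exit w x A"
  by (subst mean_exit_rec) (auto intro: killed_nonneg mean_exit_nonneg)

lemma mean_exit_ge_survival:
  assumes "finite A"
  shows "(\<Sum>n<m. survival A n x) \<le> mean_exit w x A"
  unfolding mean_exit_eq[OF assms] by (rule sum_le_suminf) (auto simp: survival_nonneg summable_survival assms)

lemma mean_exit_le_of_survival:
  assumes "finite A" "\<And>x. survival A N x \<le> 1 / 2"
  shows "mean_exit w x A \<le> 2 * N"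
  unfolding mean_exit_eq[OF assms(1)]
  by (rule suminf_le_const[OF summable_survival[OF assms(1)]])
     (use sum_survival_le[OF assms(1) _ _ assms(2)] in \<open>simp add: mult.commute\<close>)

text \<open>A superharmonic function dominates its iterates under the killed walk; these are at
  least -M times the survival probability, which tends to 0.\<close>

lemma minimum_principle:
  assumes "finite A" "\<And>x. x \<in> A \<Longrightarrow> killed A g x \<le> g x" "x \<in> A"
  shows "0 \<le> g x"
proof -
  define M where "M = Max (insert 0 ((\<lambda>x. - g x) ` A))"
  have M: "- g x \<le> M" if "x \<in> A" for x
    unfolding M_def using assms(1) that by (intro Max_ge) auto
  have "- (M * survival A n x) \<le> g x" if "x \<in> A" for n x
    using that
  proof (induction n arbitrary: x)
    case 0
    then show ?case using M[of x] by (simp add: survival_0)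
  next
    case (Suc n)
    have "- (M * survival A (Suc n) x) = killed A (\<lambda>y. (- M) * survival A n y) x"
      by (simp only: killed_cmult survival_Suc)
    also have "\<dots> \<le> killed A g x"
      using Suc.IH by (intro killed_mono) simp
    also have "\<dots> \<le> g x"
      using assms(2) Suc.prems by simp
    finally show ?case .
  qed
  moreover have "(\<lambda>n. - (M * survival A n x)) \<longlonglongrightarrow> - (M * 0)"
    by (intro tendsto_intros survival_tendsto_0 assms)
  ultimately show ?thesis
    using assms(3) LIMSEQ_le_const2[of "\<lambda>n. - (M * survival A n x)" "- (M * 0)" "g x"] by auto
qed

lemma max_mean_exit_ge: "finite A \<Longrightarrow> x \<in> A \<Longrightarrow> mean_exit w x A \<le> max_mean_exit w A"
  unfolding max_mean_exit_def by (rule Max_ge) auto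

lemma max_mean_exit_le:
  "finite A \<Longrightarrow> A \<noteq> {} \<Longrightarrow> (\<And>x. x \<in> A \<Longrightarrow> mean_exit w x A \<le> M) \<Longrightarrow> max_mean_exit w A \<le> M"
  unfolding max_mean_exit_def by (subst Max_le_iff) auto

lemma max_mean_exit_ge_1: "finite A \<Longrightarrow> A \<noteq> {} \<Longrightarrow> 1 \<le> max_mean_exit w A"
  using max_mean_exit_ge[of A] mean_exit_ge_1[of A] by force

lemma max_mean_exit_mono:
  assumes "finite B" "A \<subseteq> B" "A \<noteq> {}"
  shows "max_mean_exit w A \<le> max_mean_exit w B"
proof (rule max_mean_exit_le)
  fix x assume "x \<in> A"
  have "mean_exit w x A \<le> mean_exit w x B"
    using assms by (intro mean_exit_mono)
  also have "\<dots> \<le> max_mean_exit w B"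
    using assms \<open>x \<in> A\<close> by (intro max_mean_exit_ge) auto
  finally show "mean_exit w x A \<le> max_mean_exit w B" .
qed (use assms finite_subset in auto)

section \<open>Dirichlet form, eigenvalue and resistance of finite sets\<close>

definition bil :: "'v set \<Rightarrow> ('v \<Rightarrow> real) \<Rightarrow> ('v \<Rightarrow> real) \<Rightarrow> real" where
  "bil S f g = (\<Sum>x\<in>S. \<Sum>y\<in>S. w x y * ((f x - f y) * (g x - g y))) / 2"

text \<open>Contains both ends of every edge along which a function vanishing outside
  \<open>A\<close> can change, so summing over it gives the full energy
  (\<open>energy_eq_form\<close>).\<close>

definition nbhd :: "'v set \<Rightarrow> 'v set" where
  "nbhd A = A \<union> (\<Union>x\<in>A. nbrs x)"

abbreviation form :: "'v set \<Rightarrow> ('v \<Rightarrow> real) \<Rightarrow> ('v \<Rightarrow> real) \<Rightarrow> real" where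
  "form A \<equiv> bil (nbhd A)"

lemma finite_nbhd: "finite A \<Longrightarrow> finite (nbhd A)"
  by (simp add: nbhd_def finite_nbrs)

lemma bil_nonneg: "0 \<le> bil S f f"
  unfolding bil_def
  by (intro divide_nonneg_pos sum_nonneg mult_nonneg_nonneg[OF weight_nonneg zero_le_square]) simp

lemma bil_lipschitz:
  assumes "\<And>a b. \<bar>\<phi> a - \<phi> b\<bar> \<le> \<bar>a - b\<bar>"
  shows "bil S (\<lambda>x. \<phi> (u x)) (\<lambda>x. \<phi> (u x)) \<le> bil S u u"
proof -
  have "(\<phi> a - \<phi> b) * (\<phi> a - \<phi> b) \<le> (a - b) * (a - b)" for a b
    using assms[of a b] by (simp add: abs_le_square_iff flip: power2_eq_square)
  then show ?thesis
    unfolding bil_def by (intro divide_right_mono sum_mono mult_left_mono[OF _ weight_nonneg]) auto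
qed

text \<open>For a nondecreasing contraction the energy of \<phi>(u) is controlled by its pairing
  with u itself, so that an equation satisfied by u can be used.\<close>

lemma bil_lipschitz_mono:
  assumes "\<And>a b. a \<le> b \<Longrightarrow> \<phi> a \<le> \<phi> b \<and> \<phi> b - \<phi> a \<le> b - a"
  shows "bil S (\<lambda>x. \<phi> (u x)) (\<lambda>x. \<phi> (u x)) \<le> bil S (\<lambda>x. \<phi> (u x)) u"
proof -
  have "(\<phi> a - \<phi> b) * (\<phi> a - \<phi> b) \<le> (\<phi> a - \<phi> b) * (a - b)" for a b
  proof (cases "a \<le> b")
    case True
    with assms[OF True] show ?thesis
      by (intro mult_left_mono_neg) auto
  next
    case False
    with assms[of b a] show ?thesis
      by (intro mult_left_mono) auto
  qed
  then show ?thesis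
    unfolding bil_def by (intro divide_right_mono sum_mono mult_left_mono[OF _ weight_nonneg]) auto
qed

text \<open>Green's formula: symmetry in x and y reduces the double sum to the terms carrying f(x),
  and transitions to points outside \<open>A\<close> enter only through the total probability
  1.\<close>

lemma form_eq_ip:
  assumes "finite A" "\<And>x. x \<notin> A \<Longrightarrow> f x = 0" "\<And>x. x \<notin> A \<Longrightarrow> g x = 0"
  shows "form A f g = ip A f g - ip A f (killed A g)"
proof -
  let ?S = "nbhd A"
  have fin: "finite ?S" using finite_nbhd assms(1) by simp
  have AS: "A \<subseteq> ?S" by (auto simp: nbhd_def)
  have sw: "(\<Sum>x\<in>?S. \<Sum>y\<in>?S. w x y * (f y * (g y - g x))) = (\<Sum>x\<in>?S. \<Sum>y\<in>?S. w x y * (f x * (g x - g y)))"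
    by (subst sum.swap) (simp add: weight_sym)
  have "2 * form A f g = (\<Sum>x\<in>?S. \<Sum>y\<in>?S. w x y * (f x * (g x - g y)) + w x y * (f y * (g y - g x)))"
    unfolding bil_def by (simp add: algebra_simps)
  also have "\<dots> = 2 * (\<Sum>x\<in>?S. \<Sum>y\<in>?S. w x y * (f x * (g x - g y)))"
    using sw by (simp add: sum.distrib)
  finally have "form A f g = (\<Sum>x\<in>?S. \<Sum>y\<in>?S. w x y * (f x * (g x - g y)))"
    by simp
  also have "\<dots> = (\<Sum>x\<in>A. \<Sum>y\<in>?S. w x y * (f x * (g x - g y)))"
    by (rule sum.mono_neutral_right) (use fin AS assms in auto)
  also have "\<dots> = (\<Sum>x\<in>A. f x * g x * \<mu> x - f x * killed A g x * \<mu> x)"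
  proof (rule sum.cong[OF refl])
    fix x assume x: "x \<in> A"
    have 1: "(\<Sum>y\<in>?S. P x y) = 1"
      by (rule sum_trans_prob_eq_1[OF fin]) (use x in \<open>auto simp: nbhd_def\<close>)
    have 2: "(\<Sum>y\<in>?S. P x y * g y) = killed A g x"
      unfolding killed_def using x by (simp, intro sum.mono_neutral_right) (use fin AS assms in auto)
    have "(\<Sum>y\<in>?S. w x y * (f x * (g x - g y))) = (\<Sum>y\<in>?S. \<mu> x * f x * (P x y * g x - P x y * g y))"
      by (intro sum.cong refl) (simp add: algebra_simps flip: trans_prob_reversible[of x])
    also have "\<dots> = \<mu> x * f x * ((\<Sum>y\<in>?S. P x y) * g x - (\<Sum>y\<in>?S. P x y * g y))"
      by (simp add: sum_distrib_left sum_distrib_right sum_subtractf algebra_simps)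
    also have "\<dots> = f x * g x * \<mu> x - f x * killed A g x * \<mu> x"
      using 1 2 by (simp add: algebra_simps)
    finally show "(\<Sum>y\<in>?S. w x y * (f x * (g x - g y))) = f x * g x * \<mu> x - f x * killed A g x * \<mu> x" .
  qed
  finally show ?thesis
    by (simp add: ip_def sum_subtractf)
qed

text \<open>Green's formula together with (I - P) u = 1 on \<open>A\<close>.\<close>

lemma form_mean_exit:
  assumes "finite A" "\<And>x. x \<notin> A \<Longrightarrow> f x = 0"
  shows "form A f (\<lambda>x. mean_exit w x A) = (\<Sum>x\<in>A. f x * \<mu> x)"
proof -
  have "form A f (\<lambda>x. mean_exit w x A) = ip A f (\<lambda>x. mean_exit w x A - killed A (\<lambda>x. mean_exit w x A) x)"
    using assms by (subst form_eq_ip) (auto simp: ip_diff_right)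
  also have "\<dots> = ip A f (\<lambda>_. 1)"
    using mean_exit_rec[OF assms(1)] by (intro ip_cong) auto
  finally show ?thesis
    by (simp add: ip_def)
qed

lemma energy_eq_form:
  assumes "finite A" "\<And>x. x \<notin> A \<Longrightarrow> f x = 0"
  shows "energy w f = ennreal (form A f f)"
proof -
  let ?S = "nbhd A" and ?h = "\<lambda>x y. w x y * ((f x - f y) * (f x - f y))"
  have fin: "finite (?S \<times> ?S)" using finite_nbhd assms(1) by simp
  have nn: "0 \<le> ?h x y" for x y by (simp add: weight_nonneg)
  have zero: "?h x y = 0" if "(x, y) \<notin> ?S \<times> ?S" for x y
  proof -
    have "x \<notin> A" "y \<notin> A" if "adjacent w x y"
      using that \<open>(x, y) \<notin> ?S \<times> ?S\<close> adjacent_sym[of x y] by (auto simp: nbhd_def nbrs_def)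
    then show ?thesis
      using assms(2) not_adjacent_iff[of x y] by (cases "adjacent w x y") auto
  qed
  have "(\<Sum>\<^sub>\<infinity>(x, y)\<in>UNIV. ennreal (w x y * (f x - f y)\<^sup>2)) = (\<Sum>\<^sub>\<infinity>(x, y)\<in>?S \<times> ?S. ennreal (?h x y))"
  proof (rule infsum_cong_neutral)
    fix p assume "p \<in> UNIV - ?S \<times> ?S"
    then show "(case p of (x, y) \<Rightarrow> ennreal (w x y * (f x - f y)\<^sup>2)) = 0"
      using zero[of "fst p" "snd p"] by (cases p) (auto simp: power2_eq_square)
  qed (auto simp: power2_eq_square)
  also have "\<dots> = (\<Sum>(x, y)\<in>?S \<times> ?S. ennreal (?h x y))"
    using fin by simp
  also have "\<dots> = ennreal (\<Sum>(x, y)\<in>?S \<times> ?S. ?h x y)"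
    unfolding case_prod_beta by (rule sum_ennreal) (use nn in auto)
  also have "(\<Sum>(x, y)\<in>?S \<times> ?S. ?h x y) = 2 * form A f f"
    by (simp add: bil_def sum.cartesian_product)
  finally have "energy w f = ennreal (2 * form A f f) / 2"
    by (simp add: energy_def)
  also have "\<dots> = ennreal (2 * form A f f / 2)"
    using bil_nonneg by (subst divide_ennreal[symmetric]) auto
  finally show ?thesis by simp
qed

lemma sq_norm_eq_ip:
  assumes "finite A" "\<And>x. x \<notin> A \<Longrightarrow> f x = 0"
  shows "sq_norm w f = ennreal (ip A f f)"
proof -
  have "sq_norm w f = (\<Sum>\<^sub>\<infinity>x\<in>A. ennreal (f x * f x * \<mu> x))"
    unfolding sq_norm_def by (rule infsum_cong_neutral) (use assms in \<open>auto simp: power2_eq_square\<close>)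
  also have "\<dots> = (\<Sum>x\<in>A. ennreal (f x * f x * \<mu> x))"
    using assms(1) by simp
  also have "\<dots> = ennreal (ip A f f)"
    unfolding ip_def by (rule sum_ennreal) (simp add: less_imp_le)
  finally show ?thesis .
qed

lemma ip_self_pos:
  assumes "finite A" "x \<in> A" "f x \<noteq> 0"
  shows "0 < ip A f f"
  unfolding ip_def
  by (rule sum_pos2[of _ x]) (use assms in \<open>auto simp: zero_less_mult_iff mult_nonneg_nonneg\<close>)

text \<open>Barta's argument: the mean exit time is a positive function with \<open>(I - P) u = 1\<close> on \<open>A\<close>.\<close>

lemma ip_le_form:
  assumes "finite A" "\<And>x. x \<notin> A \<Longrightarrow> f x = 0"
  shows "ip A f f \<le> max_mean_exit w A * form A f f"
proof (cases "A = {}")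
  case True
  with assms show ?thesis by (simp add: ip_def bil_def nbhd_def)
next
  case False
  define u where "u = (\<lambda>x. mean_exit w x A)"
  have u1: "1 \<le> u x" if "x \<in> A" for x
    using mean_exit_ge_1[OF assms(1) that] by (simp add: u_def)
  have uK: "killed A u x = u x - 1" if "x \<in> A" for x
    using mean_exit_rec[OF assms(1) that] by (simp add: u_def)
  let ?M = "max_mean_exit w A"
  have M: "1 \<le> ?M"
    using max_mean_exit_ge_1 assms(1) False by blast
  let ?a = "\<lambda>x y. w x y * (f x * f x * u y / u x)"
  \<comment> \<open>AM-GM with weights from u: summed against w(x, y), the mixed term is bounded by
    an expression in P u, which the equation for u evaluates.\<close>
  have two: "2 * (f x * f y) \<le> f x * f x * u y / u x + f y * f y * u x / u y" if "x \<in> A" "y \<in> A" for x y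
  proof -
    have p: "u x > 0" "u y > 0" using u1 that by force+
    have "0 \<le> (f x * u y - f y * u x)\<^sup>2 / (u x * u y)"
      using p by simp
    also have "\<dots> = f x * f x * u y / u x + f y * f y * u x / u y - 2 * (f x * f y)"
      using p by (simp add: field_simps power2_eq_square)
    finally show ?thesis by simp
  qed
  have "2 * ip A f (killed A f) = (\<Sum>x\<in>A. \<Sum>y\<in>A. w x y * (2 * (f x * f y)))"
    unfolding ip_def killed_def
    by (simp add: sum_distrib_left sum_distrib_right algebra_simps flip: trans_prob_reversible)
  also have "\<dots> \<le> (\<Sum>x\<in>A. \<Sum>y\<in>A. w x y * (f x * f x * u y / u x + f y * f y * u x / u y))"
    by (intro sum_mono mult_left_mono two weight_nonneg)
  also have "\<dots> = (\<Sum>x\<in>A. \<Sum>y\<in>A. ?a x y) + (\<Sum>x\<in>A. \<Sum>y\<in>A. ?a y x)"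
    by (simp add: distrib_left sum.distrib weight_sym)
  also have "(\<Sum>x\<in>A. \<Sum>y\<in>A. ?a y x) = (\<Sum>x\<in>A. \<Sum>y\<in>A. ?a x y)"
    by (rule sum.swap)
  also have "(\<Sum>x\<in>A. \<Sum>y\<in>A. ?a x y) = (\<Sum>x\<in>A. f x * f x * \<mu> x - f x * f x * \<mu> x / u x)"
  proof (rule sum.cong[OF refl])
    fix x assume x: "x \<in> A"
    have "(\<Sum>y\<in>A. ?a x y) = f x * f x * \<mu> x / u x * killed A u x"
      using x by (simp add: killed_def sum_distrib_left sum_divide_distrib algebra_simps flip: trans_prob_reversible[of x])
    also have "\<dots> = f x * f x * \<mu> x - f x * f x * \<mu> x / u x"
      unfolding uK[OF x] using u1[OF x] by (simp add: field_simps)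
    finally show "(\<Sum>y\<in>A. ?a x y) = f x * f x * \<mu> x - f x * f x * \<mu> x / u x" .
  qed
  finally have "ip A f (killed A f) \<le> ip A f f - (\<Sum>x\<in>A. f x * f x * \<mu> x / u x)"
    by (simp add: ip_def sum_subtractf)
  then have "(\<Sum>x\<in>A. f x * f x * \<mu> x / u x) \<le> form A f f"
    using assms by (simp add: form_eq_ip)
  moreover have "(\<Sum>x\<in>A. f x * f x * \<mu> x / ?M) \<le> (\<Sum>x\<in>A. f x * f x * \<mu> x / u x)"
  proof (intro sum_mono divide_left_mono)
    fix x assume x: "x \<in> A"
    show "u x \<le> ?M" unfolding u_def by (rule max_mean_exit_ge[OF assms(1) x])
    show "0 < ?M * u x" using M u1[OF x] by simp
  qed (simp add: less_imp_le)
  moreover have "(\<Sum>x\<in>A. f x * f x * \<mu> x / ?M) = ip A f f / ?M"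
    by (simp add: ip_def sum_divide_distrib)
  ultimately have "ip A f f / ?M \<le> form A f f" by simp
  with M show ?thesis
    by (simp add: field_simps)
qed

lemma eigenvalue_mult_ip_le:
  assumes "finite A" "\<And>x. x \<notin> A \<Longrightarrow> f x = 0"
  shows "eigenvalue w A * ip A f f \<le> form A f f"
proof (cases "f = (\<lambda>_. 0)")
  case True
  then show ?thesis by (simp add: ip_def bil_def)
next
  case False
  then obtain x where x: "f x \<noteq> 0" by auto
  with assms(2) have "x \<in> A" by blast
  then have pos: "0 < ip A f f" using ip_self_pos assms(1) x by blast
  have "eigenvalue w A \<le> enn2real (energy w f / sq_norm w f)"
    unfolding eigenvalue_def
  proof (rule enn2real_mono)
    show "(INF f\<in>{f. f \<noteq> (\<lambda>_. 0) \<and> (\<forall>x. x \<notin> A \<longrightarrow> f x = 0)}. energy w f / sq_norm w f) \<le> energy w f / sq_norm w f"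
      by (rule INF_lower) (use False assms(2) in auto)
    show "energy w f / sq_norm w f < top"
      using pos by (simp add: energy_eq_form[OF assms] sq_norm_eq_ip[OF assms] divide_ennreal bil_nonneg)
  qed
  also have "\<dots> = form A f f / ip A f f"
    using pos by (simp add: energy_eq_form[OF assms] sq_norm_eq_ip[OF assms] divide_ennreal bil_nonneg)
  finally show ?thesis
    using pos by (simp add: field_simps)
qed

lemma eigenvalue_ge:
  assumes "finite A" "A \<noteq> {}" "0 \<le> c"
    and "\<And>f. (\<And>x. x \<notin> A \<Longrightarrow> f x = 0) \<Longrightarrow> c * ip A f f \<le> form A f f"
  shows "c \<le> eigenvalue w A"
proof -
  let ?F = "{f. f \<noteq> (\<lambda>_. 0) \<and> (\<forall>x. x \<notin> A \<longrightarrow> f x = (0::real))}"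
  let ?I = "INF f\<in>?F. energy w f / sq_norm w f"
  have quot: "energy w f / sq_norm w f = ennreal (form A f f / ip A f f)" and pos: "0 < ip A f f" if "f \<in> ?F" for f
  proof -
    from that have z: "\<And>x. x \<notin> A \<Longrightarrow> f x = 0" and "f \<noteq> (\<lambda>_. 0)" by auto
    then obtain x where x: "f x \<noteq> 0" by auto
    with z have "x \<in> A" by blast
    then show pos: "0 < ip A f f" using ip_self_pos assms(1) x by blast
    show "energy w f / sq_norm w f = ennreal (form A f f / ip A f f)"
      using pos by (simp add: energy_eq_form[OF assms(1) z] sq_norm_eq_ip[OF assms(1) z] divide_ennreal bil_nonneg)
  qed
  have "ennreal c \<le> ?I"
  proof (rule INF_greatest)
    fix f assume f: "f \<in> ?F"
    then have "c * ip A f f \<le> form A f f" by (intro assms(4)) auto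
    then show "ennreal c \<le> energy w f / sq_norm w f"
      unfolding quot[OF f] using pos[OF f] by (intro ennreal_leI) (simp add: field_simps)
  qed
  moreover have "?I < top"
  proof -
    obtain x where "x \<in> A" using assms(2) by blast
    then have f: "indicator {x} \<in> ?F"
      by (auto simp: fun_eq_iff indicator_def)
    then have "?I \<le> energy w (indicator {x}) / sq_norm w (indicator {x})"
      by (rule INF_lower)
    also have "\<dots> < top" unfolding quot[OF f] by simp
    finally show ?thesis .
  qed
  ultimately have "enn2real (ennreal c) \<le> enn2real ?I"
    by (rule enn2real_mono)
  then show ?thesis
    using assms(3) by (simp add: eigenvalue_def)
qed

lemma inv_max_mean_exit_le_eigenvalue:
  assumes "finite A" "A \<noteq> {}"
  shows "1 / max_mean_exit w A \<le> eigenvalue w A"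
proof (rule eigenvalue_ge[OF assms])
  show "0 \<le> 1 / max_mean_exit w A" using max_mean_exit_ge_1[OF assms] by simp
  fix f :: "'v \<Rightarrow> real" assume "\<And>x. x \<notin> A \<Longrightarrow> f x = 0"
  from ip_le_form[OF assms(1) this] show "1 / max_mean_exit w A * ip A f f \<le> form A f f"
    using max_mean_exit_ge_1[OF assms] by (simp add: field_simps)
qed

lemma eigenvalue_pos: "finite A \<Longrightarrow> A \<noteq> {} \<Longrightarrow> 0 < eigenvalue w A"
  using inv_max_mean_exit_le_eigenvalue[of A] max_mean_exit_ge_1[of A]
  by (smt (verit) divide_pos_pos)

lemma inv_eigenvalue_pos: "finite A \<Longrightarrow> A \<noteq> {} \<Longrightarrow> 0 < inv_eigenvalue w A"
  by (simp add: inv_eigenvalue_def eigenvalue_pos)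

lemma inv_eigenvalue_le_max_mean_exit:
  assumes "finite A" "A \<noteq> {}"
  shows "inv_eigenvalue w A \<le> max_mean_exit w A"
  using inv_max_mean_exit_le_eigenvalue[OF assms] max_mean_exit_ge_1[OF assms] eigenvalue_pos[OF assms]
  by (simp add: inv_eigenvalue_def field_simps)

lemma mass_le_ip:
  assumes "finite A" "D \<subseteq> A" "\<And>x. x \<in> D \<Longrightarrow> f x = 1"
  shows "mass w D \<le> ip A f f"
proof -
  have "mass w D = (\<Sum>x\<in>D. f x * f x * \<mu> x)"
    using assms(3) by (simp add: mass_finite[OF finite_subset[OF assms(2,1)]])
  also have "\<dots> \<le> ip A f f"
    unfolding ip_def by (intro sum_mono2) (use assms in \<open>auto simp: less_imp_le\<close>)
  finally show ?thesis .
qed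

text \<open>An admissible f has squared norm at least \<mu>(D), hence energy at least \<lambda>(A)
  \<mu>(D). This positive bound also keeps the inverse of the infimum finite, so that
  \<open>enn2real\<close> loses nothing in the second claim.\<close>

lemma rel_resistance_bounds:
  assumes "finite A" "D \<subseteq> A" "D \<noteq> {}"
  shows rel_resistance_le: "rel_resistance w D A * mass w D \<le> inv_eigenvalue w A"
    and rel_resistance_ge: "\<And>f. (\<And>x. x \<in> D \<Longrightarrow> f x = 1) \<Longrightarrow> (\<And>x. x \<notin> A \<Longrightarrow> f x = 0) \<Longrightarrow>
      1 \<le> rel_resistance w D A * form A f f"
proof -
  let ?F = "{f. (\<forall>x\<in>D. f x = 1) \<and> (\<forall>x\<in>UNIV - A. f x = (0::real))}"
  let ?I = "INF f\<in>?F. energy w f"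
  define c where "c = eigenvalue w A * mass w D"
  have ne: "A \<noteq> {}" and finD: "finite D" using assms finite_subset by auto
  have c: "c > 0"
    unfolding c_def using eigenvalue_pos[OF assms(1) ne] mass_pos[OF finD assms(3)] by simp
  have low: "c \<le> form A f f" if "f \<in> ?F" for f
  proof -
    have "c \<le> eigenvalue w A * ip A f f"
      unfolding c_def using eigenvalue_pos[OF assms(1) ne] assms that
      by (intro mult_left_mono mass_le_ip) auto
    also have "\<dots> \<le> form A f f"
      using that by (intro eigenvalue_mult_ip_le[OF assms(1)]) auto
    finally show ?thesis .
  qed
  have I: "ennreal c \<le> ?I"
  proof (rule INF_greatest)
    fix f assume f: "f \<in> ?F"
    then have "energy w f = ennreal (form A f f)"
      by (intro energy_eq_form[OF assms(1)]) auto
    with low[OF f] show "ennreal c \<le> energy w f"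
      by (simp add: ennreal_leI)
  qed
  have inv: "inverse (ennreal r) = ennreal (1 / r)" if "r > 0" for r
    using that by (simp add: inverse_ennreal inverse_eq_divide)
  have Iinv: "inverse ?I \<le> ennreal (1 / c)"
    using ennreal_inverse_antimono[OF I] inv[OF c] by simp
  then have "rel_resistance w D A \<le> 1 / c"
    using enn2real_mono[OF Iinv] c by (simp add: rel_resistance_def resistance_def)
  then show "rel_resistance w D A * mass w D \<le> inv_eigenvalue w A"
    using mass_pos[OF finD assms(3)] eigenvalue_pos[OF assms(1) ne]
    by (simp add: c_def inv_eigenvalue_def field_simps)
  fix f :: "'v \<Rightarrow> real" assume f: "\<And>x. x \<in> D \<Longrightarrow> f x = 1" "\<And>x. x \<notin> A \<Longrightarrow> f x = 0"
  then have fF: "f \<in> ?F" by auto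
  have pos: "form A f f > 0" using low[OF fF] c by simp
  have "?I \<le> energy w f" by (rule INF_lower[OF fF])
  then have "?I \<le> ennreal (form A f f)"
    using energy_eq_form[OF assms(1) f(2)] by simp
  then have "ennreal (1 / form A f f) \<le> inverse ?I"
    using ennreal_inverse_antimono[of ?I "ennreal (form A f f)"] inv[OF pos] by simp
  moreover have "inverse ?I < top"
    using Iinv by (rule order_le_less_trans) simp
  ultimately have "enn2real (ennreal (1 / form A f f)) \<le> rel_resistance w D A"
    unfolding rel_resistance_def resistance_def by (rule enn2real_mono)
  then show "1 \<le> rel_resistance w D A * form A f f"
    using pos by (simp add: field_simps)
qed

end

section \<open>Consequences of the doubling conditions\<close>

text \<open>Doubling is applied ceil(log_2 (R / r)) times; rounding up costs the leading factor
  \<open>D\<close>.\<close>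

lemma power_growth:
  fixes F :: "real \<Rightarrow> real"
  assumes mono: "\<And>r R. 0 < r \<Longrightarrow> r \<le> R \<Longrightarrow> F r \<le> F R" and nonneg: "\<And>r. 0 < r \<Longrightarrow> 0 \<le> F r"
    and dbl: "\<And>r. 0 < r \<Longrightarrow> F (2 * r) \<le> D * F r" and D: "1 \<le> D" and r: "0 < r" "r \<le> R"
  shows "F R \<le> D * (R / r) powr log 2 D * F r"
proof -
  define k where "k = nat \<lceil>log 2 (R / r)\<rceil>"
  have q: "1 \<le> R / r" using r by simp
  then have l0: "0 \<le> log 2 (R / r)" by (subst zero_le_log_cancel_iff) auto
  have k: "log 2 (R / r) \<le> real k" "real k \<le> log 2 (R / r) + 1"
    using l0 unfolding k_def by linarith+
  have it: "F (2 ^ j * r) \<le> D ^ j * F r" for j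
  proof (induction j)
    case (Suc j)
    have "F (2 ^ Suc j * r) \<le> D * F (2 ^ j * r)"
      using dbl[of "2 ^ j * r"] r by (simp add: mult_ac)
    also have "\<dots> \<le> D * (D ^ j * F r)"
      using Suc D by (intro mult_left_mono) auto
    finally show ?case by (simp add: mult_ac)
  qed simp
  have "R / r = 2 powr log 2 (R / r)"
    using q by simp
  also have "\<dots> \<le> 2 powr real k"
    using k by (intro powr_mono) auto
  also have "\<dots> = 2 ^ k" by (simp add: powr_realpow)
  finally have "R \<le> 2 ^ k * r" using r by (simp add: field_simps)
  then have "F R \<le> F (2 ^ k * r)" using r by (intro mono) auto
  also have "\<dots> \<le> D ^ k * F r" by (rule it)
  also have "\<dots> \<le> D * (R / r) powr log 2 D * F r"
  proof (intro mult_right_mono nonneg r)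
    have "D ^ k = D powr real k" using D by (simp add: powr_realpow)
    also have "\<dots> \<le> D powr (log 2 (R / r) + 1)" using k D by (intro powr_mono) auto
    also have "\<dots> = D * D powr log 2 (R / r)" using D by (simp add: powr_add)
    also have "D powr log 2 (R / r) = (R / r) powr log 2 D"
      using D r by (simp add: powr_def log_def)
    finally show "D ^ k \<le> D * (R / r) powr log 2 D" .
  qed
  finally show ?thesis .
qed

text \<open>The number of steps is now rounded down, which puts the loss \<open>a\<close> on the
  side of \<open>F R\<close>. Growth is required from radius 1 on only, as balls of smaller radius
  are single vertices.\<close>

lemma power_growth_lower:
  fixes F :: "real \<Rightarrow> real"
  assumes mono: "\<And>r R. 0 < r \<Longrightarrow> r \<le> R \<Longrightarrow> F r \<le> F R" and nonneg: "\<And>r. 0 < r \<Longrightarrow> 0 \<le> F r"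
    and grow: "\<And>r. 1 \<le> r \<Longrightarrow> a * F r \<le> F (4 * r)" and a: "1 < a" and r: "1 \<le> r" "r \<le> R"
  shows "(R / r) powr log 4 a * F r \<le> a * F R"
proof -
  define k where "k = nat \<lfloor>log 4 (R / r)\<rfloor>"
  have q: "1 \<le> R / r" using r by simp
  then have l0: "0 \<le> log 4 (R / r)" by (subst zero_le_log_cancel_iff) auto
  have k: "log 4 (R / r) \<le> real k + 1" "real k \<le> log 4 (R / r)"
    using l0 unfolding k_def by linarith+
  have it: "a ^ j * F r \<le> F (4 ^ j * r)" for j
  proof (induction j)
    case (Suc j)
    have "a ^ Suc j * F r = a * (a ^ j * F r)" by simp
    also have "\<dots> \<le> a * F (4 ^ j * r)"
      using Suc a by (intro mult_left_mono) auto
    also have "\<dots> \<le> F (4 * (4 ^ j * r))"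
    proof (rule grow)
      have "1 * 1 \<le> 4 ^ j * r" using r by (intro mult_mono) auto
      then show "1 \<le> 4 ^ j * r" by simp
    qed
    finally show ?case by (simp add: mult_ac)
  qed simp
  have "4 ^ k = 4 powr real k" by (simp add: powr_realpow)
  also have "\<dots> \<le> 4 powr log 4 (R / r)" using k by (intro powr_mono) auto
  also have "\<dots> = R / r" using q by simp
  finally have "4 ^ k * r \<le> R" using r by (simp add: field_simps)
  then have le: "F (4 ^ k * r) \<le> F R" using r by (intro mono) auto
  have "(R / r) powr log 4 a = a powr log 4 (R / r)"
    using a r by (simp add: powr_def log_def)
  also have "\<dots> \<le> a powr (real k + 1)" using k a by (intro powr_mono) auto
  also have "\<dots> = a * a ^ k" using a by (simp add: powr_add powr_realpow)
  finally have "(R / r) powr log 4 a * F r \<le> a * a ^ k * F r"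
    using nonneg[of r] r by (intro mult_right_mono) auto
  also have "\<dots> \<le> a * F R"
    using it[of k] le a by simp
  finally show ?thesis .
qed

text \<open>Both constants may be enlarged, so lower bounds of 2 cost nothing; they make
  \<open>alpha\<close> and \<open>beta\<close> at least 1.\<close>

locale doubling_graph = bounded_prob_graph w p0
  for w :: "'v \<Rightarrow> 'v \<Rightarrow> real" and p0 :: real +
  fixes DV CT :: real
  assumes DV_ge: "2 \<le> DV"
    and CT_ge: "2 \<le> CT"
    and VD: "0 < R \<Longrightarrow> volume w x (2 * R) \<le> DV * volume w x R"
    and TC: "0 < R \<Longrightarrow> y \<in> graph_ball w x R \<Longrightarrow> mean_exit_ball w y (2 * R) \<le> CT * mean_exit_ball w x R"
begin

abbreviation ball where "ball \<equiv> graph_ball w"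
abbreviation V where "V \<equiv> volume w"
abbreviation E where "E \<equiv> mean_exit_ball w"

text \<open>Growth exponents: \<open>alpha\<close> for V from above, \<open>beta\<close> for E from
  above, \<open>gam\<close> for E from below, where E gains the factor \<open>step_gain\<close>
  whenever the radius is multiplied by 4.\<close>

definition alpha :: real where "alpha = log 2 DV"
definition beta :: real where "beta = log 2 CT"
definition step_gain :: real where "step_gain = 1 + 1 / CT"
definition gam :: real where "gam = log 4 step_gain"

lemma alpha_ge_1: "1 \<le> alpha"
  using DV_ge by (simp add: alpha_def le_log_iff)

lemma beta_ge_1: "1 \<le> beta"
  using CT_ge by (simp add: beta_def le_log_iff)

lemma step_gain: "1 < step_gain" "step_gain \<le> 2"
  using CT_ge by (auto simp: step_gain_def)

lemma gam_pos: "0 < gam"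
  using step_gain by (simp add: gam_def)

lemma E_mono: "r \<le> R \<Longrightarrow> E x r \<le> E x R"
  by (simp add: mean_exit_ball_def mean_exit_mono ball_mono)

lemma E_nonneg: "0 \<le> E x R"
  by (simp add: mean_exit_ball_def mean_exit_nonneg)

lemma E_ge_1: "0 < R \<Longrightarrow> 1 \<le> E x R"
  by (simp add: mean_exit_ball_def mean_exit_ge_1)

lemma E_pos: "0 < R \<Longrightarrow> 0 < E x R"
  using E_ge_1[of R x] by simp

lemma E_nonpos: "R \<le> 0 \<Longrightarrow> E x R = 0"
  by (simp add: mean_exit_ball_def ball_nonpos)

lemma E_doubling: "0 < R \<Longrightarrow> E x (2 * R) \<le> CT * E x R"
  by (rule TC) auto

lemma E_near: "real (graph_dist w x y) < R \<Longrightarrow> E y (2 * R) \<le> CT * E x R"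
  by (rule TC) (auto simp: mem_ball intro: le_less_trans[of 0])

lemma V_growth: "0 < r \<Longrightarrow> r \<le> R \<Longrightarrow> V x R \<le> DV * (R / r) powr alpha * V x r"
  unfolding alpha_def
  by (rule power_growth) (use DV_ge VD volume_mono volume_pos in \<open>auto intro: less_imp_le\<close>)

lemma E_growth: "0 < r \<Longrightarrow> r \<le> R \<Longrightarrow> E x R \<le> CT * (R / r) powr beta * E x r"
  unfolding beta_def
  by (rule power_growth) (use CT_ge E_doubling E_mono E_nonneg in auto)

text \<open>Loops are the only delay at a single vertex, and connectedness gives a neighbour other
  than \<open>x\<close>, so each step leaves \<open>x\<close> with probability at least
  \<open>p0\<close>.\<close>

lemma E_1: "E x 1 \<le> 1 / p0"
proof -
  obtain z where z: "z \<noteq> x"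
    using ex_new_if_finite[of "{x}"] infinite_vertices by auto
  have "\<exists>y. adjacent w x y \<and> y \<noteq> x"
  proof (rule ccontr)
    assume no: "\<not> (\<exists>y. adjacent w x y \<and> y \<noteq> x)"
    have "y = x" if "(adjacent w)\<^sup>*\<^sup>* x y" for y
      using that by (induction) (use no in auto)
    with connected[of x z] z show False by auto
  qed
  then obtain y where y: "adjacent w x y" "y \<noteq> x" by auto
  have "P x x + P x y \<le> 1"
    using sum_trans_prob_le_1[of "{x, y}" x] y by simp
  moreover have "p0 \<le> P x y"
    using y trans_prob_ge by (simp add: nbrs_def)
  ultimately have p: "p0 \<le> 1 - P x x" by simp
  have b: "ball x 1 = {x}" by (simp add: ball_small)
  have "E x 1 = 1 + P x x * E x 1"
    using mean_exit_rec[of "{x}" x] by (simp add: mean_exit_ball_def b killed_def)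
  then have "(1 - P x x) * E x 1 = 1" by (simp add: algebra_simps)
  moreover have "p0 * E x 1 \<le> (1 - P x x) * E x 1"
    using p E_nonneg by (intro mult_right_mono)
  ultimately show ?thesis
    using p0_pos by (simp add: field_simps)
qed

text \<open>The strong Markov property in analytic form: after leaving B(x, R) the walk still needs
  mean time at least \<open>c\<close> to leave B(x, 4R). On the smaller ball, the difference of the
  two exit functions minus \<open>c\<close> is superharmonic, because \<open>c\<close> bounds the
  larger one from below at all neighbours.\<close>

lemma E_step:
  assumes R: "1 \<le> R"
  shows "step_gain * E x R \<le> E x (4 * R)"
proof -
  let ?A = "ball x R" and ?B = "ball x (4 * R)"
  define c where "c = E x R / CT"
  define u v where "u = (\<lambda>y. mean_exit w y ?B)" and "v = (\<lambda>y. mean_exit w y ?A)"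
  have AB: "?A \<subseteq> ?B" using R by (intro ball_mono) auto
  \<comment> \<open>\<open>z\<close> is within 2R of \<open>x\<close>, so B(z, 2R) lies in B(x, 4R),
    while (TC) bounds E(x, 4R) by CT E(z, 2R).\<close>
  have far: "c \<le> u z" and zB: "z \<in> ?B" if "y \<in> ?A" "adjacent w y z" for y z
  proof -
    have d: "real (graph_dist w x z) < 2 * R"
      using dist_triangle[of x z y] dist_adjacent[OF that(2)] that(1) R by (simp add: mem_ball)
    have "E x R \<le> E x (2 * (2 * R))" using R by (intro E_mono) auto
    also have "\<dots> \<le> CT * E z (2 * R)"
      using d by (intro E_near) (simp add: dist_sym)
    finally have "c \<le> E z (2 * R)"
      using CT_ge by (simp add: c_def field_simps)
    also have "\<dots> \<le> u z"
      unfolding u_def mean_exit_ball_def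
      using d by (intro mean_exit_mono ball_subset_ball) auto
    finally show "c \<le> u z" .
    show "z \<in> ?B" using d R by (auto simp: mem_ball)
  qed
  have "0 \<le> u x - v x - c"
  proof (rule minimum_principle[of ?A "\<lambda>y. u y - v y - c"])
    fix y assume y: "y \<in> ?A"
    have nb: "nbrs y \<subseteq> ?B" using zB[OF y] by (auto simp: nbrs_def)
    have "(\<Sum>z\<in>?B. P y z * (u z - c)) = (\<Sum>z\<in>?B. P y z * u z) - c * (\<Sum>z\<in>?B. P y z)"
      by (simp add: algebra_simps sum_subtractf sum_distrib_left)
    also have "\<dots> = u y - 1 - c"
      using mean_exit_rec[of ?B y] y AB sum_trans_prob_eq_1[OF _ nb] by (auto simp: u_def killed_def)
    finally have 1: "(\<Sum>z\<in>?B. P y z * (u z - c)) = u y - 1 - c" .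
    have "(\<Sum>z\<in>?A. P y z * (u z - c)) \<le> (\<Sum>z\<in>?B. P y z * (u z - c))"
    proof (rule sum_mono2)
      fix z assume "z \<in> ?B - ?A"
      show "0 \<le> P y z * (u z - c)"
        using far[OF y, of z] trans_prob_nonneg[of y z] trans_prob_eq_0[of y z]
        by (cases "adjacent w y z") auto
    qed (use AB in auto)
    moreover have "killed ?A (\<lambda>z. u z - v z - c) y = (\<Sum>z\<in>?A. P y z * (u z - c)) - (\<Sum>z\<in>?A. P y z * v z)"
      using y by (simp add: killed_def algebra_simps sum_subtractf sum.distrib)
    moreover have "(\<Sum>z\<in>?A. P y z * v z) = v y - 1"
      using mean_exit_rec[of ?A y] y by (simp add: v_def killed_def)
    ultimately show "killed ?A (\<lambda>z. u z - v z - c) y \<le> u y - v y - c"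
      using 1 by simp
  qed (use R in auto)
  moreover have "u x = E x (4 * R)" "v x = E x R"
    by (simp_all add: u_def v_def mean_exit_ball_def)
  ultimately show ?thesis
    by (simp add: step_gain_def c_def algebra_simps)
qed

lemma E_growth_lower:
  assumes "1 \<le> r" "r \<le> R"
  shows "(R / r) powr gam * E x r \<le> 2 * E x R"
proof -
  have "(R / r) powr gam * E x r \<le> step_gain * E x R"
    unfolding gam_def
    by (rule power_growth_lower) (use assms step_gain E_step E_mono E_nonneg in auto)
  also have "\<dots> \<le> 2 * E x R"
    using step_gain E_nonneg by (intro mult_right_mono) auto
  finally show ?thesis .
qed

text \<open>B(x, R) is contained in B(y, 2R) for each of its points y, where (TC) applies.\<close>

lemma max_mean_exit_ball_le: "0 < R \<Longrightarrow> max_mean_exit w (ball x R) \<le> CT * E x R"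
proof (rule max_mean_exit_le)
  fix y assume R: "0 < R" and y: "y \<in> ball x R"
  then have "mean_exit w y (ball x R) \<le> E y (2 * R)"
    unfolding mean_exit_ball_def
    by (intro mean_exit_mono ball_subset_ball) (auto simp: mem_ball dist_sym)
  also have "\<dots> \<le> CT * E x R"
    using R y by (rule TC)
  finally show "mean_exit w y (ball x R) \<le> CT * E x R" .
qed (auto simp: ball_def, metis centre_in_ball empty_iff)

lemma E_le_max_mean_exit_ball: "0 < R \<Longrightarrow> E x R \<le> max_mean_exit w (ball x R)"
  unfolding mean_exit_ball_def by (rule max_mean_exit_ge) auto

text \<open>Leaving the ball takes at least \<open>r\<close> steps. In particular E(x, .) is
  unbounded, so the \<open>LEAST\<close> in \<open>exit_radius\<close> is attained.\<close>

lemma E_ge_radius: "real r \<le> E x (real r)"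
proof -
  have "real r = (\<Sum>n<r. survival (ball x r) n x)"
    by (subst sum.cong[OF refl survival_eq_1]) (auto simp: mem_ball)
  also have "\<dots> \<le> E x r"
    unfolding mean_exit_ball_def by (rule mean_exit_ge_survival) auto
  finally show ?thesis .
qed

section \<open>Exit radii and the volumes attached to times\<close>

abbreviation er where "er \<equiv> exit_radius w"

lemma E_exit_radius_ge: "real n \<le> E x (er x n)"
  unfolding exit_radius_def by (rule LeastI[of _ n]) (rule E_ge_radius)

lemma exit_radius_ge_1: "1 \<le> n \<Longrightarrow> 1 \<le> er x n"
  using E_exit_radius_ge[of n x] by (cases "er x n") (auto simp: E_nonpos)

text \<open>Covers both cases of \<open>E_exit_radius_le\<close>: doubling from the radius
  \<open>er x n - 1\<close>, and the single vertex if \<open>er x n = 1\<close>.\<close>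

definition CE :: real where "CE = max CT (1 / p0)"

lemma CE_ge: "CT \<le> CE" "1 / p0 \<le> CE" "2 \<le> CE"
  using CT_ge by (auto simp: CE_def)

lemma E_exit_radius_le:
  assumes n: "1 \<le> n"
  shows "E x (er x n) \<le> CE * n"
proof (cases "er x n = 1")
  case True
  have "E x 1 \<le> CE * 1" using E_1[of x] CE_ge by linarith
  also have "\<dots> \<le> CE * n" using n CE_ge by (intro mult_left_mono) auto
  finally show ?thesis using True by simp
next
  case False
  define r where "r = er x n - 1"
  have r: "1 \<le> r" "er x n = Suc r" using False exit_radius_ge_1[OF n, of x] by (auto simp: r_def)
  have "\<not> real n \<le> E x (real r)"
  proof
    assume "real n \<le> E x (real r)"
    then have "er x n \<le> r" unfolding exit_radius_def by (rule Least_le)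
    with r show False by simp
  qed
  then have "E x r \<le> n" by simp
  have "E x (er x n) \<le> E x (2 * r)" using r by (intro E_mono) auto
  also have "\<dots> \<le> CT * E x r" using E_doubling[of "real r" x] r by simp
  also have "\<dots> \<le> CE * n" using \<open>E x r \<le> n\<close> CE_ge CT_ge by (intro mult_mono E_nonneg) auto
  finally show ?thesis .
qed

text \<open>Time \<open>0\<close> is treated like time \<open>1\<close>, because \<open>exit_radius w x 0 = 0\<close>.\<close>

definition Wt :: "'v \<Rightarrow> nat \<Rightarrow> real" where
  "Wt x n = V x (er x (max n 1))"

lemma Wt_pos: "0 < Wt x n"
  unfolding Wt_def using exit_radius_ge_1[of "max n 1" x] by (intro volume_pos) auto

text \<open>Constants of \<open>Wt_compare\<close>. In 16 CT^2 CE, the 8 of the time comparison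
  meets the 2 of the lower growth, (TC) and upper growth give one CT each, and CE bounds E at the
  exit radius by time.\<close>

definition Wt_const :: real where
  "Wt_const = DV * max 1 (16 * CT ^ 2 * CE) powr (alpha / gam)"
definition Wt_exp :: real where
  "Wt_exp = alpha * beta / gam"

lemma Wt_exp_nonneg: "0 \<le> Wt_exp"
  using alpha_ge_1 beta_ge_1 gam_pos by (simp add: Wt_exp_def)

lemma Wt_const_ge_1: "1 \<le> Wt_const"
proof -
  have "1 powr (alpha / gam) \<le> max 1 (16 * CT ^ 2 * CE) powr (alpha / gam)"
    using alpha_ge_1 gam_pos by (intro powr_mono2) auto
  then have "1 * 1 \<le> DV * max 1 (16 * CT ^ 2 * CE) powr (alpha / gam)"
    using DV_ge by (intro mult_mono) auto
  then show ?thesis by (simp add: Wt_const_def)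
qed

text \<open>Radii at different centres are compared through mean exit times: growth from below
  around \<open>z\<close> and from above around \<open>x\<close> bound (\<rho> / r')^gam by a
  multiple of (\<rho> / r)^beta, and the power alpha / gam turns this into volumes. The factor 8
  leaves room for an n' of about half the size of n, rounded to an even number.\<close>

lemma Wt_compare:
  assumes d: "real (graph_dist w x z) \<le> D" and n: "1 \<le> n" and n': "n \<le> 8 * max n' 1"
  shows "Wt x n \<le> Wt_const * (1 + D / er x n) powr Wt_exp * Wt z n'"
proof -
  define m where "m = max n' 1"
  define r where "r = real (er x n)"
  define r' where "r' = real (er z m)"
  define \<rho> where "\<rho> = r + D"
  have D: "0 \<le> D" using d by linarith
  have r: "1 \<le> r" "1 \<le> r'"
    unfolding r_def r'_def using exit_radius_ge_1[of n x] exit_radius_ge_1[of m z] n by (auto simp: m_def)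
  have \<rho>: "r \<le> \<rho>" using D by (simp add: \<rho>_def)
  have Wx: "Wt x n = V x r" and Wz: "Wt z n' = V z r'"
    using n by (simp_all add: Wt_def r_def r'_def m_def max_absorb1)
  have q: "\<rho> / r = 1 + D / er x n" using r by (simp add: \<rho>_def r_def field_simps)
  have q1: "1 \<le> \<rho> / r" using \<rho> r by simp
  have V1: "V x r \<le> V z \<rho>"
    unfolding volume_def \<rho>_def using d by (intro mass_mono finite_ball ball_subset_ball) (simp add: dist_sym)
  show ?thesis
  proof (cases "\<rho> \<le> r'")
    case True
    have "V x r \<le> V z r'" using V1 volume_mono[OF True] by (rule order_trans)
    moreover have "1 * 1 \<le> Wt_const * (1 + D / er x n) powr Wt_exp"
      using Wt_const_ge_1 q1 Wt_exp_nonneg unfolding q[symmetric]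
      by (intro mult_mono ge_one_powr_ge_zero) auto
    ultimately show ?thesis
      unfolding Wx Wz using volume_pos[of r' z] r
      by (smt (verit) mult_le_cancel_right1)
  next
    case False
    have "(\<rho> / r') powr gam * (n / 8) \<le> (\<rho> / r') powr gam * E z r'"
    proof (intro mult_left_mono)
      have "real n \<le> 8 * real m" using n' by (simp add: m_def)
      also have "real m \<le> E z r'" unfolding r'_def by (rule E_exit_radius_ge)
      finally show "n / 8 \<le> E z r'" by simp
    qed simp
    also have "\<dots> \<le> 2 * E z \<rho>"
      using False r by (intro E_growth_lower) auto
    finally have 1: "(\<rho> / r') powr gam * (n / 8) \<le> 2 * E z \<rho>" .
    have "E z \<rho> \<le> E z (2 * \<rho>)" using \<rho> r by (intro E_mono) auto
    also have "E z (2 * \<rho>) \<le> CT * E x \<rho>"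
      using d r by (intro E_near) (auto simp: \<rho>_def)
    also have "\<dots> \<le> CT * (CT * (\<rho> / r) powr beta * (CE * n))"
    proof (intro mult_left_mono)
      have "E x \<rho> \<le> CT * (\<rho> / r) powr beta * E x r"
        using r \<rho> by (intro E_growth) auto
      also have "\<dots> \<le> CT * (\<rho> / r) powr beta * (CE * n)"
        unfolding r_def using E_exit_radius_le[OF n] CT_ge by (intro mult_left_mono) auto
      finally show "E x \<rho> \<le> CT * (\<rho> / r) powr beta * (CE * n)" .
    qed (use CT_ge in auto)
    finally have "(\<rho> / r') powr gam * (n / 8) \<le> 2 * (CT * (CT * (\<rho> / r) powr beta * (CE * n)))"
      using 1 by linarith
    then have "(\<rho> / r') powr gam \<le> 16 * CT ^ 2 * CE * (\<rho> / r) powr beta"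
      using n by (simp add: field_simps power2_eq_square)
    also have "\<dots> \<le> max 1 (16 * CT ^ 2 * CE) * (\<rho> / r) powr beta"
      by (intro mult_right_mono) auto
    finally have "((\<rho> / r') powr gam) powr (alpha / gam) \<le> (max 1 (16 * CT ^ 2 * CE) * (\<rho> / r) powr beta) powr (alpha / gam)"
      using alpha_ge_1 gam_pos by (intro powr_mono2) auto
    then have "(\<rho> / r') powr alpha \<le> max 1 (16 * CT ^ 2 * CE) powr (alpha / gam) * (\<rho> / r) powr Wt_exp"
      using gam_pos by (simp add: powr_powr powr_mult Wt_exp_def mult_ac)
    then have "DV * (\<rho> / r') powr alpha * V z r' \<le> Wt_const * (\<rho> / r) powr Wt_exp * V z r'"
      using DV_ge volume_pos[of r' z] r by (simp add: Wt_const_def mult.assoc)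
    moreover have "V z \<rho> \<le> DV * (\<rho> / r') powr alpha * V z r'"
      using False r by (intro V_growth) auto
    ultimately show ?thesis
      unfolding Wx Wz q[symmetric] using V1 by linarith
  qed
qed

end

section \<open>Exit times, eigenvalues and resistances\<close>

text \<open>De Giorgi iteration: the levels \<open>t k\<close> rise by geometrically shrinking gaps
  while the bound on \<open>m\<close> halves each time; the limit of the levels is the point in the
  claim.\<close>

lemma level_iteration:
  fixes m :: "real \<Rightarrow> real"
  assumes K: "0 < K" and \<delta>: "0 < \<delta>"
    and nonneg: "\<And>t. 0 \<le> m t" and anti: "\<And>s t. t \<le> s \<Longrightarrow> m s \<le> m t"
    and step: "\<And>s t. 0 \<le> t \<Longrightarrow> t < s \<Longrightarrow> (s - t) * m s \<le> K * m t powr (1 + \<delta>)"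
  shows "m (2 * K * m 0 powr \<delta> / (1 - 2 powr (- \<delta>))) = 0"
proof (cases "m 0 = 0")
  case True
  then show ?thesis using nonneg[of 0] by simp
next
  case False
  define q where "q = (2::real) powr (- \<delta>)"
  define t where "t = (\<lambda>k. 2 * K * m 0 powr \<delta> * (\<Sum>i<k. q ^ i))"
  have m0: "0 < m 0" using False nonneg[of 0] by simp
  have q: "0 < q" "q < 1" using \<delta> by (auto simp: q_def powr_less_one)
  have t0: "0 \<le> t k" for k using K q by (auto simp: t_def intro!: mult_nonneg_nonneg sum_nonneg)
  have bound: "m (t k) \<le> m 0 / 2 ^ k" for k
  proof (induction k)
    case 0
    then show ?case by (simp add: t_def)
  next
    case (Suc k)
    \<comment> \<open>The gap for which one step halves the bound: K (m 0 / 2^k)^(1 + \<delta>) = h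
      m 0 / 2^(k + 1).\<close>
    define h where "h = 2 * K * (m 0 / 2 ^ k) powr \<delta>"
    have h: "0 < h" using K m0 by (simp add: h_def)
    have "(m 0 / 2 ^ k) powr \<delta> = m 0 powr \<delta> * q ^ k"
    proof -
      have "(2 ^ k) powr \<delta> = (2::real) powr (\<delta> * k)"
        by (simp add: powr_realpow[symmetric] powr_powr mult.commute)
      moreover have "q ^ k = 2 powr (- (\<delta> * k))"
        by (simp add: q_def powr_powr flip: powr_realpow)
      ultimately show ?thesis
        using m0 by (simp add: powr_divide powr_minus_divide)
    qed
    then have th: "t (Suc k) - t k = h"
      by (simp add: t_def h_def algebra_simps)
    have "h * m (t (Suc k)) \<le> K * m (t k) powr (1 + \<delta>)"
      using step[OF t0[of k], of "t (Suc k)"] th h by simp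
    also have "\<dots> \<le> K * (m 0 / 2 ^ k) powr (1 + \<delta>)"
      using Suc K nonneg \<delta> by (intro mult_left_mono powr_mono2) auto
    also have "\<dots> = h * (m 0 / 2 ^ Suc k)"
      using m0 by (simp add: h_def powr_add)
    finally show ?case using h by (rule mult_left_le_imp_le)
  qed
  have sumq: "(\<Sum>i<k. q ^ i) \<le> 1 / (1 - q)" for k
  proof -
    have "(\<Sum>i<k. q ^ i) = (1 - q ^ k) / (1 - q)"
      using q by (subst sum_gp_strict) auto
    also have "\<dots> \<le> 1 / (1 - q)" using q by (intro divide_right_mono) auto
    finally show ?thesis .
  qed
  have tT: "t k \<le> 2 * K * m 0 powr \<delta> / (1 - q)" for k
  proof -
    have "2 * K * m 0 powr \<delta> * (\<Sum>i<k. q ^ i) \<le> 2 * K * m 0 powr \<delta> * (1 / (1 - q))"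
      using K by (intro mult_left_mono sumq) auto
    then show ?thesis by (simp add: t_def)
  qed
  have "m (2 * K * m 0 powr \<delta> / (1 - q)) \<le> m 0 * (1 / 2) ^ k" for k
    using anti[OF tT[of k]] bound[of k] by (simp add: power_divide)
  moreover have "(\<lambda>k. m 0 * (1 / 2) ^ k) \<longlonglongrightarrow> m 0 * 0"
    by (intro tendsto_intros LIMSEQ_power_zero) simp
  ultimately have "m (2 * K * m 0 powr \<delta> / (1 - q)) \<le> m 0 * 0"
    using LIMSEQ_le_const by blast
  then show ?thesis
    using nonneg[of "2 * K * m 0 powr \<delta> / (1 - q)"] by (simp add: q_def)
qed

context bounded_prob_graph begin

lemma bil_scale: "bil S (\<lambda>x. c * f x) (\<lambda>x. c * f x) = c\<^sup>2 * bil S f f"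
proof -
  have "w x y * ((c * f x - c * f y) * (c * f x - c * f y)) = c\<^sup>2 * (w x y * ((f x - f y) * (f x - f y)))" for x y
    by (simp add: algebra_simps power2_eq_square)
  then show ?thesis
    by (simp only: bil_def sum_distrib_left times_divide_eq_right)
qed

text \<open>Both sides are the full energy of \<open>f\<close>.\<close>

lemma form_independent:
  assumes "finite A" "A' \<subseteq> A" "\<And>x. x \<notin> A' \<Longrightarrow> f x = 0"
  shows "form A' f f = form A f f"
proof -
  have "finite A'" using assms finite_subset by blast
  then have "ennreal (form A' f f) = ennreal (form A f f)"
    using assms energy_eq_form[of A' f] energy_eq_form[of A f] by auto
  then show ?thesis
    by (simp add: bil_nonneg)
qed

text \<open>Truncation between the levels t and s is a nondecreasing contraction, so the energy of
  the truncated u is at most its pairing with u; that is its integral, at most (s - t) \<mu>(u >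
  t).\<close>

lemma form_clamp_mean_exit_le:
  assumes "finite A" "0 \<le> t" "t < s"
  defines "f \<equiv> \<lambda>x. 1 / (s - t) * max 0 (min (mean_exit w x A - t) (s - t))"
  shows "form A f f \<le> mass w {x \<in> A. t < mean_exit w x A} / (s - t)"
proof -
  define u where "u = (\<lambda>x. mean_exit w x A)"
  define \<phi> where "\<phi> = (\<lambda>a. max 0 (min (a - t) (s - t)))"
  let ?A' = "{x \<in> A. t < u x}"
  have "form A f f = (1 / (s - t))\<^sup>2 * form A (\<lambda>x. \<phi> (u x)) (\<lambda>x. \<phi> (u x))"
    unfolding f_def \<phi>_def u_def by (rule bil_scale)
  also have "\<dots> \<le> (1 / (s - t))\<^sup>2 * ((s - t) * mass w ?A')"
  proof (rule mult_left_mono)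
    have "form A (\<lambda>x. \<phi> (u x)) (\<lambda>x. \<phi> (u x)) \<le> form A (\<lambda>x. \<phi> (u x)) u"
      by (rule bil_lipschitz_mono) (auto simp: \<phi>_def)
    also have "\<dots> = (\<Sum>x\<in>A. \<phi> (u x) * \<mu> x)"
      unfolding u_def using assms by (intro form_mean_exit) (auto simp: \<phi>_def)
    also have "\<dots> = (\<Sum>x\<in>?A'. \<phi> (u x) * \<mu> x)"
      using assms by (intro sum.mono_neutral_right) (auto simp: \<phi>_def)
    also have "\<dots> \<le> (\<Sum>x\<in>?A'. (s - t) * \<mu> x)"
      using assms by (intro sum_mono mult_right_mono) (auto simp: \<phi>_def)
    also have "\<dots> = (s - t) * mass w ?A'"
      using assms by (simp add: mass_finite sum_distrib_left)
    finally show "form A (\<lambda>x. \<phi> (u x)) (\<lambda>x. \<phi> (u x)) \<le> (s - t) * mass w ?A'" .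
  qed simp
  also have "\<dots> = mass w ?A' / (s - t)"
    using assms by (simp add: power2_eq_square)
  finally show ?thesis
    by (simp add: u_def)
qed

text \<open>The truncated and rescaled mean exit time u is a test function for the resistance
  between {u > s} and the complement of {u > t}. Combined with the hypothesis this gives (s - t)
  m(s) <= K m(t)^(1 + \<delta>), the input of \<open>level_iteration\<close>.\<close>

lemma max_mean_exit_le_of_resistance:
  assumes A: "finite A" "A \<noteq> {}" and K: "0 < K" and \<delta>: "0 < \<delta>"
    and res: "\<And>D A'. D \<noteq> {} \<Longrightarrow> D \<subseteq> A' \<Longrightarrow> A' \<subseteq> A \<Longrightarrow> rel_resistance w D A' * mass w D \<le> K * mass w A' powr \<delta>"
  shows "max_mean_exit w A \<le> 2 * K * mass w A powr \<delta> / (1 - 2 powr (- \<delta>))"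
proof -
  define u where "u = (\<lambda>x. mean_exit w x A)"
  define m where "m = (\<lambda>t. mass w {x \<in> A. t < u x})"
  have m0: "m 0 = mass w A"
  proof -
    have "{x \<in> A. 0 < u x} = A"
      using mean_exit_ge_1[OF A(1)] by (force simp: u_def)
    then show ?thesis by (simp add: m_def)
  qed
  have nonneg: "0 \<le> m t" for t
    using A by (auto simp: m_def mass_finite intro: sum_nonneg)
  let ?T = "2 * K * m 0 powr \<delta> / (1 - 2 powr (- \<delta>))"
  have "m ?T = 0"
  proof (rule level_iteration[OF K \<delta> nonneg])
    show "m s \<le> m t" if "t \<le> s" for s t
      unfolding m_def using A that by (intro mass_mono) auto
    fix s t :: real assume t: "0 \<le> t" and ts: "t < s"
    let ?D = "{x \<in> A. s < u x}" and ?A' = "{x \<in> A. t < u x}"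
    show "(s - t) * m s \<le> K * m t powr (1 + \<delta>)"
    proof (cases "?D = {}")
      case True
      have "m s = 0" unfolding m_def True by (simp add: mass_def)
      then show ?thesis using K by simp
    next
      case False
      have sub: "?D \<subseteq> ?A'" "?A' \<subseteq> A" using ts by auto
      have fin: "finite ?A'" using A by simp
      define f where "f = (\<lambda>x. 1 / (s - t) * max 0 (min (mean_exit w x A - t) (s - t)))"
      have f0: "f x = 0" if "x \<notin> ?A'" for x
      proof -
        have "mean_exit w x A \<le> t"
          using that A t by (cases "x \<in> A") (auto simp: u_def)
        then show ?thesis by (simp add: f_def)
      qed
      have f1: "f x = 1" if "x \<in> ?D" for x
        using that ts by (simp add: f_def u_def)
      have "form ?A' f f = form A f f"
        by (rule form_independent[OF A(1) sub(2)]) (rule f0)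
      also have "\<dots> \<le> m t / (s - t)"
        unfolding f_def m_def u_def by (rule form_clamp_mean_exit_le[OF A(1) t ts])
      finally have form: "form ?A' f f \<le> m t / (s - t)" .
      have \<rho>0: "0 \<le> rel_resistance w ?D ?A'"
        by (simp add: rel_resistance_def resistance_def)
      have "1 \<le> rel_resistance w ?D ?A' * form ?A' f f"
        by (rule rel_resistance_ge[OF fin sub(1) False]) (use f0 f1 in auto)
      also have "\<dots> \<le> rel_resistance w ?D ?A' * (m t / (s - t))"
        using \<rho>0 form by (rule mult_left_mono[rotated])
      finally have "s - t \<le> rel_resistance w ?D ?A' * m t"
        using ts by (simp add: field_simps)
      then have "(s - t) * m s \<le> rel_resistance w ?D ?A' * m t * m s"
        using nonneg by (intro mult_right_mono)
      also have "\<dots> = (rel_resistance w ?D ?A' * mass w ?D) * m t"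
        by (simp add: m_def)
      also have "\<dots> \<le> (K * m t powr \<delta>) * m t"
        using res[OF False sub] nonneg by (intro mult_right_mono) (auto simp: m_def)
      also have "\<dots> = K * m t powr (1 + \<delta>)"
        using nonneg[of t] by (simp add: powr_add)
      finally show ?thesis .
    qed
  qed
  then have "\<not> 0 < mass w {x \<in> A. ?T < u x}"
    by (simp add: m_def)
  then have "{x \<in> A. ?T < u x} = {}"
    using mass_pos[of "{x \<in> A. ?T < u x}"] A(1) finite_subset[of "{x \<in> A. ?T < u x}" A] by blast
  then show ?thesis
    using A unfolding m0 by (intro max_mean_exit_le) (auto simp: u_def not_less)
qed

end

section \<open>Comparability of exit time, eigenvalue and resistance on balls\<close>

context doubling_graph begin

lemma ball_nonempty: "0 < R \<Longrightarrow> ball x R \<noteq> {}"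
  using centre_in_ball by blast

lemma annulus_resistance_eq: "annulus_resistance w x R (2 * R) = rel_resistance w (ball x R) (ball x (2 * R))"
  by (simp add: annulus_resistance_def rel_resistance_def)

lemma annulus_resistance_nonneg: "0 \<le> annulus_resistance w x r R"
  by (simp add: annulus_resistance_def resistance_def)

text \<open>The test function is min(u, t) / t, where u is the mean exit time of B(x, 2R) and, by
  (TC), u >= t on B(x, R).\<close>

lemma annulus_resistance_lower:
  assumes R: "0 < R"
  shows "E x (2 * R) \<le> CT * annulus_resistance w x R (2 * R) * mass w (ball x (2 * R))"
proof -
  let ?B = "ball x (2 * R)" and ?D = "ball x R"
  define t where "t = E x (2 * R) / CT"
  define f where "f = (\<lambda>y. 1 / (t - 0) * max 0 (min (mean_exit w y ?B - 0) (t - 0)))"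
  have t: "0 < t" using E_pos[of "2 * R" x] R CT_ge by (simp add: t_def)
  have u: "t \<le> mean_exit w y ?B" if y: "y \<in> ?D" for y
  proof -
    have "E x (2 * R) \<le> CT * E y R"
      using y by (intro E_near) (simp add: mem_ball dist_sym)
    then have "t \<le> E y R" using CT_ge by (simp add: t_def field_simps)
    also have "\<dots> \<le> mean_exit w y ?B"
      unfolding mean_exit_ball_def using y by (intro mean_exit_mono ball_subset_ball) (auto simp: mem_ball)
    finally show ?thesis .
  qed
  have ne: "?D \<noteq> {}" using R centre_in_ball by blast
  have "1 \<le> annulus_resistance w x R (2 * R) * form ?B f f"
    unfolding annulus_resistance_eq
  proof (rule rel_resistance_ge)
    show "f y = 1" if "y \<in> ?D" for y
      using u[OF that] t by (simp add: f_def)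
    show "f y = 0" if "y \<notin> ?B" for y
      using that t by (simp add: f_def)
  qed (use R ne ball_mono[of R "2 * R" x] in auto)
  also have "\<dots> \<le> annulus_resistance w x R (2 * R) * (mass w ?B / t)"
  proof (intro mult_left_mono annulus_resistance_nonneg)
    have "form ?B f f \<le> mass w {y \<in> ?B. 0 < mean_exit w y ?B} / (t - 0)"
      unfolding f_def by (rule form_clamp_mean_exit_le) (use t in auto)
    also have "\<dots> \<le> mass w ?B / t"
      using t by (simp, intro divide_right_mono mass_mono) auto
    finally show "form ?B f f \<le> mass w ?B / t" .
  qed
  finally have "t \<le> annulus_resistance w x R (2 * R) * mass w ?B"
    using t by (simp add: field_simps)
  then show ?thesis
    using CT_ge by (simp add: t_def field_simps)
qed

text \<open>\<open>rel_resistance_le\<close> gives the bound with V(x, R); (VD) replaces it by the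
  volume of the larger ball.\<close>

lemma annulus_resistance_upper:
  assumes R: "0 < R"
  shows "annulus_resistance w x R (2 * R) * mass w (ball x (2 * R)) \<le> DV * inv_eigenvalue w (ball x (2 * R))"
proof -
  have "annulus_resistance w x R (2 * R) * V x R \<le> inv_eigenvalue w (ball x (2 * R))"
    unfolding annulus_resistance_eq volume_def
    by (rule rel_resistance_le) (use R ball_nonempty ball_mono[of R "2 * R" x] in auto)
  then have "DV * (annulus_resistance w x R (2 * R) * V x R) \<le> DV * inv_eigenvalue w (ball x (2 * R))"
    using DV_ge by (intro mult_left_mono) auto
  moreover have "annulus_resistance w x R (2 * R) * V x (2 * R) \<le> annulus_resistance w x R (2 * R) * (DV * V x R)"
    using VD[OF R] annulus_resistance_nonneg by (rule mult_left_mono)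
  ultimately show ?thesis
    by (simp add: volume_def mult_ac)
qed

lemma E_le_inv_eigenvalue:
  assumes R: "0 < R"
  shows "E x (2 * R) \<le> CT * DV * inv_eigenvalue w (ball x (2 * R))"
proof -
  have "E x (2 * R) \<le> CT * (annulus_resistance w x R (2 * R) * mass w (ball x (2 * R)))"
    using annulus_resistance_lower[OF R] by (simp add: mult.assoc)
  also have "\<dots> \<le> CT * (DV * inv_eigenvalue w (ball x (2 * R)))"
    using annulus_resistance_upper[OF R] CT_ge by (intro mult_left_mono) auto
  finally show ?thesis by (simp add: mult.assoc)
qed

lemma mean_exit_ineq_imp_eigenvalue_ineq:
  assumes "mean_exit_ineq w"
  shows "eigenvalue_ineq w"
proof -
  obtain C \<delta> where C: "0 < C" "0 < \<delta>" and *: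
    "\<forall>x. \<forall>R>0. \<forall>A. A \<noteq> {} \<longrightarrow> A \<subseteq> ball x (2 * R) \<longrightarrow>
      max_mean_exit w A / max_mean_exit w (ball x (2 * R)) \<le> C * (mass w A / mass w (ball x (2 * R))) powr \<delta>"
    using assms unfolding mean_exit_ineq_def by (elim exE conjE) (rule that)
  note ineq = *[rule_format]
  show ?thesis
    unfolding eigenvalue_ineq_def
  proof (rule exI[of _ "C * (CT * CT * DV)"], rule conjI[rotated], rule exI[of _ \<delta>], intro conjI allI impI)
    fix x R A assume R: "(0::real) < R" and A: "A \<noteq> {}" "A \<subseteq> ball x (2 * R)"
    let ?B = "ball x (2 * R)" and ?q = "(mass w A / mass w (ball x (2 * R))) powr \<delta>"
    have fin: "finite A" using A(2) finite_ball by (rule finite_subset)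
    have neB: "?B \<noteq> {}" using A by auto
    have B1: "1 \<le> max_mean_exit w ?B" using neB by (intro max_mean_exit_ge_1) auto
    have l: "0 < inv_eigenvalue w ?B" using neB by (intro inv_eigenvalue_pos) auto
    have "inv_eigenvalue w A \<le> max_mean_exit w A"
      using fin A by (intro inv_eigenvalue_le_max_mean_exit)
    also have "\<dots> \<le> C * ?q * max_mean_exit w ?B"
      using ineq[OF R A] B1 by (simp add: field_simps)
    also have "\<dots> \<le> C * ?q * (CT * (CT * DV * inv_eigenvalue w ?B))"
    proof (rule mult_left_mono)
      have "max_mean_exit w ?B \<le> CT * E x (2 * R)"
        using R by (intro max_mean_exit_ball_le) auto
      also have "\<dots> \<le> CT * (CT * DV * inv_eigenvalue w ?B)"
        using CT_ge by (intro mult_left_mono E_le_inv_eigenvalue R) auto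
      finally show "max_mean_exit w ?B \<le> CT * (CT * DV * inv_eigenvalue w ?B)" .
    qed (use C in auto)
    finally show "inv_eigenvalue w A / inv_eigenvalue w ?B \<le> C * (CT * CT * DV) * ?q"
      using l by (simp add: field_simps)
  qed (use C CT_ge DV_ge in auto)
qed

lemma eigenvalue_ineq_imp_resistance_ineq:
  assumes "eigenvalue_ineq w"
  shows "resistance_ineq w"
proof -
  obtain C \<delta> where C: "0 < C" "0 < \<delta>" and *:
    "\<forall>x. \<forall>R>0. \<forall>A. A \<noteq> {} \<longrightarrow> A \<subseteq> ball x (2 * R) \<longrightarrow>
      inv_eigenvalue w A / inv_eigenvalue w (ball x (2 * R)) \<le> C * (mass w A / mass w (ball x (2 * R))) powr \<delta>"
    using assms unfolding eigenvalue_ineq_def by (elim exE conjE) (rule that)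
  note ineq = *[rule_format]
  show ?thesis
    unfolding resistance_ineq_def
  proof (rule exI[of _ "C * (CT * CT)"], rule conjI[rotated], rule exI[of _ \<delta>], intro conjI allI impI)
    fix x R A D assume R: "(0::real) < R" and D: "D \<noteq> {}" "D \<subseteq> A" and A: "A \<subseteq> ball x (2 * R)"
    let ?B = "ball x (2 * R)"
    define a b c where "a = mass w A" and "b = mass w ?B" and "c = mass w D"
    let ?\<rho> = "annulus_resistance w x R (2 * R)"
    have fin: "finite A" using A finite_ball by (rule finite_subset)
    have finD: "finite D" using D(2) fin by (rule finite_subset)
    have neA: "A \<noteq> {}" and neB: "?B \<noteq> {}"
      using A D by auto
    have pos: "0 < a" "0 < b" "0 < c"
      unfolding a_def b_def c_def using fin neA finD D neB by (auto intro: mass_pos)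
    have l: "0 < inv_eigenvalue w ?B" using neB by (intro inv_eigenvalue_pos) auto
    have low: "E x (2 * R) \<le> CT * ?\<rho> * b" unfolding b_def by (rule annulus_resistance_lower[OF R])
    have \<rho>: "0 < ?\<rho>"
    proof (rule ccontr)
      assume "\<not> 0 < ?\<rho>"
      then have "?\<rho> = 0" using annulus_resistance_nonneg[of x R "2 * R"] by simp
      with low E_pos[of "2 * R" x] R show False by simp
    qed
    have "rel_resistance w D A * c \<le> inv_eigenvalue w A"
      unfolding c_def by (rule rel_resistance_le[OF fin D(2,1)])
    also have "\<dots> \<le> C * (a / b) powr \<delta> * inv_eigenvalue w ?B"
      using ineq[OF R neA A] l by (simp add: field_simps a_def b_def)
    also have "\<dots> \<le> C * (a / b) powr \<delta> * (CT * (CT * ?\<rho> * b))"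
    proof (rule mult_left_mono)
      have "inv_eigenvalue w ?B \<le> max_mean_exit w ?B"
        using neB by (intro inv_eigenvalue_le_max_mean_exit) auto
      also have "\<dots> \<le> CT * E x (2 * R)"
        using R by (intro max_mean_exit_ball_le) auto
      also have "\<dots> \<le> CT * (CT * ?\<rho> * b)"
        using CT_ge low by (intro mult_left_mono) auto
      finally show "inv_eigenvalue w ?B \<le> CT * (CT * ?\<rho> * b)" .
    qed (use C in auto)
    finally have "rel_resistance w D A / ?\<rho> \<le> C * (CT * CT) * ((a / b) powr \<delta> * (b / c))"
      using pos \<rho> by (simp add: field_simps)
    \<comment> \<open>The factor b / c, left over from \<mu>(B) / \<mu>(D), is what lowers the
      second exponent to \<delta> - 1.\<close>
    also have "(a / b) powr \<delta> * (b / c) = (a / c) powr \<delta> * (c / b) powr (\<delta> - 1)"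
      using pos by (simp add: powr_divide powr_diff)
    finally show "rel_resistance w D A / annulus_resistance w x R (2 * R)
        \<le> C * (CT * CT) * (mass w A / mass w D) powr \<delta> * (mass w D / mass w ?B) powr (\<delta> - 1)"
      by (simp add: a_def b_def c_def mult.assoc)
  qed (use C CT_ge in auto)
qed

lemma resistance_ineq_imp_mean_exit_ineq:
  assumes "resistance_ineq w"
  shows "mean_exit_ineq w"
proof -
  obtain C \<delta> where C: "0 < C" "0 < \<delta>" and *:
    "\<forall>x. \<forall>R>0. \<forall>A D. D \<noteq> {} \<longrightarrow> D \<subseteq> A \<longrightarrow> A \<subseteq> ball x (2 * R) \<longrightarrow>
      rel_resistance w D A / annulus_resistance w x R (2 * R)
        \<le> C * (mass w A / mass w D) powr \<delta> * (mass w D / mass w (ball x (2 * R))) powr (\<delta> - 1)"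
    using assms unfolding resistance_ineq_def by (elim exE conjE) (rule that)
  note ineq = *[rule_format]
  define q where "q = 1 - (2::real) powr (- \<delta>)"
  have q: "0 < q" using C by (simp add: q_def powr_less_one)
  show ?thesis
    unfolding mean_exit_ineq_def
  proof (rule exI[of _ "2 * (C * DV) / q"], rule conjI[rotated], rule exI[of _ \<delta>], intro conjI allI impI)
    fix x R A assume R: "(0::real) < R" and A: "A \<noteq> {}" "A \<subseteq> ball x (2 * R)"
    let ?B = "ball x (2 * R)" and ?\<rho> = "annulus_resistance w x R (2 * R)"
    define b where "b = mass w ?B"
    have fin: "finite A" using A(2) finite_ball by (rule finite_subset)
    have neB: "?B \<noteq> {}" using A by auto
    have b: "0 < b" unfolding b_def using neB by (intro mass_pos) auto
    let ?M = "max_mean_exit w ?B"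
    have M: "1 \<le> ?M" using neB by (intro max_mean_exit_ge_1) auto
    have low: "E x (2 * R) \<le> CT * ?\<rho> * b" unfolding b_def by (rule annulus_resistance_lower[OF R])
    have \<rho>: "0 < ?\<rho>"
    proof (rule ccontr)
      assume "\<not> 0 < ?\<rho>"
      then have "?\<rho> = 0" using annulus_resistance_nonneg[of x R "2 * R"] by simp
      with low E_pos[of "2 * R" x] R show False by simp
    qed
    have \<rho>b: "?\<rho> * b \<le> DV * ?M"
    proof -
      have "?\<rho> * b \<le> DV * inv_eigenvalue w ?B"
        unfolding b_def by (rule annulus_resistance_upper[OF R])
      also have "\<dots> \<le> DV * ?M"
        using DV_ge neB by (intro mult_left_mono inv_eigenvalue_le_max_mean_exit) auto
      finally show ?thesis .
    qed
    \<comment> \<open>\<open>K\<close> carries the scale of the ball: divided by \<mu>(B)^\<delta>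
      and multiplied by the maximal mean exit time of B, it makes the resulting bound scale
      invariant.\<close>
    define K where "K = C * DV * ?M / b powr \<delta>"
    have K: "0 < K" using C DV_ge M b by (simp add: K_def)
    have "max_mean_exit w A \<le> 2 * K * mass w A powr \<delta> / (1 - 2 powr (- \<delta>))"
    proof (rule max_mean_exit_le_of_resistance[OF fin A(1) K C(2)])
      fix D A' assume D: "D \<noteq> {}" "D \<subseteq> A'" "A' \<subseteq> A"
      define a c where "a = mass w A'" and "c = mass w D"
      have fin': "finite A'" using D(3) fin by (rule finite_subset)
      then have finD: "finite D" using D(2) by (simp add: finite_subset)
      have neA': "A' \<noteq> {}" using D by auto
      have pos: "0 < a" "0 < c"
        unfolding a_def c_def using fin' finD neA' D by (auto intro: mass_pos)
      have "rel_resistance w D A' / ?\<rho> \<le> C * (a / c) powr \<delta> * (c / b) powr (\<delta> - 1)"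
        unfolding a_def b_def c_def using D A by (intro ineq[OF R]) auto
      also have "\<dots> = C * ((a / c) powr \<delta> * (c / b) powr (\<delta> - 1))" by simp
      also have "(a / c) powr \<delta> * (c / b) powr (\<delta> - 1) = a powr \<delta> / b powr \<delta> * (b / c)"
        using pos b by (simp add: powr_divide powr_diff)
      finally have "rel_resistance w D A' * c \<le> C * (a powr \<delta> / b powr \<delta>) * (?\<rho> * b)"
        using pos \<rho> b by (simp add: field_simps)
      also have "\<dots> \<le> C * (a powr \<delta> / b powr \<delta>) * (DV * ?M)"
        using \<rho>b C by (intro mult_left_mono) auto
      also have "\<dots> = K * a powr \<delta>"
        by (simp add: K_def)
      finally show "rel_resistance w D A' * mass w D \<le> K * mass w A' powr \<delta>"
        by (simp add: a_def c_def)
    qed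
    also have "\<dots> = 2 * (C * DV) / q * (mass w A / b) powr \<delta> * ?M"
      using b mass_pos[OF fin A(1)] by (simp add: K_def q_def powr_divide mult_ac)
    finally show "max_mean_exit w A / ?M \<le> 2 * (C * DV) / q * (mass w A / mass w ?B) powr \<delta>"
      using M by (simp add: b_def field_simps)
  qed (use C q DV_ge in auto)
qed

end

section \<open>Exit times from the diagonal estimate\<close>

context doubling_graph begin

text \<open>A radius that is at least \<open>1\<close> lets the case of a ball consisting of one vertex be
  treated like the others.\<close>

context
  fixes x z :: 'v and R :: real
  assumes R: "0 < R" and z: "z \<in> ball x (2 * R)"
begin

lemma mass_ball_le_volume: "mass w (ball x (2 * R)) \<le> V z (max (4 * R) 1)"
proof -
  have "ball x (2 * R) \<subseteq> ball z (max (4 * R) 1)"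
    using z by (intro ball_subset_ball) (auto simp: mem_ball dist_sym)
  then show ?thesis
    unfolding volume_def by (intro mass_mono) auto
qed

lemma E_le_max_mean_exit: "E z (max (4 * R) 1) \<le> CE * max_mean_exit w (ball x (2 * R))"
proof (cases "1 \<le> 4 * R")
  case True
  have "E z (2 * (2 * R)) \<le> CT * E x (2 * R)"
    using R z by (intro TC) auto
  also have "\<dots> \<le> CE * max_mean_exit w (ball x (2 * R))"
    using R CE_ge CT_ge by (intro mult_mono E_le_max_mean_exit_ball E_nonneg) linarith+
  finally show ?thesis
    using True by (simp add: max_absorb1)
next
  case False
  have "E z 1 \<le> CE * 1"
    using E_1[of z] CE_ge by simp
  also have "\<dots> \<le> CE * max_mean_exit w (ball x (2 * R))"
    using R CE_ge by (intro mult_left_mono max_mean_exit_ge_1 ball_nonempty) auto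
  finally show ?thesis
    using False by (simp add: max_absorb2)
qed

text \<open>Here S is a radius about \<open>z\<close> large enough to cover B. If S <=
  \<open>e\<close>, then B lies in the ball of radius \<open>e\<close> about \<open>z\<close>.
  Otherwise growth from below bounds (S / e)^gam by a multiple of the maximal mean exit time over n,
  and volume growth gives the second alternative.\<close>

lemma Wt_lower:
  assumes n: "1 \<le> n"
  defines "B \<equiv> ball x (2 * R)"
  shows "mass w B \<le> Wt z n \<or>
    mass w B * (n / max_mean_exit w B) powr (alpha / gam) \<le> DV * (2 * CE) powr (alpha / gam) * Wt z n"
proof -
  define e where "e = real (er z n)"
  define S where "S = max (4 * R) 1"
  let ?M = "max_mean_exit w B"
  have M: "1 \<le> ?M" unfolding B_def using R by (intro max_mean_exit_ge_1 ball_nonempty) auto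
  have W: "Wt z n = V z e" using n by (simp add: Wt_def e_def max_absorb1)
  have e: "1 \<le> e" unfolding e_def using exit_radius_ge_1[OF n, of z] by simp
  have b: "mass w B \<le> V z S" unfolding B_def S_def by (rule mass_ball_le_volume)
  show ?thesis
  proof (cases "S \<le> e")
    case True
    then show ?thesis using b volume_mono[OF True, of z] W by simp
  next
    case False
    have "(S / e) powr gam * n \<le> (S / e) powr gam * E z e"
      unfolding e_def by (intro mult_left_mono E_exit_radius_ge) auto
    also have "\<dots> \<le> 2 * E z S" using False e by (intro E_growth_lower) auto
    also have "\<dots> \<le> 2 * (CE * ?M)"
      unfolding B_def S_def using E_le_max_mean_exit by simp
    finally have "(S / e) powr gam * (n / ?M) \<le> 2 * CE" using M by (simp add: field_simps)
    then have "((S / e) powr gam * (n / ?M)) powr (alpha / gam) \<le> (2 * CE) powr (alpha / gam)"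
      using alpha_ge_1 gam_pos M by (intro powr_mono2) auto
    moreover have "((S / e) powr gam * Q) powr (alpha / gam) = (S / e) powr alpha * Q powr (alpha / gam)"
      if "0 \<le> Q" for Q
      using gam_pos that by (simp add: powr_mult powr_powr)
    ultimately have 1: "(S / e) powr alpha * (n / ?M) powr (alpha / gam) \<le> (2 * CE) powr (alpha / gam)"
      using M by (metis divide_nonneg_pos less_le_trans of_nat_0_le_iff zero_less_one)
    have "mass w B * (n / ?M) powr (alpha / gam) \<le> DV * (S / e) powr alpha * V z e * (n / ?M) powr (alpha / gam)"
    proof (rule mult_right_mono)
      show "mass w B \<le> DV * (S / e) powr alpha * V z e"
        using b V_growth[of e S z] False e by simp
    qed simp
    also have "\<dots> = DV * ((S / e) powr alpha * (n / ?M) powr (alpha / gam)) * V z e" by simp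
    also have "\<dots> \<le> DV * (2 * CE) powr (alpha / gam) * V z e"
      using 1 DV_ge volume_pos[of e z] e by (intro mult_right_mono mult_left_mono) auto
    finally show ?thesis unfolding W by simp
  qed
qed

text \<open>Growth starting at radius 1, where V(z, 1) <= \<mu>(A). The bound later absorbs the 1
  lost in rounding a time up to an integer.\<close>

lemma max_mean_exit_lower:
  assumes A: "finite A" "z \<in> A"
  defines "B \<equiv> ball x (2 * R)"
  shows "1 \<le> 2 * CE * DV powr (gam / alpha) * max_mean_exit w B * (mass w A / mass w B) powr (gam / alpha)"
proof -
  define S where "S = max (4 * R) 1"
  let ?M = "max_mean_exit w B" and ?b = "mass w B" and ?d = "gam / alpha"
  have S: "1 \<le> S" by (simp add: S_def)
  have b: "0 < ?b" unfolding B_def using R by (intro mass_pos ball_nonempty) auto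
  have a: "0 < mass w A" using A by (intro mass_pos) auto
  have "S powr gam * 1 \<le> S powr gam * E z 1"
    by (intro mult_left_mono E_ge_1) auto
  also have "\<dots> \<le> 2 * E z S"
    using E_growth_lower[of 1 S z] S by simp
  also have "\<dots> \<le> 2 * (CE * ?M)"
    unfolding B_def S_def using E_le_max_mean_exit by simp
  finally have 1: "S powr gam \<le> 2 * CE * ?M" by simp
  have "?b \<le> V z S" unfolding B_def S_def by (rule mass_ball_le_volume)
  also have "\<dots> \<le> DV * S powr alpha * V z 1" using V_growth[of 1 S z] S by simp
  also have "V z 1 \<le> mass w A"
    using A mass_mono[OF A(1), of "{z}"] by (simp add: volume_1 mass_finite)
  finally have "?b \<le> DV * S powr alpha * mass w A"
    using DV_ge by (simp add: mult_left_mono)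
  then have "1 \<le> DV * S powr alpha * (mass w A / ?b)" using b by (simp add: field_simps)
  then have "1 powr ?d \<le> (DV * S powr alpha * (mass w A / ?b)) powr ?d"
    using gam_pos alpha_ge_1 by (intro powr_mono2) auto
  also have "\<dots> = DV powr ?d * S powr gam * (mass w A / ?b) powr ?d"
  proof -
    have "(DV * S powr alpha * Q) powr ?d = DV powr ?d * S powr gam * Q powr ?d" if "0 \<le> Q" for Q
      using DV_ge S alpha_ge_1 that by (simp add: powr_mult powr_powr)
    then show ?thesis using a b by (simp del: times_divide_eq_right)
  qed
  also have "\<dots> \<le> DV powr ?d * (2 * CE * ?M) * (mass w A / ?b) powr ?d"
    using 1 by (intro mult_right_mono mult_left_mono) auto
  finally show ?thesis by (simp add: mult_ac)
qed

end

lemma diagonal_upper_estimate_imp_mean_exit_ineq: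
  assumes "diagonal_upper_estimate w"
  shows "mean_exit_ineq w"
proof -
  obtain C where C: "0 < C" and *: "\<forall>x. \<forall>n\<ge>1. heat_kernel w n x x \<le> C / volume w x (real (exit_radius w x n))"
    using assms unfolding diagonal_upper_estimate_def by (elim exE conjE) (rule that)
  have due: "heat_kernel w n x x \<le> C / Wt x n" if "1 \<le> n" for n x
    using *[rule_format, OF that] that by (simp add: Wt_def max_absorb1)
  define d where "d = gam / alpha"
  have d: "0 < d" "alpha / gam = 1 / d"
    using gam_pos alpha_ge_1 by (auto simp: d_def)
  define K3 where "K3 = DV * (2 * CE) powr (1 / d)"
  have K3: "0 < K3" using DV_ge CE_ge by (simp add: K3_def)
  \<comment> \<open>Chosen so that (L q^d)^(1 / d) = 2 C K3 q: for n >= L M q^d the second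
    alternative of \<open>Wt_lower\<close> then yields \<open>Wt z n\<close> >= 2 C
    \<mu>(A).\<close>
  define L where "L = (2 * C * K3) powr d"
  have L: "0 < L" using C K3 by (simp add: L_def)
  define c4 where "c4 = 2 * CE * DV powr d"
  have c4: "0 < c4" using CE_ge DV_ge by (simp add: c4_def)
  define Cf where "Cf = max ((2 * C) powr d) (4 * (L + c4))"
  show ?thesis
    unfolding mean_exit_ineq_def
  proof (rule exI[of _ Cf], rule conjI[rotated], rule exI[of _ d], intro conjI allI impI)
    show "0 < Cf" using L c4 by (simp add: Cf_def less_max_iff_disj)
    fix x R A assume R: "(0::real) < R" and A: "A \<noteq> {}" "A \<subseteq> ball x (2 * R)"
    let ?B = "ball x (2 * R)"
    define b where "b = mass w ?B"
    define a where "a = mass w A"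
    define M where "M = max_mean_exit w ?B"
    define q where "q = a / b"
    have fin: "finite A" using A(2) finite_ball by (rule finite_subset)
    have neB: "?B \<noteq> {}" using A by auto
    have pos: "0 < a" "0 < b"
      unfolding a_def b_def using fin A neB by (auto intro: mass_pos)
    have q: "0 < q" using pos by (simp add: q_def)
    have M: "1 \<le> M" unfolding M_def using neB by (intro max_mean_exit_ge_1) auto
    have "max_mean_exit w A \<le> Cf * q powr d * M"
    \<comment> \<open>If A has a definite share of \<mu>(B), monotonicity in the set is enough.
      Otherwise 2 C \<mu>(A) <= \<mu>(B), as the first alternative of \<open>Wt_lower\<close>
      requires.\<close>
    proof (cases "1 \<le> 2 * C * q")
      case True
      have "max_mean_exit w A \<le> 1 * M"
        unfolding M_def using A by (simp add: max_mean_exit_mono)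
      also have "\<dots> \<le> (2 * C * q) powr d * M"
        using M True d by (intro mult_right_mono ge_one_powr_ge_zero) auto
      also have "\<dots> \<le> Cf * q powr d * M"
        using M C q by (intro mult_right_mono) (auto simp: powr_mult Cf_def intro: mult_right_mono)
      finally show ?thesis .
    next
      case False
      define m where "m = nat \<lceil>L * M * q powr d\<rceil>"
      \<comment> \<open>An even time, so that diagonal values control the off-diagonal ones.\<close>
      define n where "n = 2 * m"
      have LMq: "0 < L * M * q powr d" using L M q by simp
      then have m: "1 \<le> m" "L * M * q powr d \<le> m" "real m \<le> L * M * q powr d + 1"
        unfolding m_def by linarith+
      have n: "1 \<le> n" "L * M * q powr d \<le> n" using m by (auto simp: n_def)
      have W: "2 * C * a \<le> Wt z n" if z: "z \<in> A" for z
      proof -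
        have zB: "z \<in> ?B" using z A by auto
        show ?thesis
          using Wt_lower[OF R zB n(1)]
        proof
          assume "mass w ?B \<le> Wt z n"
          moreover have "2 * C * a \<le> b" using False pos by (simp add: q_def field_simps)
          ultimately show ?thesis by (simp add: b_def)
        next
          assume 1: "mass w ?B * (n / max_mean_exit w ?B) powr (alpha / gam) \<le> DV * (2 * CE) powr (alpha / gam) * Wt z n"
          have "2 * C * K3 * q = (L * q powr d) powr (1 / d)"
            using C K3 q d by (simp add: L_def powr_mult powr_powr)
          also have "\<dots> \<le> (n / M) powr (1 / d)"
            using n M d L q by (intro powr_mono2) (auto simp: field_simps)
          finally have "b * (2 * C * K3 * q) \<le> b * (n / M) powr (1 / d)"
            using pos by (intro mult_left_mono) auto
          also have "\<dots> \<le> K3 * Wt z n"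
            using 1 by (simp add: d(2) b_def M_def K3_def)
          finally have "K3 * (2 * C * a) \<le> K3 * Wt z n"
            using pos by (simp add: q_def mult_ac)
          then show ?thesis using K3 by simp
        qed
      qed
      have heat: "heat_kernel w n z z \<le> 1 / (2 * a)" if "z \<in> A" for z
      proof -
        have "heat_kernel w n z z \<le> C / Wt z n" by (rule due[OF n(1)])
        also have "\<dots> \<le> C / (2 * C * a)"
          using W[OF that] C pos Wt_pos by (intro divide_left_mono) auto
        finally show ?thesis using C by simp
      qed
      have half: "survival A n y \<le> 1 / 2" for y
      proof (cases "y \<in> A")
        case True
        have "survival A n y = (\<Sum>z\<in>A. hk A n y z * \<mu> z)" by (rule survival_eq_sum[OF fin])
        also have "\<dots> \<le> (\<Sum>z\<in>A. 1 / (2 * a) * \<mu> z)"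
        proof (intro sum_mono mult_right_mono)
          fix z assume z: "z \<in> A"
          have "hk A n u u \<le> 1 / (2 * a)" if "u \<in> A" for u
            using hk_le_heat_kernel[OF fin, of n u u] heat[OF that] by simp
          then have "hk A n y y * hk A n z z \<le> 1 / (2 * a) * (1 / (2 * a))"
            using True z pos by (intro mult_mono hk_nonneg) auto
          then have "sqrt (hk A n y y * hk A n z z) \<le> sqrt (1 / (2 * a) * (1 / (2 * a)))"
            by (rule real_sqrt_le_mono)
          also have "\<dots> = 1 / (2 * a)" using pos by (simp add: real_sqrt_divide real_sqrt_mult)
          finally show "hk A n y z \<le> 1 / (2 * a)"
            using hk_le_sqrt[OF fin, of m y z] by (simp add: n_def)
        qed auto
        also have "\<dots> = 1 / (2 * a) * a"
          by (simp add: a_def mass_finite[OF fin] sum_distrib_left)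
        finally show ?thesis using pos by simp
      qed simp
      have "max_mean_exit w A \<le> 2 * real n"
        using mean_exit_le_of_survival[OF fin half] by (intro max_mean_exit_le fin A) simp
      also have "\<dots> \<le> 4 * (L * M * q powr d + 1)"
        using m by (simp add: n_def)
      also have "1 \<le> c4 * M * q powr d"
      proof -
        obtain z where z: "z \<in> A" using A by auto
        then have "z \<in> ?B" using A by auto
        from max_mean_exit_lower[OF R this fin z] show ?thesis
          by (simp add: c4_def d_def M_def q_def a_def b_def)
      qed
      finally have "max_mean_exit w A \<le> 4 * (L * M * q powr d + c4 * M * q powr d)" by simp
      also have "\<dots> = 4 * (L + c4) * (q powr d * M)" by (simp add: algebra_simps)
      also have "\<dots> \<le> Cf * (q powr d * M)"
        using M by (intro mult_right_mono) (auto simp: Cf_def)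
      finally show ?thesis by simp
    qed
    then show "max_mean_exit w A / max_mean_exit w ?B \<le> Cf * (mass w A / mass w ?B) powr d"
      using M by (simp add: M_def q_def a_def b_def field_simps)
  qed (use d in auto)
qed

text \<open>On a ball \<open>B\<close> of radius \<open>r\<close> the function \<open>1 - E\<^sub>y(B) / (2 M)\<close>, with \<open>M\<close> the maximal mean exit
  time, is a \<open>(1 + \<lambda>)\<close>-supersolution; each crossing of such a ball gains a factor \<open>1 - 1/(2 CT)\<close>.\<close>

lemma exit_probability_chain:
  assumes r: "1 \<le> r" and lam: "0 < lam"
    and M: "\<And>z. graph_dist w x z \<le> K * r \<Longrightarrow> 1 \<le> lam * max_mean_exit w (ball z (real r))"
    and R: "real (K * r) \<le> R"
    and j: "j \<le> K" and z: "graph_dist w x z \<le> (K - j) * r"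
  shows "1 - survival (ball x R) m z \<le> (1 + lam) ^ m * (1 - 1 / (2 * CT)) ^ j"
  using j z
\<comment> \<open>Outer induction on the number of balls still to be crossed, for all times at once;
  the time induction is nested inside.\<close>
proof (induction j arbitrary: m z)
  case 0
  have "1 - survival (ball x R) m z \<le> 1" using survival_nonneg by simp
  also have "\<dots> \<le> (1 + lam) ^ m" using lam by (intro one_le_power) auto
  finally show ?case by simp
next
  case (Suc j)
  note outer = Suc.IH and prems = Suc.prems
  let ?A = "ball x R" and ?B = "ball z (real r)"
  define u where "u = (\<lambda>y. mean_exit w y ?B)"
  define T where "T = max_mean_exit w ?B"
  define h where "h = (\<lambda>y. 1 - u y / (2 * T))"
  define g where "g = (1 - 1 / (2 * CT)) ^ j"
  have g: "0 \<le> g" using CT_ge by (simp add: g_def)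
  have neB: "?B \<noteq> {}" using r by (intro ball_nonempty) auto
  have T: "1 \<le> T" unfolding T_def using neB by (intro max_mean_exit_ge_1) auto
  have zK: "graph_dist w x z \<le> K * r"
  proof -
    have "(K - Suc j) * r \<le> K * r" by (intro mult_le_mono1) simp
    with Suc.prems show ?thesis by linarith
  qed
  have lamT: "1 \<le> lam * T" unfolding T_def by (rule M[OF zK])
  have h: "1 / 2 \<le> h y" for y
  proof -
    have "u y \<le> T"
    proof (cases "y \<in> ?B")
      case True
      then show ?thesis unfolding u_def T_def by (intro max_mean_exit_ge) auto
    qed (use T in \<open>simp add: u_def\<close>)
    then show ?thesis using T by (simp add: h_def field_simps)
  qed
  have Kj: "(K - Suc j) * r + r = (K - j) * r"
  proof -
    have "K - j = Suc (K - Suc j)" using Suc.prems by simp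
    then show ?thesis by simp
  qed
  have near: "graph_dist w x y \<le> (K - j) * r" if "graph_dist w z y \<le> r" for y
    using dist_triangle[of x y z] Suc.prems that Kj by simp
  \<comment> \<open>Off the ball \<open>h\<close> is 1, and the outer hypothesis applies at a point
    at most one radius further out. Inside, one step of the walk costs a factor 1 +
    \<open>lam\<close>.\<close>
  have main: "1 - survival ?A m y \<le> (1 + lam) ^ m * g * h y" if "graph_dist w z y \<le> r" for m y
    using that
  proof (induction m arbitrary: y)
    case 0
    show ?case
    proof (cases "y \<in> ?B")
      case True
      have "real (graph_dist w x y) < R"
      proof -
        have "graph_dist w x y < (K - j) * r"
          using dist_triangle[of x y z] prems(2) True Kj by (simp add: mem_ball)
        also have "(K - j) * r \<le> K * r" by simp
        finally have "real (graph_dist w x y) < real (K * r)" by (simp only: of_nat_less_iff)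
        with R show ?thesis by simp
      qed
      then have "survival ?A 0 y = 1" by (simp add: survival_0 mem_ball)
      then show ?thesis using g h[of y] by simp
    next
      case False
      then have "h y = 1" by (simp add: h_def u_def)
      then show ?thesis
        using outer[of y 0] near[OF 0] prems(1) by (simp add: g_def)
    qed
  next
    case (Suc m)
    show ?case
    proof (cases "y \<in> ?B")
      case False
      then have "h y = 1" by (simp add: h_def u_def)
      then show ?thesis
        using outer[of y "Suc m"] near[OF Suc.prems] prems(1) by (simp add: g_def)
    next
      case True
      have yA: "y \<in> ?A"
      proof -
        have "graph_dist w x y < (K - j) * r"
          using dist_triangle[of x y z] prems(2) True Kj by (simp add: mem_ball)
        also have "(K - j) * r \<le> K * r" by simp
        finally have "real (graph_dist w x y) < real (K * r)" by (simp only: of_nat_less_iff)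
        with R show ?thesis by (simp add: mem_ball)
      qed
      \<comment> \<open>A finite set that carries all transitions from \<open>y\<close> as well as
        the supports of survival and \<open>u\<close>, so sums over it can be compared with total
        probability 1.\<close>
      define U where "U = ?A \<union> ?B \<union> nbrs y"
      have finU: "finite U" by (simp add: U_def finite_nbrs)
      have PU: "(\<Sum>v\<in>U. P y v) = 1"
        by (rule sum_trans_prob_eq_1[OF finU]) (simp add: U_def)
      have "survival ?A (Suc m) y = (\<Sum>v\<in>?A. P y v * survival ?A m v)"
        using yA by (simp add: survival_Suc killed_def)
      also have "\<dots> = (\<Sum>v\<in>U. P y v * survival ?A m v)"
        using finU by (intro sum.mono_neutral_left) (auto simp: U_def)
      finally have "1 - survival ?A (Suc m) y = (\<Sum>v\<in>U. P y v * (1 - survival ?A m v))"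
        using PU by (simp add: algebra_simps sum_subtractf)
      also have "\<dots> \<le> (\<Sum>v\<in>U. P y v * ((1 + lam) ^ m * g * h v))"
      proof (rule sum_mono)
        fix v assume "v \<in> U"
        show "P y v * (1 - survival ?A m v) \<le> P y v * ((1 + lam) ^ m * g * h v)"
        proof (cases "adjacent w y v")
          case True
          have "graph_dist w z v \<le> r"
            using dist_triangle[of z v y] dist_adjacent[OF True] \<open>y \<in> ?B\<close> by (simp add: mem_ball)
          from Suc.IH[OF this] show ?thesis by (intro mult_left_mono trans_prob_nonneg)
        qed (simp add: trans_prob_eq_0)
      qed
      also have "\<dots> = (1 + lam) ^ m * g * (\<Sum>v\<in>U. P y v * h v)"
        by (simp add: sum_distrib_left mult_ac)
      also have "(\<Sum>v\<in>U. P y v * h v) = h y + 1 / (2 * T)"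
      proof -
        have "(\<Sum>v\<in>U. P y v * u v) = (\<Sum>v\<in>?B. P y v * u v)"
          using finU by (intro sum.mono_neutral_right) (auto simp: U_def u_def)
        also have "\<dots> = u y - 1"
          using mean_exit_rec[of ?B y] True by (simp add: u_def killed_def)
        finally have "(\<Sum>v\<in>U. P y v * u v) = u y - 1" .
        moreover have "(\<Sum>v\<in>U. P y v * h v) = (\<Sum>v\<in>U. P y v) - (\<Sum>v\<in>U. P y v * u v) / (2 * T)"
          by (simp add: h_def algebra_simps sum_subtractf sum_divide_distrib)
        ultimately show ?thesis using PU T by (simp add: h_def field_simps)
      qed
      \<comment> \<open>This is where lam T >= 1 and h >= 1/2 enter.\<close>
      also have "(1 + lam) ^ m * g * (h y + 1 / (2 * T)) \<le> (1 + lam) ^ m * g * ((1 + lam) * h y)"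
      proof (rule mult_left_mono)
        have "1 / (2 * T) \<le> lam * (1 / 2)" using lamT T by (simp add: field_simps)
        also have "\<dots> \<le> lam * h y" using lam h by (intro mult_left_mono) auto
        finally show "h y + 1 / (2 * T) \<le> (1 + lam) * h y" by (simp add: algebra_simps)
      qed (use lam g in auto)
      finally show ?thesis by (simp add: mult_ac)
    qed
  qed
  \<comment> \<open>By (TC) the mean exit time at the centre is at least T / CT: the gain of one
    crossing.\<close>
  have "h z \<le> 1 - 1 / (2 * CT)"
  proof -
    have "T \<le> CT * u z"
      unfolding T_def u_def using max_mean_exit_ball_le[of "real r" z] r by (simp add: mean_exit_ball_def)
    then show ?thesis using T CT_ge by (simp add: h_def field_simps)
  qed
  then have "(1 + lam) ^ m * g * h z \<le> (1 + lam) ^ m * g * (1 - 1 / (2 * CT))"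
    using lam g by (intro mult_left_mono) auto
  with main[of z m] show ?case by (simp add: g_def mult_ac)
qed

text \<open>Normalised by eta^beta = 1 / CE^2, so that k = eta (E(x, R) / n)^(1 / beta) satisfies k
  <= R once R >= 1, and lam n <= CT for the rate \<open>lam\<close> used in
  \<open>exit_probability_le\<close>.\<close>

definition eta :: real where "eta = (1 / CE\<^sup>2) powr (1 / beta)"
text \<open>In the exponent, CT bounds lam n and the 1 pays for rounding the number of
  balls.\<close>

definition tail_const :: real where "tail_const = exp (CT + 1)"
definition tail_rate :: real where "tail_rate = eta / (4 * CT)"

lemma tail_rate_pos: "0 < tail_rate"
  using CE_ge CT_ge by (simp add: tail_rate_def eta_def)

text \<open>Small balls of radius about R / k allow a rate \<open>lam\<close> of order k^beta / E(x,
  R). The choice of k keeps (1 + lam)^n bounded, and about k / 2 crossings leave a factor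
  exponentially small in k.\<close>

lemma exit_probability_le:
  assumes R: "0 < R" and n: "1 \<le> n"
  shows "1 - survival (ball x R) n x \<le> tail_const * exp (- (tail_rate * (E x R / n) powr (1 / beta)))"
proof -
  have main: "1 - survival (ball x R) n x \<le> tail_const * exp (- (tail_rate * (E x R / n) powr (1 / beta)))"
    if R: "1 \<le> R" for R
  proof -
    define k where "k = eta * (E x R / n) powr (1 / beta)"
    have eta: "0 < eta" using CE_ge by (simp add: eta_def)
    have etab: "eta powr beta = 1 / CE\<^sup>2" using beta_ge_1 CE_ge by (simp add: eta_def powr_powr)
    have EP: "0 < E x R" using R by (intro E_pos) auto
    have k: "0 < k" using eta EP n by (simp add: k_def)
    have kb: "k powr beta = E x R / n / CE\<^sup>2"
      using beta_ge_1 etab EP n by (simp add: k_def powr_mult powr_powr)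
    have rate: "tail_rate * (E x R / n) powr (1 / beta) = k / (4 * CT)"
      by (simp add: tail_rate_def k_def)
    show ?thesis
    proof (cases "1 \<le> k")
      \<comment> \<open>For k < 1 the right-hand side is at least 1, thanks to
        \<open>tail_const\<close>.\<close>
      case False
      have "k / (4 * CT) \<le> 1 / 1" using False CT_ge k by (intro frac_le) auto
      then have "k / (4 * CT) \<le> CT + 1" using CT_ge by linarith
      then have "1 \<le> exp (CT + 1 - k / (4 * CT))" by simp
      also have "\<dots> = tail_const * exp (- (k / (4 * CT)))"
        by (simp add: tail_const_def flip: exp_add)
      finally show ?thesis unfolding rate using survival_nonneg[of "ball x R" n x] by linarith
    next
      case True
      \<comment> \<open>The small radius R / k must be at least 1; growth from radius 1 gives E(x,
        R) <= CE^2 R^beta, which rules out k > R.\<close>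
      have kR: "k \<le> R"
      proof (rule ccontr)
        assume "\<not> k \<le> R"
        then have "R powr beta < k powr beta" using R beta_ge_1 by (intro powr_less_mono2) auto
        then have "CE\<^sup>2 * R powr beta < CE\<^sup>2 * k powr beta"
          using CE_ge by (intro mult_strict_left_mono) auto
        also have "\<dots> = E x R / n" unfolding kb using CE_ge by simp
        also have "\<dots> \<le> E x R" using n EP by (simp add: field_simps)
        also have "E x R \<le> CT * R powr beta * E x 1" using E_growth[of 1 R x] R by simp
        also have "\<dots> \<le> CE * R powr beta * CE"
          using E_1[of x] CE_ge CT_ge E_nonneg by (intro mult_mono) auto
        finally show False by (simp add: power2_eq_square mult_ac)
      qed
      \<comment> \<open>Rounding is harmless: r <= 2 R / k since R / k >= 1, and at least k / 2 - 1
        steps of length r fit into R.\<close>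
      define r where "r = nat \<lceil>R / k\<rceil>"
      define K where "K = nat \<lfloor>R / r\<rfloor>"
      have Rk: "1 \<le> R / k" using kR k by simp
      then have r: "R / k \<le> real r" "real r \<le> R / k + 1" "1 \<le> r" unfolding r_def by linarith+
      have r2: "real r \<le> 2 * (R / k)" using r Rk by linarith
      have "R / k \<le> R" using True R k by (simp add: field_simps)
      then have r2R: "real r \<le> 2 * R" using r2 by linarith
      have "0 \<le> R / r" using R by simp
      then have K: "real K \<le> R / r" "R / r - 1 \<le> real K" unfolding K_def by linarith+
      have KrR: "real (K * r) \<le> R" using K r by (simp add: field_simps)
      have "k * r \<le> 2 * R" using r2 k by (simp add: field_simps)
      then have "k / 2 \<le> R / r" using r(3) by (simp add: field_simps)
      then have Kk: "k / 2 - 1 \<le> K" using K by linarith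
      \<comment> \<open>By (TC) and growth, with 2 R / r <= 2 k, E(x, R) is at most CT^2 (2 k)^beta
        times the maximal mean exit time of each small ball.\<close>
      define lam where "lam = CT\<^sup>2 * (2 * k) powr beta / E x R"
      have lam: "0 < lam" using CT_ge k EP by (simp add: lam_def)
      have M: "1 \<le> lam * max_mean_exit w (ball z (real r))" if d: "graph_dist w x z \<le> K * r" for z
      proof -
        have dR: "real (graph_dist w z x) < 2 * R"
        proof -
          have "real (graph_dist w x z) \<le> real (K * r)" using d by (simp only: of_nat_le_iff)
          then show ?thesis using KrR R by (simp add: dist_sym)
        qed
        have "E x R \<le> E x (2 * (2 * R))" using R by (intro E_mono) auto
        also have "\<dots> \<le> CT * E z (2 * R)" by (rule E_near[OF dR])
        also have "\<dots> \<le> CT * (CT * (2 * R / r) powr beta * E z r)"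
          using CT_ge r r2R by (intro mult_left_mono E_growth) auto
        also have "\<dots> \<le> CT * (CT * (2 * k) powr beta * max_mean_exit w (ball z (real r)))"
        proof (intro mult_left_mono mult_mono)
          show "(2 * R / r) powr beta \<le> (2 * k) powr beta"
            using r(1,3) R k beta_ge_1 by (intro powr_mono2) (auto simp: field_simps)
          show "E z r \<le> max_mean_exit w (ball z (real r))"
            using r by (intro E_le_max_mean_exit_ball) auto
        qed (use CT_ge E_nonneg in auto)
        finally have "1 \<le> CT * (CT * (2 * k) powr beta * max_mean_exit w (ball z (real r))) / E x R"
          using EP by (simp add: pos_le_divide_eq)
        then show ?thesis by (simp add: lam_def power2_eq_square)
      qed
      have lamn: "lam * n \<le> CT"
      proof -
        have "lam * n = CT\<^sup>2 * 2 powr beta * (k powr beta * n / E x R)"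
          by (simp add: lam_def powr_mult k less_imp_le)
        also have "k powr beta * n / E x R = 1 / CE\<^sup>2"
          unfolding kb using n EP by simp
        also have "CT\<^sup>2 * 2 powr beta * (1 / CE\<^sup>2) = CT\<^sup>2 * CT * (1 / CE\<^sup>2)"
          using CT_ge by (simp add: beta_def)
        also have "\<dots> \<le> CT"
        proof -
          have "CT\<^sup>2 \<le> CE\<^sup>2" using CE_ge CT_ge by (intro power_mono) auto
          then have "CT\<^sup>2 / CE\<^sup>2 \<le> 1" using CE_ge by simp
          then have "CT * (CT\<^sup>2 / CE\<^sup>2) \<le> CT * 1" using CT_ge by (intro mult_left_mono) auto
          then show ?thesis by (simp add: mult_ac)
        qed
        finally show ?thesis .
      qed
      have "1 - survival (ball x R) n x \<le> (1 + lam) ^ n * (1 - 1 / (2 * CT)) ^ K"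
        by (rule exit_probability_chain[OF r(3) lam M KrR]) auto
      also have "\<dots> \<le> exp (lam * n) * exp (- (K / (2 * CT)))"
      proof (intro mult_mono)
        have "(1 + lam) ^ n \<le> exp lam ^ n" using lam by (intro power_mono) (auto simp: exp_ge_add_one_self)
        then show "(1 + lam) ^ n \<le> exp (lam * n)" by (simp only: exp_of_nat2_mult)
        have "1 - 1 / (2 * CT) \<le> exp (- (1 / (2 * CT)))" using exp_ge_add_one_self[of "- (1 / (2 * CT))"] by simp
        then have "(1 - 1 / (2 * CT)) ^ K \<le> exp (- (1 / (2 * CT))) ^ K"
          using CT_ge by (intro power_mono) auto
        also have "\<dots> = exp (- (K / (2 * CT)))" using exp_of_nat_mult[of K "- (1 / (2 * CT))"] by simp
        finally show "(1 - 1 / (2 * CT)) ^ K \<le> exp (- (K / (2 * CT)))" .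
      qed (use CT_ge in auto)
      also have "\<dots> = exp (lam * n - K / (2 * CT))" by (simp flip: exp_add)
      also have "\<dots> \<le> exp (CT + 1 - k / (4 * CT))"
      proof -
        have "(k / 2 - 1) / (2 * CT) \<le> K / (2 * CT)" using Kk CT_ge by (intro divide_right_mono) auto
        moreover have "(k / 2 - 1) / (2 * CT) = k / (4 * CT) - 1 / (2 * CT)" using CT_ge by (simp add: field_simps)
        moreover have "1 / (2 * CT) \<le> 1" using CT_ge by simp
        ultimately show ?thesis using lamn by simp
      qed
      also have "\<dots> = tail_const * exp (- (k / (4 * CT)))"
        by (simp add: tail_const_def flip: exp_add)
      finally show ?thesis unfolding rate .
    qed
  qed
  show ?thesis
  proof (cases "1 \<le> R")
    case False
    \<comment> \<open>All balls of radius in (0, 1] are the single vertex, so the case R = 1 covers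
      them.\<close>
    have "ball x R = ball x 1" using R False by (simp add: ball_small)
    then show ?thesis using main[of 1] by (simp add: mean_exit_ball_def)
  qed (rule main)
qed

end

section \<open>Nash inequality for the killed walk\<close>

text \<open>Discrete form of a' = - a^(1 + \<delta>) / Q: the quantity a^(-\<delta>) grows by at
  least \<delta> / Q per step. Vanishing values are carried as an alternative because
  \<open>0 powr _\<close> is 0.\<close>

lemma powr_decay:
  fixes a :: "nat \<Rightarrow> real"
  assumes nonneg: "\<And>k. 0 \<le> a k" and \<delta>: "0 < \<delta>" and Q: "0 < Q"
    and step: "\<And>k. a k powr (1 + \<delta>) \<le> Q * (a k - a (Suc k))" and k: "1 \<le> k"
  shows "a k \<le> (Q / (\<delta> * k)) powr (1 / \<delta>)"
proof -
  have inv: "a k = 0 \<or> \<delta> * k / Q \<le> a k powr (- \<delta>)" for k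
  proof (induction k)
    case (Suc k)
    show ?case
    proof (cases "a (Suc k) = 0")
      case False
      define x y where "x = a k" and "y = a (Suc k)"
      have y: "0 < y" using False nonneg[of "Suc k"] by (simp add: y_def)
      have "0 \<le> Q * (x - y)" using step[of k] by (simp add: x_def y_def) (smt (verit) powr_ge_zero)
      then have xy: "y \<le> x" using Q by (simp add: zero_le_mult_iff)
      then have x: "0 < x" using y by simp
      have IH: "\<delta> * k / Q \<le> x powr (- \<delta>)" using Suc.IH x by (simp add: x_def)
      \<comment> \<open>Towards (y / x)^(-\<delta>) >= 1 + \<delta> (1 - y / x), from ln s <= s - 1
        and exp s >= 1 + s.\<close>
      have "\<delta> * (1 - y / x) \<le> - (\<delta> * ln (y / x))"
      proof -
        have "\<delta> * ln (y / x) \<le> \<delta> * (y / x - 1)"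
          using ln_le_minus_one[of "y / x"] x y \<delta> by (intro mult_left_mono) auto
        then show ?thesis by (simp add: algebra_simps)
      qed
      then have "1 + \<delta> * (1 - y / x) \<le> exp (- (\<delta> * ln (y / x)))"
        using exp_ge_add_one_self[of "- (\<delta> * ln (y / x))"] by linarith
      also have "\<dots> = (y / x) powr (- \<delta>)" using x y by (simp add: powr_def)
      finally have B: "1 + \<delta> * (1 - y / x) \<le> (y / x) powr (- \<delta>)" .
      have "x * x powr \<delta> \<le> Q * (x - y)"
        using step[of k] x by (simp add: powr_add x_def y_def)
      then have "1 / Q \<le> x powr (- \<delta>) * (1 - y / x)"
        using x Q by (simp add: powr_minus field_simps)
      then have "\<delta> * (1 / Q) \<le> \<delta> * (x powr (- \<delta>) * (1 - y / x))" using \<delta> by (intro mult_left_mono) auto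
      then have "\<delta> * Suc k / Q \<le> x powr (- \<delta>) * (1 + \<delta> * (1 - y / x))"
        using IH by (simp add: algebra_simps add_divide_distrib)
      also have "\<dots> \<le> x powr (- \<delta>) * (y / x) powr (- \<delta>)" using B by (intro mult_left_mono) auto
      also have "\<dots> = y powr (- \<delta>)" using x y by (simp flip: powr_mult)
      finally show ?thesis by (simp add: y_def)
    qed simp
  qed simp
  show ?thesis
  proof (cases "a k = 0")
    case False
    then have ak: "0 < a k" using nonneg[of k] by simp
    have c: "0 < \<delta> * k / Q" using \<delta> Q k by simp
    have "\<delta> * k / Q \<le> a k powr (- \<delta>)" using inv[of k] False by simp
    then have "(a k powr (- \<delta>)) powr (- (1 / \<delta>)) \<le> (\<delta> * k / Q) powr (- (1 / \<delta>))"
      using c \<delta> by (intro powr_mono2') auto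
    also have "\<dots> = (Q / (\<delta> * k)) powr (1 / \<delta>)"
      using \<delta> Q k by (simp add: powr_minus powr_divide)
    finally show ?thesis using \<delta> ak by (simp add: powr_powr)
  qed simp
qed

text \<open>From ln s <= s at s = (c / p) (1 + T), multiplied by p. Polynomial losses are absorbed
  in this way by exponential decay.\<close>

lemma poly_le_exp:
  assumes "0 \<le> p" "0 < (c :: real)"
  shows "\<exists>C>0. \<forall>T\<ge>0. (1 + T) powr p \<le> C * exp (c * T)"
proof (cases "p = 0")
  case True
  show ?thesis
    by (rule exI[of _ 1]) (use True assms in auto)
next
  case False
  then have p: "0 < p" using assms by simp
  show ?thesis
  proof (rule exI[of _ "exp (c - p * ln (c / p))"], intro conjI allI impI)
    fix T :: real assume T: "0 \<le> T"
    have "ln ((c / p) * (1 + T)) \<le> (c / p) * (1 + T)"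
      using ln_le_minus_one[of "(c / p) * (1 + T)"] p assms T by simp
    moreover have "ln ((c / p) * (1 + T)) = ln (c / p) + ln (1 + T)"
      using p assms T by (subst ln_mult) auto
    ultimately have "ln (c / p) + ln (1 + T) \<le> (c / p) * (1 + T)"
      by simp
    then have "p * (ln (c / p) + ln (1 + T)) \<le> p * ((c / p) * (1 + T))"
      using p by (intro mult_left_mono) auto
    also have "\<dots> = c * (1 + T)"
      using p by simp
    finally have "p * ln (1 + T) \<le> (c - p * ln (c / p)) + c * T"
      by (simp add: algebra_simps)
    then have "exp (p * ln (1 + T)) \<le> exp ((c - p * ln (c / p)) + c * T)" by simp
    then show "(1 + T) powr p \<le> exp (c - p * ln (c / p)) * exp (c * T)"
      using T by (simp add: powr_def exp_add)
  qed simp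
qed

context bounded_prob_graph begin

text \<open>Decomposition at the first exit from \<open>A\<close>: \<open>h\<close> is the mass
  stepping out at one time, and its total over time telescopes to 1 - survival. The remaining time,
  from a to a + m - 1, goes to the second factor, which is at most \<open>M\<close> at the exit
  points.\<close>

lemma exit_decomposition:
  assumes fin: "finite S" and AS: "A \<subseteq> S" and x: "x \<in> A" and M: "0 \<le> M"
    and bound: "\<And>k z y. z \<in> S - A \<Longrightarrow> y \<in> A \<Longrightarrow> adjacent w y z \<Longrightarrow> a \<le> k \<Longrightarrow> k < a + m \<Longrightarrow> hk S k y0 z \<le> M"
  shows "ip S (\<lambda>z. hk S m x z - hk A m x z) (hk S a y0) \<le> M * (1 - survival A m x)"
  using bound
proof (induction m arbitrary: a)
  case 0
  have "hk S 0 x z = hk A 0 x z" for z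
    using x AS by (auto simp: hk_0)
  then show ?case using x by (simp add: ip_def survival_0)
next
  case (Suc m)
  have finA: "finite A" using AS fin by (rule finite_subset)
  define f where "f = hk A m x"
  define h where "h = (\<lambda>z. killed S f z - killed A f z)"
  have f0: "f z = 0" if "z \<notin> A" for z using that by (simp add: f_def hk_outside)
  have fnn: "0 \<le> f z" for z by (simp add: f_def hk_nonneg)
  have hA: "h z = 0" if "z \<in> A" for z
  proof -
    have "(\<Sum>v\<in>S. P z v * f v) = (\<Sum>v\<in>A. P z v * f v)"
      using fin AS f0 by (intro sum.mono_neutral_right) auto
    then show ?thesis using that AS by (auto simp: h_def killed_def)
  qed
  have hnn: "0 \<le> h z" for z
    using killed_mono_set[OF fin AS, of f f z] fnn by (simp add: h_def)
  have dec: "hk S (Suc m) x z - hk A (Suc m) x z = killed S (\<lambda>z. hk S m x z - hk A m x z) z + h z" for z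
    by (simp add: hk_Suc killed_diff h_def f_def)
  have hz: "h z * hk S a y0 z \<le> h z * M" if z: "z \<in> S" for z
  proof (cases "z \<notin> A \<and> (\<exists>y\<in>A. adjacent w y z)")
    case True
    then obtain y where "y \<in> A" "adjacent w y z" by auto
    with True z have "hk S a y0 z \<le> M" by (intro Suc.prems) auto
    then show ?thesis using hnn by (intro mult_left_mono)
  next
    case False
    have "h z = 0"
    proof (cases "z \<in> A")
      case zA: False
      have "P z v * f v = 0" for v
        using False zA f0[of v] trans_prob_eq_0[of z v] adjacent_sym[of v z] by (cases "v \<in> A") auto
      then have "(\<Sum>v\<in>S. P z v * f v) = 0" by (intro sum.neutral ballI)
      then have "killed S f z = 0" by (simp add: killed_def)
      then show ?thesis using zA by (simp add: h_def)
    qed (rule hA)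
    then show ?thesis by simp
  qed
  have hsum: "(\<Sum>z\<in>S. h z * \<mu> z) \<le> survival A m x - survival A (Suc m) x"
  proof -
    have "(\<Sum>z\<in>S. h z * \<mu> z) = ip S (killed S f) (\<lambda>_. 1) - (\<Sum>z\<in>S. killed A f z * \<mu> z)"
      by (simp add: ip_def h_def algebra_simps sum_subtractf)
    also have "(\<Sum>z\<in>S. killed A f z * \<mu> z) = (\<Sum>z\<in>A. killed A f z * \<mu> z)"
      using fin AS by (intro sum.mono_neutral_right) auto
    also have "\<dots> = survival A (Suc m) x"
      by (simp add: survival_eq_sum[OF finA] hk_Suc f_def)
    also have "ip S (killed S f) (\<lambda>_. 1) = ip S f (killed S (\<lambda>_. 1))"
      by (rule killed_selfadjoint)
    also have "\<dots> = ip S (killed S (\<lambda>_. 1)) f" by (rule ip_sym)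
    also have "\<dots> \<le> ip S (\<lambda>_. 1) f"
      using fin fnn by (intro ip_mono killed_le_bound) auto
    also have "\<dots> = (\<Sum>z\<in>A. f z * \<mu> z)"
      unfolding ip_def using fin AS f0 by (simp, intro sum.mono_neutral_right) auto
    also have "\<dots> = survival A m x" by (simp add: survival_eq_sum[OF finA] f_def)
    finally show ?thesis by simp
  qed
  have "ip S (\<lambda>z. hk S (Suc m) x z - hk A (Suc m) x z) (hk S a y0)
      = ip S (killed S (\<lambda>z. hk S m x z - hk A m x z)) (hk S a y0) + ip S h (hk S a y0)"
    by (simp add: dec ip_add_left)
  also have "ip S (killed S (\<lambda>z. hk S m x z - hk A m x z)) (hk S a y0)
      = ip S (\<lambda>z. hk S m x z - hk A m x z) (hk S (Suc a) y0)"
    by (simp add: killed_selfadjoint hk_Suc)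
  also have "\<dots> \<le> M * (1 - survival A m x)"
    by (rule Suc.IH) (use Suc.prems in auto)
  also have "ip S h (hk S a y0) \<le> (\<Sum>z\<in>S. h z * M * \<mu> z)"
    unfolding ip_def using hz by (intro sum_mono mult_right_mono) auto
  also have "\<dots> = M * (\<Sum>z\<in>S. h z * \<mu> z)"
    by (simp add: sum_distrib_left mult_ac)
  also have "\<dots> \<le> M * (survival A m x - survival A (Suc m) x)"
    using hsum M by (rule mult_left_mono)
  finally show ?case by (simp add: algebra_simps)
qed

text \<open>The killed operator has no spectrum below -1: expand the sum of w(x, y) (g(x) +
  g(y))^2.\<close>

lemma ip_plus_ip_killed_nonneg:
  assumes "finite A"
  shows "0 \<le> ip A g g + ip A g (killed A g)"
proof -
  have K: "ip A g (killed A g) = (\<Sum>x\<in>A. \<Sum>y\<in>A. w x y * (g x * g y))"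
    unfolding ip_def killed_def
    by (simp add: sum_distrib_left sum_distrib_right algebra_simps flip: trans_prob_reversible)
  have I: "(\<Sum>x\<in>A. \<Sum>y\<in>A. w x y * (g x * g x)) \<le> ip A g g"
    unfolding ip_def
  proof (rule sum_mono)
    fix x assume "x \<in> A"
    have "(\<Sum>y\<in>A. w x y * (g x * g x)) = (g x * g x * \<mu> x) * (\<Sum>y\<in>A. P x y)"
      by (simp add: sum_distrib_left algebra_simps flip: trans_prob_reversible[of x])
    also have "\<dots> \<le> (g x * g x * \<mu> x) * 1"
      using assms by (intro mult_left_mono sum_trans_prob_le_1) auto
    finally show "(\<Sum>y\<in>A. w x y * (g x * g x)) \<le> g x * g x * \<mu> x" by simp
  qed
  have I': "(\<Sum>x\<in>A. \<Sum>y\<in>A. w x y * (g y * g y)) = (\<Sum>x\<in>A. \<Sum>y\<in>A. w x y * (g x * g x))"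
    by (subst sum.swap) (simp add: weight_sym)
  have "0 \<le> (\<Sum>x\<in>A. \<Sum>y\<in>A. w x y * ((g x + g y) * (g x + g y)))"
    by (intro sum_nonneg mult_nonneg_nonneg[OF weight_nonneg zero_le_square])
  also have "\<dots> = (\<Sum>x\<in>A. \<Sum>y\<in>A. w x y * (g x * g x)) + (\<Sum>x\<in>A. \<Sum>y\<in>A. w x y * (g y * g y))
      + 2 * (\<Sum>x\<in>A. \<Sum>y\<in>A. w x y * (g x * g y))"
    by (simp add: algebra_simps sum.distrib sum_distrib_left)
  finally show ?thesis using K I I' by linarith
qed

text \<open>Faber-Krahn is applied to the level set {f > s} and the truncation (f - s)^+. With s = I
  / (4 N) the truncation keeps half of the squared norm I, and Markov's inequality bounds the
  measure of the level set by 4 N^2 / I.\<close>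

lemma Nash_inequality:
  assumes B: "finite B" and Kf: "0 < Kf" and \<delta>: "0 < \<delta>"
    and FK: "\<And>\<Omega>. \<Omega> \<noteq> {} \<Longrightarrow> \<Omega> \<subseteq> B \<Longrightarrow> inv_eigenvalue w \<Omega> \<le> Kf * mass w \<Omega> powr \<delta>"
    and f0: "\<And>x. x \<notin> B \<Longrightarrow> f x = 0" and fnn: "\<And>x. 0 \<le> f x" and N: "0 < N"
    and f1: "(\<Sum>x\<in>B. f x * \<mu> x) \<le> N"
  shows "ip B f f powr (1 + \<delta>) \<le> 2 * Kf * (4 * N\<^sup>2) powr \<delta> * form B f f"
proof (cases "ip B f f = 0")
  case True
  then show ?thesis using Kf by (simp add: bil_nonneg)
next
  case False
  define I where "I = ip B f f"
  have I: "0 < I" using False ip_self_nonneg[of B f] by (simp add: I_def)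
  define s where "s = I / (4 * N)"
  have s: "0 < s" using I N by (simp add: s_def)
  define \<Omega> where "\<Omega> = {x \<in> B. s < f x}"
  define g where "g = (\<lambda>x. max 0 (f x - s))"
  have sub: "\<Omega> \<subseteq> B" by (auto simp: \<Omega>_def)
  have finO: "finite \<Omega>" using sub B by (rule finite_subset)
  have gO: "g x = 0" if "x \<notin> \<Omega>" for x
    using that f0[of x] s by (cases "x \<in> B") (auto simp: \<Omega>_def g_def)
  have lower: "I / 2 \<le> ip B g g"
  proof -
    have "I - 2 * s * (\<Sum>x\<in>B. f x * \<mu> x) = (\<Sum>x\<in>B. (f x * f x - 2 * s * f x) * \<mu> x)"
      by (simp add: I_def ip_def algebra_simps sum_subtractf sum_distrib_left)
    also have "\<dots> \<le> ip B g g"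
      unfolding ip_def
    proof (intro sum_mono mult_right_mono)
      fix x
      show "f x * f x - 2 * s * f x \<le> g x * g x"
      proof (cases "s \<le> f x")
        case True
        have "0 \<le> s * s" by simp
        then show ?thesis using True by (simp add: g_def algebra_simps)
      next
        case False
        have "f x * (f x - 2 * s) \<le> 0" using False fnn[of x] s by (intro mult_nonneg_nonpos) auto
        then show ?thesis using False by (simp add: g_def algebra_simps)
      qed
    qed simp
    finally have "I - 2 * s * (\<Sum>x\<in>B. f x * \<mu> x) \<le> ip B g g" .
    moreover have "2 * s * (\<Sum>x\<in>B. f x * \<mu> x) \<le> 2 * s * N"
      using f1 s by (intro mult_left_mono) auto
    moreover have "2 * s * N = I / 2" using N by (simp add: s_def)
    ultimately show ?thesis by linarith
  qed
  have ipO: "ip \<Omega> g g = ip B g g"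
    using B sub gO by (intro ip_restrict[symmetric]) auto
  have neO: "\<Omega> \<noteq> {}"
  proof
    assume "\<Omega> = {}"
    then have "ip B g g = 0" using ipO by (simp add: ip_def)
    with lower I show False by simp
  qed
  have massO: "mass w \<Omega> \<le> 4 * N\<^sup>2 / I"
  proof -
    have "s * mass w \<Omega> = (\<Sum>x\<in>\<Omega>. s * \<mu> x)"
      by (simp add: mass_finite[OF finO] sum_distrib_left)
    also have "\<dots> \<le> (\<Sum>x\<in>\<Omega>. f x * \<mu> x)"
      by (intro sum_mono mult_right_mono) (auto simp: \<Omega>_def)
    also have "\<dots> \<le> (\<Sum>x\<in>B. f x * \<mu> x)"
      using B sub fnn by (intro sum_mono2) auto
    also have "\<dots> \<le> N" by (rule f1)
    finally show ?thesis using I N by (simp add: s_def field_simps power2_eq_square)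
  qed
  have form: "form \<Omega> g g \<le> form B f f"
  proof -
    have "form \<Omega> g g = form B g g" by (rule form_independent[OF B sub gO])
    also have "\<dots> \<le> form B f f"
      unfolding g_def by (rule bil_lipschitz[where \<phi> = "\<lambda>a. max 0 (a - s)"]) auto
    finally show ?thesis .
  qed
  have "eigenvalue w \<Omega> * ip \<Omega> g g \<le> form \<Omega> g g"
    by (rule eigenvalue_mult_ip_le[OF finO gO])
  then have "ip \<Omega> g g \<le> inv_eigenvalue w \<Omega> * form \<Omega> g g"
    using eigenvalue_pos[OF finO neO] by (simp add: inv_eigenvalue_def field_simps)
  also have "\<dots> \<le> (Kf * (4 * N\<^sup>2 / I) powr \<delta>) * form B f f"
  proof (rule mult_mono[OF _ form])
    have "inv_eigenvalue w \<Omega> \<le> Kf * mass w \<Omega> powr \<delta>" by (rule FK[OF neO sub])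
    also have "\<dots> \<le> Kf * (4 * N\<^sup>2 / I) powr \<delta>"
      using massO Kf \<delta> mass_pos[OF finO neO] by (intro mult_left_mono powr_mono2) auto
    finally show "inv_eigenvalue w \<Omega> \<le> Kf * (4 * N\<^sup>2 / I) powr \<delta>" .
  qed (use Kf in \<open>auto simp: bil_nonneg\<close>)
  finally have "I / 2 \<le> (Kf * (4 * N\<^sup>2 / I) powr \<delta>) * form B f f"
    using lower ipO by simp
  then have "I * I powr \<delta> \<le> 2 * Kf * (4 * N\<^sup>2) powr \<delta> * form B f f"
    using I by (simp add: powr_divide field_simps)
  then show ?thesis
    using I by (simp add: powr_add flip: I_def)
qed

text \<open>Since the walk may be periodic, \<open>P\<close> may have the eigenvalue \<open>-1\<close>; the Nash inequality is therefore
  applied to \<open>f\<^sub>k + f\<^sub>k\<^sub>+\<^sub>1\<close> instead of \<open>f\<^sub>k\<close>, and \<open>(1 - t) (1 + t)\<^sup>2 \<le> 2 (1 - t\<^sup>2)\<close> on \<open>[-1, 1]\<close>.\<close>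

lemma killed_diagonal_upper:
  assumes B: "finite B" and Kf: "0 < Kf" and \<delta>: "0 < \<delta>"
    and FK: "\<And>\<Omega>. \<Omega> \<noteq> {} \<Longrightarrow> \<Omega> \<subseteq> B \<Longrightarrow> inv_eigenvalue w \<Omega> \<le> Kf * mass w \<Omega> powr \<delta>"
    and m: "1 \<le> m"
  shows "hk B (2 * m) x x \<le> (4 * Kf * 16 powr \<delta> / (\<delta> * m)) powr (1 / \<delta>)"
proof (rule powr_decay[where a = "\<lambda>k. hk B (2 * k) x x", OF hk_nonneg \<delta> _ _ m])
  show "0 < 4 * Kf * 16 powr \<delta>" using Kf by simp
  fix k
  define f where "f = (\<lambda>i. hk B (k + i) x)"
  define A where "A = (\<lambda>i. hk B (2 * k + i) x x)"
  have ipf: "ip B (f i) (f j) = A (i + j)" for i j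
    unfolding f_def A_def by (simp add: ip_hk[OF B] mult_2 add_ac)
  have fS: "killed B (f i) = f (Suc i)" for i
    by (simp add: f_def hk_Suc)
  define h where "h = (\<lambda>y. f 0 y + f 1 y)"
  define g where "g = (\<lambda>y. f 0 y - f 1 y)"
  have kh: "killed B h = (\<lambda>y. f 1 y + f 2 y)"
    unfolding h_def by (rule ext) (simp add: killed_add fS numeral_2_eq_2)
  have kg: "killed B g = (\<lambda>y. f 1 y - f 2 y)"
    unfolding g_def by (rule ext) (simp add: killed_diff fS numeral_2_eq_2)
  have hh: "ip B h h = A 0 + 2 * A 1 + A 2"
    unfolding h_def by (simp add: ip_add_left ip_add_right ipf numeral_2_eq_2)
  have hkh: "ip B h (killed B h) = A 1 + 2 * A 2 + A 3"
    unfolding kh unfolding h_def by (simp add: ip_add_left ip_add_right ipf numeral_2_eq_2 numeral_3_eq_3)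
  have gg: "ip B g g = A 0 - 2 * A 1 + A 2"
    unfolding g_def by (simp add: ip_diff_left ip_diff_right ipf numeral_2_eq_2)
  have gkg: "ip B g (killed B g) = A 1 - 2 * A 2 + A 3"
    unfolding kg unfolding g_def by (simp add: ip_diff_left ip_diff_right ipf numeral_2_eq_2 numeral_3_eq_3)
  have h0: "h y = 0" if "y \<notin> B" for y using that by (simp add: h_def f_def hk_outside)
  have form_h: "form B h h = A 0 + A 1 - A 2 - A 3"
    using form_eq_ip[OF B h0 h0] hh hkh by simp
  \<comment> \<open>The difference of the two sides is the pairing of g with g + P g.\<close>
  also have "\<dots> \<le> 2 * (A 0 - A 2)"
    using ip_plus_ip_killed_nonneg[OF B, of g] gg gkg by simp
  finally have fh: "form B h h \<le> 2 * (A 0 - A 2)" .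
  have Ann: "0 \<le> A i" for i by (simp add: A_def hk_nonneg)
  have "(\<Sum>y\<in>B. h y * \<mu> y) = survival B k x + survival B (Suc k) x"
    by (simp add: h_def f_def survival_eq_sum[OF B] distrib_right sum.distrib)
  then have "(\<Sum>y\<in>B. h y * \<mu> y) \<le> 2"
    using survival_le_1[OF B, of k x] survival_le_1[OF B, of "Suc k" x] by simp
  \<comment> \<open>The L1 norm of h is a sum of two survival probabilities, hence N = 2.\<close>
  then have N: "ip B h h powr (1 + \<delta>) \<le> 2 * Kf * (4 * 2\<^sup>2) powr \<delta> * form B h h"
    by (intro Nash_inequality[OF B Kf \<delta> FK h0]) (auto simp: h_def f_def hk_nonneg)
  have "A 0 powr (1 + \<delta>) \<le> ip B h h powr (1 + \<delta>)"
    using hh Ann[of 0] Ann[of 1] Ann[of 2] \<delta> by (intro powr_mono2) auto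
  also have "\<dots> \<le> 2 * Kf * 16 powr \<delta> * form B h h"
    using N by simp
  also have "\<dots> \<le> 2 * Kf * 16 powr \<delta> * (2 * (A 0 - A 2))"
    using fh Kf by (intro mult_left_mono) auto
  also have "\<dots> = 4 * Kf * 16 powr \<delta> * (A 0 - A 2)" by (simp add: algebra_simps)
  finally have "A 0 powr (1 + \<delta>) \<le> 4 * Kf * 16 powr \<delta> * (A 0 - A 2)" .
  then show "hk B (2 * k) x x powr (1 + \<delta>) \<le> 4 * Kf * 16 powr \<delta> * (hk B (2 * k) x x - hk B (2 * Suc k) x x)"
    by (simp add: A_def)
qed

end

section \<open>Heat kernel estimates\<close>

context doubling_graph begin

text \<open>Cauchy-Schwarz at the even time 2l, which is k or k - 1, with diagonal bounds
  transported to \<open>x\<close> by \<open>Wt_compare\<close>. For odd k one averaging step reaches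
  a neighbour, whence D + 1; n <= 2 k + 3 guarantees n <= 8 max(2l, 1).\<close>

lemma hk_offdiagonal:
  assumes S: "finite S" and M: "0 \<le> M"
    and diag: "\<And>l u. 2 * l \<le> k \<Longrightarrow> heat_kernel w (2 * l) u u \<le> M / Wt u (2 * l)"
    and d: "real (graph_dist w x y) \<le> D" "real (graph_dist w x z) \<le> D"
    and n: "1 \<le> n" "n \<le> 2 * k + 3"
  shows "hk S k y z \<le> M * (Wt_const * (1 + (D + 1) / er x n) powr Wt_exp) / Wt x n"
proof -
  define G where "G = Wt_const * (1 + (D + 1) / er x n) powr Wt_exp"
  define l where "l = k div 2"
  have l: "2 * l \<le> k" "n \<le> 8 * max (2 * l) 1" using n by (auto simp: l_def)
  have G: "0 \<le> G" using Wt_const_ge_1 by (simp add: G_def)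
  have diag': "hk S (2 * l) u u \<le> M * G / Wt x n" if "real (graph_dist w x u) \<le> D + 1" for u
  proof -
    have W: "Wt x n \<le> G * Wt u (2 * l)"
      unfolding G_def by (rule Wt_compare[OF that n(1) l(2)])
    have "hk S (2 * l) u u \<le> heat_kernel w (2 * l) u u" by (rule hk_le_heat_kernel[OF S])
    also have "\<dots> \<le> M / Wt u (2 * l)" by (rule diag[OF l(1)])
    also have "\<dots> = M * Wt x n / (Wt x n * Wt u (2 * l))" using Wt_pos[of x n] by simp
    also have "\<dots> \<le> M * (G * Wt u (2 * l)) / (Wt x n * Wt u (2 * l))"
      using W M Wt_pos[of x n] Wt_pos[of u "2 * l"] by (intro divide_right_mono mult_left_mono) auto
    also have "\<dots> = M * G / Wt x n" using Wt_pos[of u "2 * l"] by simp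
    finally show ?thesis .
  qed
  have c: "0 \<le> M * G / Wt x n" using M G Wt_pos[of x n] by simp
  have even: "hk S (2 * l) y u \<le> M * G / Wt x n" if u: "real (graph_dist w x u) \<le> D + 1" for u
  proof -
    have "hk S (2 * l) y y * hk S (2 * l) u u \<le> (M * G / Wt x n) * (M * G / Wt x n)"
      using d u c by (intro mult_mono diag' hk_nonneg) auto
    then have "sqrt (hk S (2 * l) y y * hk S (2 * l) u u) \<le> sqrt ((M * G / Wt x n) * (M * G / Wt x n))"
      by (rule real_sqrt_le_mono)
    also have "\<dots> = M * G / Wt x n" using c by (simp only: real_sqrt_mult_self abs_of_nonneg real_sqrt_mult)
    finally show ?thesis using hk_le_sqrt[OF S, of l y u] by simp
  qed
  show ?thesis
  proof (cases "even k")
    case True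
    then have "k = 2 * l" by (simp add: l_def)
    then show ?thesis using even[of z] d by (simp add: G_def)
  next
    case False
    then have k: "k = Suc (2 * l)" by (simp add: l_def)
    have "killed S (hk S (2 * l) y) z \<le> M * G / Wt x n"
    proof (rule killed_le_bound[OF S _ c])
      fix u assume "adjacent w z u"
      then have "real (graph_dist w x u) \<le> D + 1"
        using dist_triangle[of x u z] dist_adjacent[of z u] d by linarith
      then show "hk S (2 * l) y u \<le> M * G / Wt x n" by (rule even)
    qed
    then show ?thesis by (simp add: k hk_Suc G_def)
  qed
qed

lemma exit_radius_1: "er x 1 = 1"
proof -
  have "er x 1 \<le> 1"
    unfolding exit_radius_def by (rule Least_le) (simp add: E_ge_1)
  then show ?thesis using exit_radius_ge_1[of 1 x] by simp
qed

lemma heat_kernel_0_le: "heat_kernel w 0 u u \<le> 1 / Wt u 0"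
proof -
  have "heat_kernel w 0 u u = hk {u} 0 u u"
    by (rule heat_kernel_eq_hk) auto
  then show ?thesis using exit_radius_1[of u] by (simp add: hk_0 Wt_def volume_1)
qed

text \<open>\<open>M\<close> is fixed before the induction: the killed part contributes C1 <= M / 2,
  and L makes the contribution of the escaping paths at most M / 2 as well. L does not depend on
  \<open>M\<close>, while C1 depends on L.\<close>

lemma eigenvalue_ineq_imp_even_diagonal:
  assumes "eigenvalue_ineq w"
  shows "\<exists>M\<ge>1. \<forall>m x. heat_kernel w (2 * m) x x \<le> M / Wt x (2 * m)"
proof -
  obtain C \<delta> where C: "0 < C" "0 < \<delta>" and *:
    "\<forall>x. \<forall>R>0. \<forall>A. A \<noteq> {} \<longrightarrow> A \<subseteq> ball x (2 * R) \<longrightarrow>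
      inv_eigenvalue w A / inv_eigenvalue w (ball x (2 * R)) \<le> C * (mass w A / mass w (ball x (2 * R))) powr \<delta>"
    using assms unfolding eigenvalue_ineq_def by (elim exE conjE) (rule that)
  \<comment> \<open>(2) as a Faber-Krahn inequality at scale R, with E(x, R) in place of the inverse
    eigenvalue of the ball.\<close>
  have FK: "inv_eigenvalue w A \<le> C * CT * E x R / V x R powr \<delta> * mass w A powr \<delta>"
    if R: "0 < R" and A: "A \<noteq> {}" "A \<subseteq> ball x R" for x R A
  proof -
    have fin: "finite A" using A(2) finite_ball by (rule finite_subset)
    have V: "0 < V x R" using R by (rule volume_pos)
    have l: "0 < inv_eigenvalue w (ball x R)" using R by (intro inv_eigenvalue_pos ball_nonempty) auto
    have "inv_eigenvalue w A / inv_eigenvalue w (ball x R) \<le> C * (mass w A / V x R) powr \<delta>"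
      using *[rule_format, of "R / 2" A x] R A by (simp add: volume_def)
    then have "inv_eigenvalue w A \<le> C * (mass w A / V x R) powr \<delta> * inv_eigenvalue w (ball x R)"
      using l by (simp add: field_simps)
    also have "\<dots> \<le> C * (mass w A / V x R) powr \<delta> * (CT * E x R)"
    proof (rule mult_left_mono)
      have "inv_eigenvalue w (ball x R) \<le> max_mean_exit w (ball x R)"
        using R by (intro inv_eigenvalue_le_max_mean_exit ball_nonempty) auto
      also have "\<dots> \<le> CT * E x R" using R by (rule max_mean_exit_ball_le)
      finally show "inv_eigenvalue w (ball x R) \<le> CT * E x R" .
    qed (use C in auto)
    finally show ?thesis
      using V mass_pos[OF fin A(1)] by (simp add: powr_divide mult_ac)
  qed
  define p where "p = Wt_exp * beta / gam"
  have p: "0 \<le> p" using Wt_exp_nonneg beta_ge_1 gam_pos by (simp add: p_def)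
  \<comment> \<open>The spare power of 1 + T beyond \<open>p\<close> provides the factor 1 / (1 + T)
    in \<open>small\<close>.\<close>
  have "0 \<le> p + 1" using p by simp
  from poly_le_exp[OF this tail_rate_pos] obtain Cp
    where Cp: "0 < Cp" "\<forall>T\<ge>0. (1 + T) powr (p + 1) \<le> Cp * exp (tail_rate * T)"
    by (elim exE conjE) (rule that)
  define K0 where "K0 = 2 * tail_const * Wt_const * 4 powr Wt_exp * Cp"
  have K0: "0 < K0" using Cp Wt_const_ge_1 by (simp add: K0_def tail_const_def)
  \<comment> \<open>Makes K0 / (1 + T) <= 1/2; L is then the radius factor with L^(gam / beta) = T,
    the quantity in which the exit tail decays.\<close>
  define T where "T = 2 * K0 + 1"
  have T: "1 \<le> T" using K0 by (simp add: T_def)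
  define L where "L = T powr (beta / gam)"
  have L: "1 \<le> L" unfolding L_def using T beta_ge_1 gam_pos by (intro ge_one_powr_ge_zero) auto
  have LT: "L powr (gam / beta) = T" using T beta_ge_1 gam_pos by (simp add: L_def powr_powr)
  have small: "2 * (tail_const * exp (- (tail_rate * T))) * (Wt_const * (4 * L) powr Wt_exp) \<le> 1 / 2"
  proof -
    have "(4 * L) powr Wt_exp = 4 powr Wt_exp * T powr p"
      using T by (simp add: L_def p_def powr_mult powr_powr mult_ac)
    also have "\<dots> \<le> 4 powr Wt_exp * (1 + T) powr p"
      using T p by (intro mult_left_mono powr_mono2) auto
    also have "(1 + T) powr p = (1 + T) powr (p + 1) / (1 + T)"
      using T by (simp add: powr_add)
    also have "\<dots> \<le> Cp * exp (tail_rate * T) / (1 + T)"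
      using Cp(2)[rule_format, of T] T by (intro divide_right_mono) auto
    finally have "(4 * L) powr Wt_exp \<le> 4 powr Wt_exp * (Cp * exp (tail_rate * T) / (1 + T))" by simp
    then have "2 * (tail_const * exp (- (tail_rate * T))) * (Wt_const * (4 * L) powr Wt_exp)
        \<le> 2 * (tail_const * exp (- (tail_rate * T))) * (Wt_const * (4 powr Wt_exp * (Cp * exp (tail_rate * T) / (1 + T))))"
      using Wt_const_ge_1 by (intro mult_left_mono) (auto simp: tail_const_def)
    also have "\<dots> = K0 * (exp (- (tail_rate * T)) * exp (tail_rate * T)) / (1 + T)"
      by (simp add: K0_def mult_ac)
    also have "exp (- (tail_rate * T)) * exp (tail_rate * T) = 1"
      by (simp flip: exp_add)
    also have "K0 * 1 / (1 + T) = K0 / (1 + T)" by simp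
    also have "\<dots> \<le> 1 / 2" using K0 T by (simp add: T_def field_simps)
    finally show ?thesis .
  qed
  define C1 where "C1 = (4 * (C * CT * (2 * CT * L powr beta * CE)) * 16 powr \<delta> / \<delta>) powr (1 / \<delta>)"
  have C1: "0 \<le> C1" by (simp add: C1_def)
  define M where "M = max 1 (2 * C1)"
  have M: "1 \<le> M" "2 * C1 \<le> M" by (auto simp: M_def)
  have "heat_kernel w (2 * m) x x \<le> M / Wt x (2 * m)" for m x
  proof (induction m arbitrary: x rule: less_induct)
    case (less m)
    show ?case
    proof (cases "m = 0")
      case True
      have "1 / Wt x 0 \<le> M / Wt x 0" using M Wt_pos[of x 0] by (intro divide_right_mono) auto
      then show ?thesis using True heat_kernel_0_le[of x] by simp
    next
      case False
      define n where "n = 2 * m"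
      define e where "e = real (er x n)"
      define R where "R = L * e"
      have n: "1 \<le> n" "1 \<le> m" using False by (auto simp: n_def)
      have e: "1 \<le> e" unfolding e_def using exit_radius_ge_1[OF n(1), of x] by simp
      have "1 * e \<le> L * e" using L e by (intro mult_right_mono) auto
      then have R: "e \<le> R" "0 < R" using e by (auto simp: R_def)
      have Re: "R / e = L" using e by (simp add: R_def)
      let ?A = "ball x R"
      define S where "S = {z. graph_dist w x z \<le> n} \<union> ?A"
      have S: "finite S" "{z. graph_dist w x z \<le> n} \<subseteq> S" "?A \<subseteq> S"
        by (auto simp: S_def finite_closed_ball)
      have W: "Wt x n = V x e" using n by (simp add: Wt_def e_def max_absorb1)
      have VR: "V x e \<le> V x R" using R by (intro volume_mono)
      have EL: "E x R \<le> 2 * CT * L powr beta * CE * m"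
      proof -
        have "E x R \<le> CT * L powr beta * E x e" using E_growth[of e R x] e R Re by simp
        also have "\<dots> \<le> CT * L powr beta * (CE * n)"
          unfolding e_def using E_exit_radius_le[OF n(1)] CT_ge by (intro mult_left_mono) auto
        finally show ?thesis by (simp add: n_def mult_ac)
      qed
      have EPos: "0 < E x R" using R by (intro E_pos)
      have killed: "hk ?A (2 * m) x x \<le> C1 / Wt x n"
      proof -
        define Kf where "Kf = C * CT * E x R / V x R powr \<delta>"
        have V: "0 < V x R" using R by (intro volume_pos)
        have Kf: "0 < Kf" using C CT_ge EPos V by (simp add: Kf_def)
        have "hk ?A (2 * m) x x \<le> (4 * Kf * 16 powr \<delta> / (\<delta> * m)) powr (1 / \<delta>)"
          by (rule killed_diagonal_upper[OF finite_ball Kf C(2) _ n(2)]) (unfold Kf_def, rule FK[OF R(2)])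
        also have "\<dots> \<le> (4 * (C * CT * (2 * CT * L powr beta * CE)) * 16 powr \<delta> / \<delta> / V x R powr \<delta>) powr (1 / \<delta>)"
        proof (intro powr_mono2)
          have "4 * Kf * 16 powr \<delta> / (\<delta> * m) = 4 * C * CT * 16 powr \<delta> / \<delta> / V x R powr \<delta> * (E x R / m)"
            by (simp add: Kf_def mult_ac)
          also have "\<dots> \<le> 4 * C * CT * 16 powr \<delta> / \<delta> / V x R powr \<delta> * (2 * CT * L powr beta * CE)"
            using EL n C CT_ge by (intro mult_left_mono) (auto simp: field_simps)
          also have "\<dots> = 4 * (C * CT * (2 * CT * L powr beta * CE)) * 16 powr \<delta> / \<delta> / V x R powr \<delta>"
            by simp
          finally show "4 * Kf * 16 powr \<delta> / (\<delta> * m) \<le> 4 * (C * CT * (2 * CT * L powr beta * CE)) * 16 powr \<delta> / \<delta> / V x R powr \<delta>" .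
        qed (use C Kf in auto)
        also have "\<dots> = C1 / V x R"
        proof -
          have root: "(Q / V x R powr \<delta>) powr (1 / \<delta>) = Q powr (1 / \<delta>) / V x R" if "0 \<le> Q" for Q
            using that V C by (simp add: powr_divide powr_powr)
          show ?thesis unfolding C1_def by (rule root) (use C CT_ge CE_ge in auto)
        qed
        also have "\<dots> \<le> C1 / Wt x n"
          unfolding W using C1 VR volume_pos[of e x] e by (intro divide_left_mono) (auto simp: volume_pos R)
        finally show ?thesis .
      qed
      have tail: "1 - survival ?A m x \<le> tail_const * exp (- (tail_rate * T))"
      proof -
        have "L powr gam * n \<le> L powr gam * E x e"
          unfolding e_def by (intro mult_left_mono E_exit_radius_ge) auto
        also have "\<dots> \<le> 2 * E x R" using E_growth_lower[of e R x] e R Re by simp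
        finally have "L powr gam \<le> E x R / m" using n by (simp add: n_def field_simps)
        then have "(L powr gam) powr (1 / beta) \<le> (E x R / m) powr (1 / beta)"
          using beta_ge_1 by (intro powr_mono2) auto
        then have "T \<le> (E x R / m) powr (1 / beta)" using LT by (simp add: powr_powr)
        then have "exp (- (tail_rate * (E x R / m) powr (1 / beta))) \<le> exp (- (tail_rate * T))"
          using tail_rate_pos by simp
        then have "tail_const * exp (- (tail_rate * (E x R / m) powr (1 / beta))) \<le> tail_const * exp (- (tail_rate * T))"
          by (intro mult_left_mono) (auto simp: tail_const_def)
        with exit_probability_le[OF R(2) n(2), of x] show ?thesis by linarith
      qed
      define G where "G = Wt_const * (4 * L) powr Wt_exp"
      have G: "0 \<le> G" using Wt_const_ge_1 by (simp add: G_def)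
      have xA: "x \<in> ?A" using R by simp
      have dec: "ip S (\<lambda>z. hk S m x z - hk ?A m x z) (hk S m x) \<le> M * G / Wt x n * (1 - survival ?A m x)"
      proof (rule exit_decomposition[OF S(1,3) xA])
        show "0 \<le> M * G / Wt x n" using M G Wt_pos[of x n] by simp
        fix k z y assume z: "y \<in> ?A" "adjacent w y z" and k: "m \<le> k" "k < m + m"
        have d: "real (graph_dist w x z) \<le> R + 1"
          using dist_triangle[of x z y] dist_adjacent[OF z(2)] z(1) by (simp add: mem_ball)
        have "hk S k x z \<le> M * (Wt_const * (1 + (R + 1 + 1) / er x n) powr Wt_exp) / Wt x n"
        \<comment> \<open>Times after the exit are below 2m, so 2l <= k forces l < m and the
          induction hypothesis applies.\<close>
        proof (rule hk_offdiagonal[OF S(1)])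
          fix l u assume "2 * l \<le> k"
          then show "heat_kernel w (2 * l) u u \<le> M / Wt u (2 * l)" using k by (intro less) auto
        qed (use M R d k n in \<open>auto simp: n_def\<close>)
        also have "\<dots> \<le> M * G / Wt x n"
        proof (intro divide_right_mono mult_left_mono)
          have "1 + (R + 1 + 1) / er x n \<le> 4 * L"
          proof -
            have "(R + 1 + 1) / e = R / e + 2 / e" by (simp add: add_divide_distrib)
            moreover have "2 / e \<le> 2 / 1" using e by (intro frac_le) auto
            ultimately have "1 + (R + 1 + 1) / e \<le> 4 * L" using L Re by linarith
            then show ?thesis by (simp only: e_def)
          qed
          then show "Wt_const * (1 + (R + 1 + 1) / er x n) powr Wt_exp \<le> G"
            unfolding G_def using Wt_const_ge_1 Wt_exp_nonneg R by (intro mult_left_mono powr_mono2) auto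
        qed (use M Wt_pos[of x n] in auto)
        finally show "hk S k x z \<le> M * G / Wt x n" .
      qed
      define q where "q = hk ?A m x"
      define pS where "pS = hk S m x"
      have qp: "q z \<le> pS z" "0 \<le> q z" "0 \<le> pS z" for z
        unfolding q_def pS_def using hk_mono_set[OF S(1,3)] hk_nonneg by auto
      have "heat_kernel w (2 * m) x x = ip S pS pS"
        unfolding pS_def using heat_kernel_eq_hk[of S x n x] S by (simp add: ip_hk mult_2 n_def)
      \<comment> \<open>|p|^2 = |q|^2 + 2 <p - q, p> - |p - q|^2, with the last term
        dropped.\<close>
      also have "ip S pS pS \<le> ip S q q + 2 * ip S (\<lambda>z. pS z - q z) pS"
      proof -
        have "ip S q q = ip S pS pS - 2 * ip S (\<lambda>z. pS z - q z) pS + ip S (\<lambda>z. pS z - q z) (\<lambda>z. pS z - q z)"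
          by (simp add: ip_diff_left ip_diff_right ip_sym[of S pS q])
        then show ?thesis using ip_self_nonneg[of S "\<lambda>z. pS z - q z"] by simp
      qed
      also have "ip S q q = hk ?A (2 * m) x x"
      proof -
        have "ip S q q = ip ?A q q"
          using S by (intro ip_restrict) (auto simp: q_def hk_outside)
        then show ?thesis by (simp add: q_def ip_hk mult_2)
      qed
      also have "hk ?A (2 * m) x x + 2 * ip S (\<lambda>z. pS z - q z) pS
          \<le> C1 / Wt x n + 2 * (M * G / Wt x n * (tail_const * exp (- (tail_rate * T))))"
      proof -
        have "ip S (\<lambda>z. pS z - q z) pS \<le> M * G / Wt x n * (1 - survival ?A m x)"
          using dec by (simp add: pS_def q_def)
        also have "\<dots> \<le> M * G / Wt x n * (tail_const * exp (- (tail_rate * T)))"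
          using tail M G Wt_pos[of x n] by (intro mult_left_mono) auto
        finally show ?thesis using killed by simp
      qed
      also have "\<dots> = (C1 + M * (2 * (tail_const * exp (- (tail_rate * T))) * G)) / Wt x n"
        by (simp add: add_divide_distrib)
      also have "\<dots> \<le> (M / 2 + M * (1 / 2)) / Wt x n"
        using M small Wt_pos[of x n] unfolding G_def
        by (intro divide_right_mono add_mono mult_left_mono) auto
      finally show ?thesis by (simp add: n_def)
    qed
  qed
  with M show ?thesis by blast
qed

text \<open>Odd times come from \<open>hk_offdiagonal\<close> with D = 0; as the exit radius is at
  least 1, the polynomial factor is at most 2^Wt_exp.\<close>

lemma eigenvalue_ineq_imp_diagonal_upper_estimate:
  assumes "eigenvalue_ineq w"
  shows "diagonal_upper_estimate w"
proof -
  obtain M where M: "1 \<le> M" and diag: "\<And>m x. heat_kernel w (2 * m) x x \<le> M / Wt x (2 * m)"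
    using eigenvalue_ineq_imp_even_diagonal[OF assms] by blast
  define C where "C = M * (Wt_const * 2 powr Wt_exp)"
  have C: "0 < C" using M Wt_const_ge_1 by (simp add: C_def)
  show ?thesis
    unfolding diagonal_upper_estimate_def
  proof (rule exI[of _ C], intro conjI allI impI C)
    fix x and n :: nat assume n: "1 \<le> n"
    have fin: "finite {z. graph_dist w x z \<le> n}" by (rule finite_closed_ball)
    have "heat_kernel w n x x = hk {z. graph_dist w x z \<le> n} n x x"
      by (rule heat_kernel_eq_hk[OF fin]) simp
    also have "\<dots> \<le> M * (Wt_const * (1 + (0 + 1) / er x n) powr Wt_exp) / Wt x n"
      by (rule hk_offdiagonal[OF fin]) (use M diag n in auto)
    also have "\<dots> \<le> C / Wt x n"
      unfolding C_def using M Wt_const_ge_1 Wt_exp_nonneg Wt_pos[of x n] exit_radius_ge_1[OF n, of x]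
      by (intro divide_right_mono mult_left_mono powr_mono2) auto
    finally show "heat_kernel w n x x \<le> C / V x (er x n)"
      using n by (simp add: Wt_def max_absorb1)
  qed
qed

lemma upper_estimate_imp_diagonal_upper_estimate:
  assumes "upper_estimate w"
  shows "diagonal_upper_estimate w"
proof -
  obtain c C \<beta> where C: "0 < C" and
    *: "\<forall>x y. \<forall>n\<ge>1. heat_kernel w n x y \<le> C / volume w x (real (exit_radius w x n))
          * exp (- c * (mean_exit_ball w x (real (graph_dist w x y)) / real n) powr (1 / (\<beta> - 1)))"
    using assms unfolding upper_estimate_def by (elim exE conjE) (rule that)
  show ?thesis
    unfolding diagonal_upper_estimate_def
  proof (rule exI[of _ C], intro conjI allI impI C)
    fix x and n :: nat assume "1 \<le> n"
    \<comment> \<open>At y = x the exponent vanishes: E(x, 0) = 0 and \<open>0 powr _\<close> is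
      0.\<close>
    from *[rule_format, OF this, of x x] show "heat_kernel w n x x \<le> C / V x (er x n)"
      by (simp add: E_nonpos)
  qed
qed

text \<open>Transporting diagonal bounds over the distance d costs a power of d /
  \<open>er x n\<close>, which growth from below bounds by a power of 1 + T with T = (E(x, d) /
  n)^(1 / beta). Half of the exit tail pays for it, so the rate drops from c to c / 2.\<close>

lemma diagonal_upper_estimate_imp_upper_estimate:
  assumes "diagonal_upper_estimate w"
  shows "upper_estimate w"
proof -
  obtain C0 where C0: "0 < C0" and *: "\<forall>x. \<forall>n\<ge>1. heat_kernel w n x x \<le> C0 / volume w x (real (exit_radius w x n))"
    using assms unfolding diagonal_upper_estimate_def by (elim exE conjE) (rule that)
  define M where "M = max 1 C0"
  have M: "1 \<le> M" "C0 \<le> M" by (auto simp: M_def)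
  have diag: "heat_kernel w n u u \<le> M / Wt u n" for n u
  proof (cases "n = 0")
    case True
    have "1 / Wt u 0 \<le> M / Wt u 0" using M Wt_pos[of u 0] by (intro divide_right_mono) auto
    then show ?thesis using True heat_kernel_0_le[of u] by simp
  next
    case False
    then have "heat_kernel w n u u \<le> C0 / Wt u n"
      using *[rule_format, of n u] by (simp add: Wt_def max_absorb1)
    also have "\<dots> \<le> M / Wt u n" using M Wt_pos[of u n] by (intro divide_right_mono) auto
    finally show ?thesis .
  qed
  \<comment> \<open>Three applications of (TC) compare E(x, d) with E(y, d / 2).\<close>
  define c where "c = tail_rate * (1 / CT ^ 3) powr (1 / beta)"
  have c: "0 < c" using tail_rate_pos CT_ge by (simp add: c_def)
  define p where "p = Wt_exp * beta / gam"
  have p: "0 \<le> p" using Wt_exp_nonneg beta_ge_1 gam_pos by (simp add: p_def)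
  have "0 < c / 2" using c by simp
  from poly_le_exp[OF p this] obtain Cp
    where Cp: "0 < Cp" "\<forall>T\<ge>0. (1 + T) powr p \<le> Cp * exp (c / 2 * T)"
    by (elim exE conjE) (rule that)
  \<comment> \<open>With \<open>e\<close> the exit radius, 1 + (3 d + 1) / e is at most 5 if d <= e
    and at most 5 d / e otherwise; 2^(1 / gam) comes from the factor 2 of the lower growth.\<close>
  define b where "b = 5 * 2 powr (1 / gam)"
  have b: "5 \<le> b"
  proof -
    have "2 powr 0 \<le> 2 powr (1 / gam)" using gam_pos by (intro powr_mono) auto
    then show ?thesis by (simp add: b_def)
  qed
  define G where "G = M * (Wt_const * (b powr Wt_exp * Cp))"
  have G: "0 < G" using M Wt_const_ge_1 b Cp by (simp add: G_def)
  define C where "C = max C0 (2 * G * tail_const)"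
  have C: "0 < C" "C0 \<le> C" "2 * G * tail_const \<le> C" using C0 by (auto simp: C_def)
  have off: "heat_kernel w n x y \<le> C / Wt x n * exp (- (c / 2 * (E x (graph_dist w x y) / n) powr (1 / beta)))"
    if n: "1 \<le> n" for x y n
  \<comment> \<open>For x = y the balls of radius d / 2 would be empty, but the diagonal bound is
    already the claim.\<close>
  proof (cases "x = y")
    case True
    have "heat_kernel w n x x \<le> C0 / Wt x n"
      using *[rule_format, OF n, of x] n by (simp add: Wt_def max_absorb1)
    also have "\<dots> \<le> C / Wt x n" using C Wt_pos[of x n] by (intro divide_right_mono) auto
    finally show ?thesis using True by (simp add: E_nonpos)
  next
    case False
    define d where "d = real (graph_dist w x y)"
    have d: "1 \<le> d"
    proof -
      have "graph_dist w x y \<noteq> 0" using False by simp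
      then have "1 \<le> graph_dist w x y" by linarith
      then show ?thesis unfolding d_def by linarith
    qed
    define e where "e = real (er x n)"
    have e: "1 \<le> e" unfolding e_def using exit_radius_ge_1[OF n, of x] by simp
    define T where "T = (E x d / n) powr (1 / beta)"
    have T: "0 \<le> T" by (simp add: T_def)
    have poly: "1 + (3 * d + 1) / e \<le> b * (1 + T) powr (beta / gam)"
    proof -
      have g: "1 \<le> (1 + T) powr (beta / gam)"
        using T beta_ge_1 gam_pos by (intro ge_one_powr_ge_zero) auto
      show ?thesis
      proof (cases "d \<le> e")
        case True
        have "(3 * d + 1) / e \<le> 4" using True e by (simp add: field_simps)
        then have "1 + (3 * d + 1) / e \<le> b * 1" using b by simp
        also have "\<dots> \<le> b * (1 + T) powr (beta / gam)" using g b by (intro mult_left_mono) auto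
        finally show ?thesis .
      next
        case False
        have "(d / e) powr gam * n \<le> (d / e) powr gam * E x e"
          unfolding e_def by (intro mult_left_mono E_exit_radius_ge) auto
        also have "\<dots> \<le> 2 * E x d" using False e by (intro E_growth_lower) auto
        finally have "(d / e) powr gam \<le> 2 * (E x d / n)" using n by (simp add: field_simps)
        then have "((d / e) powr gam) powr (1 / gam) \<le> (2 * (E x d / n)) powr (1 / gam)"
          using gam_pos by (intro powr_mono2) auto
        moreover have "((d / e) powr gam) powr (1 / gam) = d / e"
          using gam_pos d e by (simp add: powr_powr)
        moreover have "(2 * (E x d / n)) powr (1 / gam) = 2 powr (1 / gam) * T powr (beta / gam)"
        proof -
          have root: "(2 * Q) powr (1 / gam) = 2 powr (1 / gam) * (Q powr (1 / beta)) powr (beta / gam)" if "0 \<le> Q" for Q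
            using that beta_ge_1 by (simp add: powr_mult powr_powr)
          show ?thesis unfolding T_def by (rule root) (simp add: E_nonneg)
        qed
        ultimately have de: "d / e \<le> 2 powr (1 / gam) * T powr (beta / gam)"
          by linarith
        have "1 + (3 * d + 1) / e = (e + 3 * d + 1) / e" using e by (simp add: add_divide_distrib)
        also have "\<dots> \<le> 5 * d / e" using False d e by (intro divide_right_mono) auto
        finally have "1 + (3 * d + 1) / e \<le> 5 * (d / e)" by simp
        also have "\<dots> \<le> 5 * (2 powr (1 / gam) * T powr (beta / gam))" using de by simp
        also have "\<dots> = b * T powr (beta / gam)" by (simp add: b_def)
        also have "\<dots> \<le> b * (1 + T) powr (beta / gam)"
          using T b beta_ge_1 gam_pos by (intro mult_left_mono powr_mono2) auto
        finally show ?thesis .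
      qed
    qed
    have growth: "M * (Wt_const * (1 + (3 * d + 1) / e) powr Wt_exp) \<le> G * exp (c / 2 * T)"
    proof -
      have "(1 + (3 * d + 1) / e) powr Wt_exp \<le> (b * (1 + T) powr (beta / gam)) powr Wt_exp"
        using poly d e Wt_exp_nonneg by (intro powr_mono2) auto
      also have "\<dots> = b powr Wt_exp * (1 + T) powr p"
        using b T by (simp add: powr_mult powr_powr p_def mult_ac)
      also have "\<dots> \<le> b powr Wt_exp * (Cp * exp (c / 2 * T))"
        using Cp(2)[rule_format, OF T] by (intro mult_left_mono) auto
      finally have "M * (Wt_const * (1 + (3 * d + 1) / e) powr Wt_exp)
          \<le> M * (Wt_const * (b powr Wt_exp * (Cp * exp (c / 2 * T))))"
        using M Wt_const_ge_1 by (intro mult_left_mono) auto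
      then show ?thesis by (simp add: G_def mult_ac)
    qed
    \<comment> \<open>Both parts are at least n div 2, and n <= 2 (n div 2) + 3, as
      \<open>hk_offdiagonal\<close> demands.\<close>
    define m m' where "m = n - n div 2" and "m' = n div 2"
    have m: "m + m' = n" "m \<le> n" "m' \<le> n" by (auto simp: m_def m'_def)
    let ?A = "ball x (d / 2)" and ?A' = "ball y (d / 2)"
    define S where "S = {z. graph_dist w x z \<le> n} \<union> ?A \<union> ?A'"
    have S: "finite S" "{z. graph_dist w x z \<le> n} \<subseteq> S" "?A \<subseteq> S" "?A' \<subseteq> S"
      by (auto simp: S_def finite_closed_ball)
    define B where "B = G * exp (c / 2 * T) / Wt x n"
    have B: "0 \<le> B" using G Wt_pos[of x n] by (simp add: B_def)
    have bound: "hk S k u z \<le> B" if "real (graph_dist w x u) \<le> 3 * d" "real (graph_dist w x z) \<le> 3 * d" "n div 2 \<le> k" for k u z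
    proof -
      have "hk S k u z \<le> M * (Wt_const * (1 + (3 * d + 1) / er x n) powr Wt_exp) / Wt x n"
        by (rule hk_offdiagonal[OF S(1)]) (use M diag n that in auto)
      also have "\<dots> \<le> B"
        unfolding B_def using growth Wt_pos[of x n] by (intro divide_right_mono) (auto simp: e_def)
      finally show ?thesis .
    qed
    have tail: "1 - survival (ball v (d / 2)) k v \<le> tail_const * exp (- (c * T))"
      if v: "E x d \<le> CT ^ 3 * E v (d / 2)" and k: "k \<le> n" for v k
    proof -
      have "1 - survival (ball v (d / 2)) k v \<le> 1 - survival (ball v (d / 2)) n v"
        using survival_antimono[OF finite_ball k] by simp
      also have "\<dots> \<le> tail_const * exp (- (tail_rate * (E v (d / 2) / n) powr (1 / beta)))"
        using d n by (intro exit_probability_le) auto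
      also have "\<dots> \<le> tail_const * exp (- (c * T))"
      proof -
        have "c * T = tail_rate * (1 / CT ^ 3 * (E x d / n)) powr (1 / beta)"
          using CT_ge E_nonneg[of x d] unfolding c_def T_def by (subst powr_mult) auto
        also have "\<dots> \<le> tail_rate * (E v (d / 2) / n) powr (1 / beta)"
        proof (intro mult_left_mono powr_mono2)
          show "1 / CT ^ 3 * (E x d / n) \<le> E v (d / 2) / n"
            using v n CT_ge by (simp add: field_simps)
        qed (use tail_rate_pos beta_ge_1 CT_ge E_nonneg[of x d] in auto)
        finally show ?thesis by (simp add: tail_const_def)
      qed
      finally show ?thesis .
    qed
    have Ex: "E x d \<le> CT ^ 3 * E x (d / 2)"
    proof -
      have "E x d \<le> CT * E x (d / 2)" using E_doubling[of "d / 2" x] d by simp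
      also have "\<dots> \<le> CT ^ 3 * E x (d / 2)"
        using CT_ge power_increasing[of 1 3 CT] by (intro mult_right_mono E_nonneg) auto
      finally show ?thesis .
    qed
    have Ey: "E x d \<le> CT ^ 3 * E y (d / 2)"
    proof -
      have "E x d \<le> E x (2 * (2 * d))" using d by (intro E_mono) auto
      also have "\<dots> \<le> CT * E y (2 * d)" using d by (intro E_near) (simp add: d_def dist_sym)
      also have "\<dots> \<le> CT * (CT * E y d)" using d CT_ge by (intro mult_left_mono E_doubling) auto
      also have "\<dots> \<le> CT * (CT * (CT * E y (d / 2)))"
        using d CT_ge E_doubling[of "d / 2" y] by (intro mult_left_mono) auto
      finally show ?thesis by (simp add: power3_eq_cube mult_ac)
    qed
    define f f' g g' where "f = hk S m x" and "f' = hk ?A m x" and "g = hk S m' y" and "g' = hk ?A' m' y"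
    have nn: "0 \<le> f z" "0 \<le> f' z" "0 \<le> g z" "0 \<le> g' z" "f' z \<le> f z" "g' z \<le> g z" for z
      unfolding f_def f'_def g_def g'_def using hk_nonneg hk_mono_set[OF S(1,3)] hk_mono_set[OF S(1,4)] by auto
    have disj: "f' z * g' z = 0" for z
    proof (cases "z \<in> ?A \<and> z \<in> ?A'")
      case True
      then have "real (graph_dist w x y) < d"
        using dist_triangle[of x y z] by (simp add: mem_ball dist_sym[of y z])
      then show ?thesis by (simp add: d_def)
    next
      case False
      then show ?thesis by (auto simp: f'_def g'_def hk_outside)
    qed
    \<comment> \<open>f g = (f - f') g + f' (g - g') + f' g'. The last product vanishes because the
      two balls are disjoint, and each of the others contains an exit.\<close>
    have "ip S f g = ip S (\<lambda>z. f z - f' z) g + ip S (\<lambda>z. g z - g' z) f' + ip S f' g'"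
      by (simp add: ip_diff_left ip_sym[of S g f'] ip_sym[of S g' f'])
    also have "ip S f' g' = 0" by (simp only: ip_def disj mult_zero_left sum.neutral_const)
    also have "ip S (\<lambda>z. g z - g' z) f' \<le> ip S (\<lambda>z. g z - g' z) f"
    proof -
      have "ip S f' (\<lambda>z. g z - g' z) \<le> ip S f (\<lambda>z. g z - g' z)"
        using nn by (intro ip_mono) auto
      then show ?thesis by (simp add: ip_sym)
    qed
    also have "ip S (\<lambda>z. f z - f' z) g \<le> B * (1 - survival ?A m x)"
      unfolding f_def f'_def g_def
    proof (rule exit_decomposition[OF S(1,3) _ B])
      fix k z v assume v: "v \<in> ?A" "adjacent w v z" and k: "m' \<le> k"
      have "real (graph_dist w x z) \<le> d / 2 + 1"
        using dist_triangle[of x z v] dist_adjacent[OF v(2)] v(1) by (simp add: mem_ball)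
      then show "hk S k y z \<le> B" using d k by (intro bound) (auto simp: d_def m'_def)
    qed (use d in simp)
    also have "ip S (\<lambda>z. g z - g' z) f \<le> B * (1 - survival ?A' m' y)"
      unfolding f_def g'_def g_def
    proof (rule exit_decomposition[OF S(1,4) _ B])
      fix k z v assume v: "v \<in> ?A'" "adjacent w v z" and k: "m \<le> k"
      have "real (graph_dist w y z) \<le> d / 2 + 1"
        using dist_triangle[of y z v] dist_adjacent[OF v(2)] v(1) by (simp add: mem_ball)
      then have "real (graph_dist w x z) \<le> 3 * d"
        using dist_triangle[of x z y] d by (simp add: d_def)
      then show "hk S k x z \<le> B" using d k by (intro bound) (auto simp: m_def)
    qed (use d in simp)
    finally have "ip S f g \<le> B * (1 - survival ?A m x) + B * (1 - survival ?A' m' y)" by simp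
    also have "\<dots> \<le> B * (tail_const * exp (- (c * T))) + B * (tail_const * exp (- (c * T)))"
      using tail[OF Ex m(2)] tail[OF Ey m(3)] B by (intro add_mono mult_left_mono) auto
    also have "\<dots> = 2 * G * tail_const / Wt x n * (exp (c / 2 * T) * exp (- (c * T)))"
      by (simp add: B_def)
    also have "exp (c / 2 * T) * exp (- (c * T)) = exp (- (c / 2 * T))"
      by (simp flip: exp_add)
    also have "2 * G * tail_const / Wt x n * exp (- (c / 2 * T)) \<le> C / Wt x n * exp (- (c / 2 * T))"
      using C Wt_pos[of x n] by (intro mult_right_mono divide_right_mono) auto
    finally have "ip S f g \<le> C / Wt x n * exp (- (c / 2 * T))" .
    moreover have "heat_kernel w n x y = ip S f g"
      unfolding f_def g_def using heat_kernel_eq_hk[OF S(1,2), of y] S(1) m by (simp add: ip_hk)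
    ultimately show ?thesis by (simp add: T_def d_def)
  qed
  show ?thesis
    unfolding upper_estimate_def
  \<comment> \<open>The witness \<open>beta + 1\<close> turns 1 / (\<beta> - 1) into the exponent 1
    / \<open>beta\<close> of the exit tail.\<close>
  proof (rule exI[of _ "c / 2"], rule conjI[rotated], rule exI[of _ C], rule conjI[rotated], rule exI[of _ "beta + 1"], intro conjI allI impI)
    fix x y and n :: nat assume n: "1 \<le> n"
    show "heat_kernel w n x y \<le> C / V x (er x n) * exp (- (c / 2) * (E x (graph_dist w x y) / n) powr (1 / (beta + 1 - 1)))"
      using off[OF n, of x y] n by (simp add: Wt_def max_absorb1)
  qed (use c C beta_ge_1 in auto)
qed

end

theorem corollary2p2:
  fixes w :: "'v \<Rightarrow> 'v \<Rightarrow> real"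
  assumes "weighted_graph w"
    and "p0_condition w"
    and "volume_doubling w"
    and "time_comparison w"
  shows "(mean_exit_ineq w \<longleftrightarrow> eigenvalue_ineq w)
    \<and> (eigenvalue_ineq w \<longleftrightarrow> resistance_ineq w)
    \<and> (resistance_ineq w \<longleftrightarrow> diagonal_upper_estimate w)
    \<and> (diagonal_upper_estimate w \<longleftrightarrow> upper_estimate w)"
proof -
  from assms(2) obtain p0 where p0: "p0 > 0" "\<And>x y. adjacent w x y \<Longrightarrow> w x y / vertex_mass w x \<ge> p0"
    unfolding p0_condition_def by auto
  interpret bounded_prob_graph w p0
    using assms(1) p0 by (simp add: bounded_prob_graph_def bounded_prob_graph_axioms_def)
  from assms(3) obtain DV where DV: "\<And>x R. R > 0 \<Longrightarrow> volume w x (2 * R) \<le> DV * volume w x R"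
    unfolding volume_doubling_def by auto
  from assms(4) obtain CT where CT:
    "\<And>x y R. R > 0 \<Longrightarrow> y \<in> graph_ball w x R \<Longrightarrow> mean_exit_ball w y (2 * R) \<le> CT * mean_exit_ball w x R"
    unfolding time_comparison_def by auto
  \<comment> \<open>Enlarging the constants keeps both inequalities, since volumes and mean exit
    times are nonnegative.\<close>
  interpret doubling_graph w p0 "max DV 2" "max CT 2"
  proof
    fix x y :: 'v and R :: real assume R: "0 < R"
    have "DV * volume w x R \<le> max DV 2 * volume w x R"
      using volume_pos[OF R, of x] by (intro mult_right_mono) auto
    with DV[OF R, of x] show "volume w x (2 * R) \<le> max DV 2 * volume w x R" by simp
    assume y: "y \<in> graph_ball w x R"
    have "CT * mean_exit_ball w x R \<le> max CT 2 * mean_exit_ball w x R"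
      by (intro mult_right_mono) (auto simp: mean_exit_ball_def mean_exit_nonneg)
    with CT[OF R y] show "mean_exit_ball w y (2 * R) \<le> max CT 2 * mean_exit_ball w x R" by simp
  qed auto
  show ?thesis
    using mean_exit_ineq_imp_eigenvalue_ineq eigenvalue_ineq_imp_resistance_ineq
      resistance_ineq_imp_mean_exit_ineq eigenvalue_ineq_imp_diagonal_upper_estimate
      diagonal_upper_estimate_imp_mean_exit_ineq diagonal_upper_estimate_imp_upper_estimate
      upper_estimate_imp_diagonal_upper_estimate by blast
qed

end
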